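(* Let $T>0$, let $\beta>2$, and let $\lambda\in C^\beta[0,T]$ be real-valued. Let $\gamma$ be the Loewner curve generated by $\lambda$, parametrized by halfplane capacity. If $\beta+\tfrac12\notin\mathbb{N}$, then $\gamma\in C^{\beta+\frac12}[s_0,T]$ for every $s_0\in(0,T)$ (i.e. $\gamma\in C^{\beta+\frac12}(0,T]$). If $\beta+\tfrac12\in\mathbb{N}$, then $\gamma\in\Lambda_*^{\beta-\frac12}[s_0,T]$ for every $s_0\in(0,T)$ (i.e. $\gamma\in\Lambda_*^{\beta-\frac12}(0,T]$).
   Context: Chordal Loewner equation: for a continuous real function $\lambda$ on $[0,T]$ and $z\in\mathbb{H}=\{\operatorname{Im} z>0\}$, $g_t(z)$ solves $\partial_t g_t(z)=\frac{2}{g_t(z)-\lambda(t)}$, $g_0(z)=z$, up to $T_z=\inf\{t: g_t(z)=\lambda(t)\}$; $K_t=\{z\in\mathbb{H}:T_z\le t\}$, and $g_t:\mathbb{H}\setminus K_t\to\mathbb{H}$ is conformal with $g_t(z)=z+\frac{2t}{z}+O(z^{-2})$ at $\infty$. $\lambda$ generates the curve $\gamma:[0,T]\to\overline{\mathbb{H}}$ if, for each $t$, $\mathbb{H}\setminus K_t$ is the unbounded component of $\mathbb{H}\setminus\gamma(0,t]$; then $\lambda(t)=g_t(\gamma(t))$ and $\gamma$ is said to be parametrized by halfplane capacity. Function spaces on an interval $I$: for $n\in\mathbb{N}_0$, $\alpha\in[0,1]$, $M>0$, $\phi\in C^{n,\alpha}(I;M)$ means $\phi',\dots,\phi^{(n)}$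 exist and are continuous, $\sup_I|\phi^{(k)}|\le M$ for $0\le k\le n$, and $\sup_{s\ne t}\frac{|\phi^{(n)}(t)-\phi^{(n)}(s)|}{|t-s|^\alpha}\le M$; $C^{n,\alpha}(I)$ is the union over $M$; $C^n=C^{n,0}$; for $\alpha\in(0,1)$, $C^{n+\alpha}:=C^{n,\alpha}$. Zygmund class: $\phi\in\Lambda_*(I)$ if $\phi$ is continuous and $\sup_{\delta>0,\ s\pm\delta\in I}\frac{|\phi(s+\delta)+\phi(s-\delta)-2\phi(s)|}{\delta}<\infty$; $\phi\in\Lambda_*^n(I)$ if $\phi',\dots,\phi^{(n)}$ exist, are continuous and bounded, and $\phi^{(n)}\in\Lambda_*(I)$. *)

theory Defs
  imports "HOL-Analysis.Analysis"
begin

definition hoelder_space_M :: "nat \<Rightarrow> real \<Rightarrow> real set \<Rightarrow> real \<Rightarrow> (real \<Rightarrow> 'a::real_normed_vector) \<Rightarrow> bool" where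
  "hoelder_space_M n \<alpha> I M \<phi> \<longleftrightarrow>
     (\<exists>D :: nat \<Rightarrow> real \<Rightarrow> 'a.
        (\<forall>t\<in>I. D 0 t = \<phi> t) \<and>
        (\<forall>k<n. \<forall>t\<in>I. (D k has_vector_derivative D (Suc k) t) (at t within I)) \<and>
        (\<forall>k\<le>n. continuous_on I (D k)) \<and>
        (\<forall>k\<le>n. \<forall>t\<in>I. norm (D k t) \<le> M) \<and>
        (\<forall>s\<in>I. \<forall>t\<in>I. s \<noteq> t \<longrightarrow> norm (D n t - D n s) \<le> M * \<bar>t - s\<bar> powr \<alpha>))"

definition hoelder_space :: "nat \<Rightarrow> real \<Rightarrow> real set \<Rightarrow> (real \<Rightarrow> 'a::real_normed_vector) \<Rightarrow> bool" where
  "hoelder_space n \<alpha> I \<phi> \<longleftrightarrow> (\<exists>M>0. hoelder_space_M n \<alpha> I M \<phi>)"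

text \<open>C^beta for real beta >= 0: C^{floor beta, beta - floor beta}; this is C^{n,alpha}
for beta = n + alpha with alpha in (0,1), and C^n = C^{n,0} for integer beta.\<close>
definition C_beta :: "real \<Rightarrow> real set \<Rightarrow> (real \<Rightarrow> 'a::real_normed_vector) \<Rightarrow> bool" where
  "C_beta \<beta> I \<phi> \<longleftrightarrow> hoelder_space (nat \<lfloor>\<beta>\<rfloor>) (\<beta> - of_int \<lfloor>\<beta>\<rfloor>) I \<phi>"

definition zygmund_class :: "nat \<Rightarrow> real set \<Rightarrow> (real \<Rightarrow> 'a::real_normed_vector) \<Rightarrow> bool" where
  "zygmund_class n I \<phi> \<longleftrightarrow>
     (\<exists>D :: nat \<Rightarrow> real \<Rightarrow> 'a.
        (\<forall>t\<in>I. D 0 t = \<phi> t) \<and>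
        (\<forall>k<n. \<forall>t\<in>I. (D k has_vector_derivative D (Suc k) t) (at t within I)) \<and>
        (\<forall>k\<le>n. continuous_on I (D k)) \<and>
        (\<forall>k\<le>n. bounded (D k ` I)) \<and>
        (\<exists>C. \<forall>s \<delta>. \<delta> > 0 \<and> s - \<delta> \<in> I \<and> s + \<delta> \<in> I \<longrightarrow>
              norm (D n (s + \<delta>) + D n (s - \<delta>) - 2 *\<^sub>R D n s) \<le> C * \<delta>))"

definition upper_half_plane :: "complex set" where
  "upper_half_plane = {z. Im z > 0}"

text \<open>z is not in K_t iff the Loewner flow started at z exists on all of [0,t]
without hitting the driving function, i.e. T_z > t.\<close>
definition loewner_hull :: "(real \<Rightarrow> real) \<Rightarrow> real \<Rightarrow> complex set" where
  "loewner_hull lam t = {z \<in> upper_half_plane.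
     \<not> (\<exists>h :: real \<Rightarrow> complex. h 0 = z \<and>
          (\<forall>s\<in>{0..t}. h s \<noteq> complex_of_real (lam s) \<and>
             (h has_vector_derivative (2 / (h s - complex_of_real (lam s)))) (at s within {0..t})))}"

definition loewner_generates :: "(real \<Rightarrow> real) \<Rightarrow> real \<Rightarrow> (real \<Rightarrow> complex) \<Rightarrow> bool" where
  "loewner_generates lam T \<gamma> \<longleftrightarrow>
     continuous_on {0..T} lam \<and>
     continuous_on {0..T} \<gamma> \<and> \<gamma> ` {0..T} \<subseteq> closure upper_half_plane \<and>
     (\<forall>t\<in>{0..T}.
        (\<exists>x. upper_half_plane - loewner_hull lam t =
               connected_component_set (upper_half_plane - \<gamma> ` {0<..t}) x) \<and>
        \<not> bounded (upper_half_plane - loewner_hull lam t))"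

end

theory Submission
  imports Defs
begin

text \<open>The tip of the hull is \<open>\<gamma>(t) = \<lambda>(0) + w\<^sub>t(t)\<close>, where \<open>w\<^sub>t\<close> is the backward flow
  \<open>w' = - 2 / w + \<lambda>'(t - s)\<close> started at the singularity \<open>w = 0\<close>; passing to \<open>w\<^sup>2\<close> removes the singularity.
  In the scaling \<open>w\<^sub>t(t \<rho>\<^sup>2) = t\<^sup>1\<^sup>/\<^sup>2 \<rho> V(\<rho>, t)\<close> the function \<open>V\<close> is as smooth in \<open>t\<close> as \<open>\<lambda>'\<close>,
  uniformly in \<open>\<rho>\<close>, because the difference of two flows solves a linear equation exactly.  This gives
  \<open>\<gamma>'(t) = \<i> t\<^sup>-\<^sup>1\<^sup>/\<^sup>2 exp (\<integral>\<^sub>0\<^sup>1 X(\<rho>, t) d\<rho>)\<close> and \<open>\<gamma>''(t) = \<integral>\<^sub>0\<^sup>1 a(\<rho>, t) d\<rho>\<close>, where \<open>a\<close> is as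
  smooth in \<open>t\<close> as \<open>\<lambda>''\<close> and \<open>\<rho>\<^sup>2 a\<close> has one derivative more.  Splitting the integral at
  \<open>\<rho> = |s - t|\<^sup>1\<^sup>/\<^sup>2\<close> when comparing times \<open>s\<close> and \<open>t\<close> yields the additional half derivative, with the
  Zygmund class in the critical case.  Finally, comparing an arbitrary flow line with \<open>w\<close> through the squares
  shows that the hull consists exactly of the tips; as the curve of tips has no interior, it is
  the only curve that can generate this hull.\<close>

section \<open>The backward flow issuing from the singularity\<close>

text \<open>The obstacle is the start at \<open>w = 0\<close>. Near it \<open>w\<^sup>2\<close> is
  close to \<open>- 4 s\<close>, so the linearised coefficient \<open>2 / w\<^sup>2\<close> is close
  to \<open>- 1 / (2 s)\<close>, which is not integrable, and the usual variational equation in t is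
  useless. The singular part is explicit, however: in the variable \<rho> its homogeneous solution
  is \<open>1 / \<rho>\<close>, so a factor \<rho> removes it and leaves the bounded coefficient
  \<open>x12\<close> with the integrating factor \<open>exp J\<close>. Differentiating the forcing
  term directly would produce \<lambda>'' at a shifted time, and a factor
  \<open>\<rho>\<^sup>2\<close> gains nothing there. Subtracting its primitive brings in the
  difference quotients \<open>Xi\<close> instead. A quotient has one derivative less than the
  function, but \<open>\<rho>\<^sup>2\<close> times it loses none, and the t-derivative of that
  product is of size \<open>\<rho> powr (2 * \<alpha>)\<close>, by Hoelder continuity over the time
  lapse \<open>t * \<rho>\<^sup>2\<close>. The two available estimates balance at
  \<open>\<rho>\<^sup>2 = |s - t|\<close>, and the length of the inner interval is the half power
  gained. Throughout \<alpha> lies in (0, 1]: an integer \<beta> is read as \<open>n + 1\<close>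
  with \<alpha> = 1, so one argument serves all \<beta>.\<close>

text \<open>The Lipschitz bound is global in space, so the Picard iterates obey the factorial bound
  \<open>M * (L' * t) ^ n / fact n\<close> and converge uniformly on all of \<open>{0..T}\<close> at
  once; no continuation of local solutions is involved.\<close>

lemma global_picard:
  fixes f :: "real \<Rightarrow> 'a::banach \<Rightarrow> 'a"
  assumes T: "0 \<le> T"
    and cont: "continuous_on ({0..T} \<times> UNIV) (\<lambda>(t, x). f t x)"
    and lip: "\<And>t x y. t \<in> {0..T} \<Longrightarrow> norm (f t x - f t y) \<le> L * norm (x - y)"
  obtains x where "x 0 = x0"
    "\<And>t. t \<in> {0..T} \<Longrightarrow> (x has_vector_derivative f t (x t)) (at t within {0..T})"
proof -
  have L0: "0 \<le> L" if "norm (a - b) > 0" for a b :: 'a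
  proof -
    have "0 \<le> norm (f 0 a - f 0 b)" by simp
    also have "\<dots> \<le> L * norm (a - b)" using lip[of 0 a b] T by simp
    finally show ?thesis using that by (simp add: zero_le_mult_iff)
  qed
  \<comment> \<open>\<open>L\<close> may be negative when the space is trivial; \<open>L'\<close> is
    nonnegative in every case.\<close>
  define L' where "L' = max L 0"
  have L': "L' \<ge> 0" by (simp add: L'_def)
  have lip': "norm (f t x - f t y) \<le> L' * norm (x - y)" if "t \<in> {0..T}" for t x y
    using lip[OF that, of x y] mult_right_mono[of L L' "norm (x - y)"] by (simp add: L'_def)
  have cf: "continuous_on {0..T} (\<lambda>s. f s (g s))" if "continuous_on {0..T} g" for g
  proof -
    have "continuous_on {0..T} (\<lambda>s. (\<lambda>(t, x). f t x) (s, g s))"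
      by (rule continuous_on_compose2[OF cont]) (auto intro!: continuous_intros that)
    then show ?thesis by simp
  qed
  define X where "X = rec_nat (\<lambda>t. x0) (\<lambda>n g t. x0 + integral {0..t} (\<lambda>s. f s (g s)))"
  have X0: "X 0 = (\<lambda>t. x0)" and XS: "X (Suc n) = (\<lambda>t. x0 + integral {0..t} (\<lambda>s. f s (X n s)))" for n
    by (simp_all add: X_def)
  have cX: "continuous_on {0..T} (X n)" for n
  proof (induction n)
    case (Suc n)
    show ?case unfolding XS
      by (intro continuous_intros indefinite_integral_continuous_1 integrable_continuous_real cf Suc)
  qed (simp add: X0)
  have int: "(\<lambda>s. f s (X n s)) integrable_on {0..t}" if "t \<in> {0..T}" for n t
    by (rule integrable_continuous_real, rule continuous_on_subset[OF cf[OF cX]]) (use that in auto)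
  have "compact ((\<lambda>t. X (Suc 0) t - X 0 t) ` {0..T})"
    by (intro compact_continuous_image continuous_intros cX compact_Icc)
  then obtain M where M: "\<And>t. t \<in> {0..T} \<Longrightarrow> norm (X (Suc 0) t - X 0 t) \<le> M"
    by (metis (no_types, lifting) compact_imp_bounded bounded_iff image_eqI)
  have step: "norm (X (Suc n) t - X n t) \<le> M * (L' * t) ^ n / fact n" if "t \<in> {0..T}" for n t
    using that
  proof (induction n arbitrary: t)
    case 0
    then show ?case using M[of t] by simp
  next
    case (Suc n)
    have "norm (X (Suc (Suc n)) t - X (Suc n) t)
        = norm (integral {0..t} (\<lambda>s. f s (X (Suc n) s) - f s (X n s)))"
      unfolding integral_diff[OF int[OF Suc.prems] int[OF Suc.prems]]
      by (subst XS[of "Suc n"], subst XS[of n]) simp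
    also have "\<dots> \<le> integral {0..t} (\<lambda>s. L' * (M * (L' * s) ^ n / fact n))"
    proof (rule integral_norm_bound_integral)
      show "(\<lambda>s. f s (X (Suc n) s) - f s (X n s)) integrable_on {0..t}"
        by (intro integrable_diff int Suc.prems)
      show "(\<lambda>s. L' * (M * (L' * s) ^ n / fact n)) integrable_on {0..t}"
        by (intro integrable_continuous_real continuous_intros) auto
      fix s assume "s \<in> {0..t}"
      then have s: "s \<in> {0..T}" using Suc.prems by auto
      show "norm (f s (X (Suc n) s) - f s (X n s)) \<le> L' * (M * (L' * s) ^ n / fact n)"
        using lip'[OF s, of "X (Suc n) s" "X n s"] mult_left_mono[OF Suc.IH[OF s] L'] by linarith
    qed
    also have "\<dots> = M * (L' * t) ^ Suc n / fact (Suc n)"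
    proof (rule integral_unique)
      have "((\<lambda>s. L' * (M * (L' * s) ^ n / fact n)) has_integral
          (M * (L' * t) ^ Suc n / fact (Suc n) - M * (L' * 0) ^ Suc n / fact (Suc n))) {0..t}"
      proof (rule fundamental_theorem_of_calculus)
        show "0 \<le> t" using Suc.prems by simp
        fix s :: real
        have "((\<lambda>s. M * (L' * s) ^ Suc n / fact (Suc n)) has_field_derivative
           M * ((1 + of_nat n) * (L' * (L' * s) ^ n)) / fact (Suc n)) (at s within {0..t})"
          by (intro DERIV_cdivide DERIV_cmult DERIV_power_Suc DERIV_cmult_Id)
        also have "M * ((1 + of_nat n) * (L' * (L' * s) ^ n)) / fact (Suc n) = L' * (M * (L' * s) ^ n / fact n)"
          unfolding fact_Suc by (simp add: divide_simps)
        finally show "((\<lambda>s. M * (L' * s) ^ Suc n / fact (Suc n)) has_vector_derivative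
           L' * (M * (L' * s) ^ n / fact n)) (at s within {0..t})"
          by (simp add: has_real_derivative_iff_has_vector_derivative)
      qed
      then show "((\<lambda>s. L' * (M * (L' * s) ^ n / fact n)) has_integral
          (M * (L' * t) ^ Suc n / fact (Suc n))) {0..t}" by simp
    qed
    finally show ?case .
  qed
  have M0: "0 \<le> M" using M[of 0] T norm_ge_zero order_trans by (metis atLeastAtMost_iff order_refl)
  define x where "x t = x0 + (\<Sum>n. X (Suc n) t - X n t)" for t
  have "uniform_limit {0..T} (\<lambda>n t. \<Sum>i<n. X (Suc i) t - X i t) (\<lambda>t. \<Sum>i. X (Suc i) t - X i t) sequentially"
  proof (rule Weierstrass_m_test)
    show "norm (X (Suc n) t - X n t) \<le> M * ((L' * T) ^ n / fact n)" if "t \<in> {0..T}" for n t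
    proof -
      have "(L' * t) ^ n \<le> (L' * T) ^ n" using that L' by (intro power_mono mult_left_mono) auto
      then have "M * (L' * t) ^ n / fact n \<le> M * (L' * T) ^ n / fact n"
        using M0 by (intro divide_right_mono mult_left_mono) auto
      with step[OF that, of n] show ?thesis by simp
    qed
    show "summable (\<lambda>n. M * ((L' * T) ^ n / fact n))"
      using summable_exp[of "L' * T"] by (intro summable_mult) (simp add: field_simps)
  qed
  moreover have "(\<Sum>i<n. X (Suc i) t - X i t) = X n t - x0" for n t
    using sum_lessThan_telescope[of "\<lambda>n. X n t" n] by (simp add: X0)
  ultimately have ul: "uniform_limit {0..T} X x sequentially"
    by (simp add: uniform_limit_iff dist_norm x_def algebra_simps)
  have cx: "continuous_on {0..T} x"
    by (rule uniform_limit_theorem[OF _ ul]) (auto simp: cX)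
  have ulf: "uniform_limit {0..T} (\<lambda>n s. f s (X n s)) (\<lambda>s. f s (x s)) sequentially"
    unfolding uniform_limit_iff
  proof (intro allI impI)
    fix e :: real assume e: "e > 0"
    have "\<forall>\<^sub>F n in sequentially. \<forall>s\<in>{0..T}. dist (X n s) (x s) < e / (L' + 1)"
      using ul e L' unfolding uniform_limit_iff by (auto simp: add_nonneg_pos)
    then show "\<forall>\<^sub>F n in sequentially. \<forall>s\<in>{0..T}. dist (f s (X n s)) (f s (x s)) < e"
    proof (eventually_elim, intro ballI)
      fix n s assume *: "\<forall>s\<in>{0..T}. dist (X n s) (x s) < e / (L' + 1)" and s: "s \<in> {0..T}"
      have "dist (f s (X n s)) (f s (x s)) \<le> (L' + 1) * dist (X n s) (x s)"
        using lip'[OF s, of "X n s" "x s"] norm_ge_zero[of "X n s - x s"]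
          unfolding dist_norm distrib_right by linarith
      also have "\<dots> < e" using *[rule_format, OF s] L' by (simp add: field_simps)
      finally show "dist (f s (X n s)) (f s (x s)) < e" .
    qed
  qed
  have eq: "x t = x0 + integral {0..t} (\<lambda>s. f s (x s))" if t: "t \<in> {0..T}" for t
  proof -
    have ul': "uniform_limit {0..t} (\<lambda>n s. f s (X n s)) (\<lambda>s. f s (x s)) sequentially"
      by (rule uniform_limit_on_subset[OF ulf]) (use t in auto)
    have c': "continuous_on {0..t} (\<lambda>s. f s (X n s))" for n
      by (rule continuous_on_subset[OF cf[OF cX]]) (use t in auto)
    obtain I J where I: "\<And>n. ((\<lambda>s. f s (X n s)) has_integral I n) {0..t}"
        "((\<lambda>s. f s (x s)) has_integral J) {0..t}" "I \<longlonglongrightarrow> J"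
      using uniform_limit_integral[OF ul' c'] by auto
    have "X (Suc n) t = x0 + I n" for n
      by (simp add: XS integral_unique[OF I(1)])
    with I(3) have "(\<lambda>n. X (Suc n) t) \<longlonglongrightarrow> x0 + J"
      by (auto intro!: tendsto_intros)
    moreover have "(\<lambda>n. X (Suc n) t) \<longlonglongrightarrow> x t"
      by (rule LIMSEQ_Suc) (use tendsto_uniform_limitI[OF ul t] in simp)
    ultimately show ?thesis using I(2) LIMSEQ_unique by (metis integral_unique)
  qed
  show thesis
  proof (rule that)
    show "x 0 = x0" using eq[of 0] T by simp
    fix t assume t: "t \<in> {0..T}"
    have "((\<lambda>t. x0 + integral {0..t} (\<lambda>s. f s (x s))) has_vector_derivative f t (x t)) (at t within {0..T})"
      using integral_has_vector_derivative[OF cf[OF cx] t]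
      by (auto intro!: derivative_eq_intros)
    then show "(x has_vector_derivative f t (x t)) (at t within {0..T})"
      by (rule has_vector_derivative_transform[OF t _, rotated]) (simp add: eq)
  qed
qed

text \<open>Gronwall in differential form: \<open>(norm d)\<^sup>2 * exp (- k)\<close> does not
  increase. Only the real part of \<open>q\<close> enters, so stretches on which the equation
  contracts cost nothing; and \<open>k\<close> is differentiated in the open interval only, which
  admits weights such as \<open>sqrt s\<close> with a derivative singular at 0.\<close>

lemma linear_ode_growth:
  fixes d q :: "real \<Rightarrow> complex" and k k' :: "real \<Rightarrow> real"
  assumes ab: "a \<le> b" and cd: "continuous_on {a..b} d" and ck: "continuous_on {a..b} k"
    and der: "\<And>s. a < s \<Longrightarrow> s < b \<Longrightarrow> (d has_vector_derivative q s * d s) (at s)"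
    and derk: "\<And>s. a < s \<Longrightarrow> s < b \<Longrightarrow> (k has_real_derivative k' s) (at s)"
    and le: "\<And>s. a < s \<Longrightarrow> s < b \<Longrightarrow> 2 * Re (q s) \<le> k' s"
  shows "(norm (d b))\<^sup>2 \<le> exp (k b - k a) * (norm (d a))\<^sup>2"
proof -
  define g where "g s = (norm (d s))\<^sup>2 * exp (- k s)" for s
  have "g b \<le> g a"
  proof (rule DERIV_nonpos_imp_decreasing_open[OF ab])
    show "continuous_on {a..b} g" unfolding g_def by (intro continuous_intros cd ck)
    fix s assume s: "a < s" "s < b"
    have "((\<lambda>s. d s \<bullet> d s) has_vector_derivative (d s \<bullet> (q s * d s) + (q s * d s) \<bullet> d s)) (at s)"
      by (rule bounded_bilinear.has_vector_derivative[OF bounded_bilinear_inner]) (use der[OF s] in auto)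
    also have "d s \<bullet> (q s * d s) + (q s * d s) \<bullet> d s = 2 * Re (q s) * (norm (d s))\<^sup>2"
      unfolding cmod_power2 by (simp add: inner_complex_def algebra_simps power2_eq_square)
    finally have "((\<lambda>s. (norm (d s))\<^sup>2) has_real_derivative 2 * Re (q s) * (norm (d s))\<^sup>2) (at s)"
      by (simp add: has_real_derivative_iff_has_vector_derivative power2_norm_eq_inner)
    moreover have "((\<lambda>s. exp (- k s)) has_real_derivative exp (- k s) * - k' s) (at s)"
      using derk[OF s] by (auto intro!: derivative_eq_intros)
    ultimately have "(g has_real_derivative (2 * Re (q s) - k' s) * g s) (at s)"
      unfolding g_def by (rule DERIV_mult[THEN DERIV_cong]) (simp add: algebra_simps)
    moreover have "(2 * Re (q s) - k' s) * g s \<le> 0"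
      using le[OF s] by (intro mult_nonpos_nonneg) (auto simp: g_def)
    ultimately show "\<exists>y. (g has_real_derivative y) (at s) \<and> y \<le> 0" by blast
  qed
  then have "exp (k b) * g b \<le> exp (k b) * g a" by simp
  then show ?thesis by (simp add: g_def exp_minus exp_diff field_simps)
qed

section \<open>The regularised backward flow\<close>

text \<open>Clipping the imaginary part from below at \<open>y\<close> makes \<open>2 / z\<close>
  globally Lipschitz, as \<open>global_picard\<close> requires. Along both flows the imaginary part
  is monotone, so whether the clipping ever acts is decided at one end of the time interval.\<close>

definition lift_Im :: "real \<Rightarrow> complex \<Rightarrow> complex" where
  "lift_Im y z = complex_of_real (Re z) + \<i> * complex_of_real (max y (Im z))"

lemma lift_Im_simps [simp]: "Re (lift_Im y z) = Re z" "Im (lift_Im y z) = max y (Im z)"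
  by (simp_all add: lift_Im_def)

lemma lift_Im_eq: "y \<le> Im z \<Longrightarrow> lift_Im y z = z"
  by (simp add: complex_eq_iff)

lemma norm_lift_Im_ge: "y > 0 \<Longrightarrow> y \<le> norm (lift_Im y z)"
  using abs_Im_le_cmod[of "lift_Im y z"] by simp

lemma continuous_on_lift_Im [continuous_intros]:
  "continuous_on S f \<Longrightarrow> continuous_on S (\<lambda>x. lift_Im y (f x))"
  unfolding lift_Im_def by (intro continuous_intros)

lemma lift_Im_lipschitz: "norm (lift_Im y a - lift_Im y b) \<le> norm (a - b)"
proof -
  have "\<bar>max y (Im a) - max y (Im b)\<bar> \<le> \<bar>Im a - Im b\<bar>" by (auto simp: max_def)
  then have "(max y (Im a) - max y (Im b))\<^sup>2 \<le> (Im a - Im b)\<^sup>2" by (simp add: abs_le_square_iff)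
  then show ?thesis unfolding cmod_def by (intro real_sqrt_le_mono) simp
qed

lemma inverse_lift_Im_lipschitz:
  assumes "y > 0"
  shows "norm (c / lift_Im y a - c / lift_Im y b) \<le> norm c / y\<^sup>2 * norm (a - b)"
proof -
  have n: "lift_Im y a \<noteq> 0" "lift_Im y b \<noteq> 0"
    using norm_lift_Im_ge[OF assms, of a] norm_lift_Im_ge[OF assms, of b] assms by auto
  then have "c / lift_Im y a - c / lift_Im y b = c * (lift_Im y b - lift_Im y a) / (lift_Im y a * lift_Im y b)"
    by (simp add: field_simps)
  then have "norm (c / lift_Im y a - c / lift_Im y b)
      = norm c * norm (lift_Im y a - lift_Im y b) / (norm (lift_Im y a) * norm (lift_Im y b))"
    by (simp add: norm_mult norm_divide norm_minus_commute)
  also have "\<dots> \<le> norm c * norm (a - b) / (y * y)"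
    using norm_lift_Im_ge[OF assms, of a] norm_lift_Im_ge[OF assms, of b] assms
    by (intro frac_le mult_left_mono mult_mono lift_Im_lipschitz) auto
  finally show ?thesis by (simp add: power2_eq_square)
qed

lemma has_vector_derivative_Im:
  "(f has_vector_derivative f') F \<Longrightarrow> ((\<lambda>x. Im (f x)) has_vector_derivative Im f') F"
  by (rule bounded_linear.has_vector_derivative[OF bounded_linear_Im])

lemma has_vector_derivative_interior:
  "(f has_vector_derivative f') (at s within {a..b}) \<Longrightarrow> a < s \<Longrightarrow> s < b \<Longrightarrow> (f has_vector_derivative f') (at s)"
  for s :: real
  by (simp add: at_within_Icc_at)

lemma has_vector_derivative_imp_continuous_on:
  "(\<And>s. s \<in> S \<Longrightarrow> (f has_vector_derivative f' s) (at s within S)) \<Longrightarrow> continuous_on S f"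
  using has_vector_derivative_continuous continuous_on_eq_continuous_within by blast

text \<open>The clipped equation has a global solution. Since \<open>- 2 / z\<close> has nonnegative
  imaginary part in the upper half-plane, the imaginary part increases from its initial value
  \<open>y\<close>; the clipping is never active and the original equation holds.\<close>

lemma regular_backward_flow:
  fixes \<nu> :: "real \<Rightarrow> real"
  assumes t: "0 \<le> t" and c: "continuous_on {0..t} \<nu>" and y: "y > 0"
  obtains w where "w 0 = \<i> * complex_of_real y"
    "\<And>s. s \<in> {0..t} \<Longrightarrow> (w has_vector_derivative (- 2 / w s + complex_of_real (\<nu> s))) (at s within {0..t})"
    "\<And>r s. 0 \<le> r \<Longrightarrow> r \<le> s \<Longrightarrow> s \<le> t \<Longrightarrow> Im (w r) \<le> Im (w s)"
proof -
  have nz: "lift_Im y z \<noteq> 0" for z using norm_lift_Im_ge[OF y, of z] y by auto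
  obtain w where w0: "w 0 = \<i> * complex_of_real y" and
    wd: "\<And>s. s \<in> {0..t} \<Longrightarrow> (w has_vector_derivative (- 2 / lift_Im y (w s) + complex_of_real (\<nu> s))) (at s within {0..t})"
  proof (rule global_picard[OF t, of "\<lambda>s z. - 2 / lift_Im y z + complex_of_real (\<nu> s)" "2 / y\<^sup>2" "\<i> * complex_of_real y"])
    show "continuous_on ({0..t} \<times> UNIV) (\<lambda>(s, z). - 2 / lift_Im y z + complex_of_real (\<nu> s))"
      unfolding case_prod_beta
      by (intro continuous_intros continuous_on_compose2[OF c]) (auto simp: nz)
    show "norm (- 2 / lift_Im y a + complex_of_real (\<nu> s) - (- 2 / lift_Im y b + complex_of_real (\<nu> s)))
      \<le> 2 / y\<^sup>2 * norm (a - b)" for s a b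
      using inverse_lift_Im_lipschitz[OF y, of "-2" a b] by simp
  qed blast
  have mono: "Im (w r) \<le> Im (w s)" if rs: "0 \<le> r" "r \<le> s" "s \<le> t" for r s
  proof (rule DERIV_nonneg_imp_increasing_open[OF \<open>r \<le> s\<close>])
    show "continuous_on {r..s} (\<lambda>s. Im (w s))"
      by (intro continuous_intros continuous_on_subset[OF has_vector_derivative_imp_continuous_on[OF wd]])
        (use rs in auto)
    fix x assume x: "r < x" "x < s"
    have "((\<lambda>x. Im (w x)) has_vector_derivative Im (- 2 / lift_Im y (w x) + complex_of_real (\<nu> x))) (at x)"
      by (rule has_vector_derivative_Im, rule has_vector_derivative_interior[OF wd]) (use x rs in auto)
    moreover have "Im (- 2 / lift_Im y (w x) + complex_of_real (\<nu> x)) \<ge> 0"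
      using y by (simp add: Im_divide zero_le_divide_iff)
    ultimately show "\<exists>d. ((\<lambda>x. Im (w x)) has_real_derivative d) (at x) \<and> 0 \<le> d"
      by (auto simp: has_real_derivative_iff_has_vector_derivative)
  qed
  show thesis
  proof (rule that[of w])
    show "w 0 = \<i> * complex_of_real y" by (rule w0)
    show "\<And>r s. 0 \<le> r \<Longrightarrow> r \<le> s \<Longrightarrow> s \<le> t \<Longrightarrow> Im (w r) \<le> Im (w s)" by (rule mono)
    fix s assume s: "s \<in> {0..t}"
    have "y \<le> Im (w s)" using mono[of 0 s] s w0 by simp
    then show "(w has_vector_derivative (- 2 / w s + complex_of_real (\<nu> s))) (at s within {0..t})"
      using wd[OF s] by (simp add: lift_Im_eq)
  qed
qed

text \<open>Everything is read off the square \<open>u = w\<^sup>2\<close>, for which the singular equation becomes \<open>u' = - 4 + 2 w \<nu>\<close>.\<close>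
lemma backward_flow_apriori:
  fixes \<nu> :: "real \<Rightarrow> real" and w :: "real \<Rightarrow> complex"
  assumes cw: "continuous_on {0..t} w"
    and wd: "\<And>s. 0 < s \<Longrightarrow> s < t \<Longrightarrow> (w has_vector_derivative (- 2 / w s + complex_of_real (\<nu> s))) (at s)"
    and nz: "\<And>s. 0 < s \<Longrightarrow> s < t \<Longrightarrow> w s \<noteq> 0"
    and L: "\<And>s. s \<in> {0..t} \<Longrightarrow> \<bar>\<nu> s\<bar> \<le> L"
    and s: "0 \<le> s" "s \<le> t"
  shows "norm (w s) \<le> norm (w 0) + 2 * sqrt s + 2 * L * s"
    "norm ((w s)\<^sup>2 + complex_of_real (4 * s) - (w 0)\<^sup>2) \<le> 2 * L * s * (norm (w 0) + 2 * sqrt s + 2 * L * s)"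
proof -
  have L0: "L \<ge> 0" using L[of s] s by auto
  have "continuous_on {0..s} (\<lambda>s. norm (w s))"
    by (intro continuous_intros continuous_on_subset[OF cw]) (use s in auto)
  then obtain r where r: "r \<in> {0..s}" and rm: "\<And>x. x \<in> {0..s} \<Longrightarrow> norm (w x) \<le> norm (w r)"
    using continuous_attains_sup[of "{0..s}" "\<lambda>s. norm (w s)"] s by auto
  define m where "m = norm (w r)"
  define g where "g x = (w x)\<^sup>2 + complex_of_real (4 * x)" for x
  have g: "norm (g x - g 0) \<le> 2 * L * m * x" if x: "x \<in> {0..s}" for x
  proof (cases "x = 0")
    case False
    then have x0: "0 < x" using x by simp
    have "norm (g x - g 0) \<le> 2 * L * m * x - 2 * L * m * 0"
    proof (rule differentiable_bound_general[OF x0, of g "\<lambda>x. 2 * L * m * x" "\<lambda>x. 2 * w x * complex_of_real (\<nu> x)" "\<lambda>x. 2 * L * m"])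
      show "continuous_on {0..x} g" unfolding g_def
        by (intro continuous_intros continuous_on_subset[OF cw]) (use x s in auto)
      fix z assume z: "0 < z" "z < x"
      then have zt: "z < t" and zs: "z \<in> {0..s}" using x s by auto
      have "(g has_vector_derivative (2 * (- 2 / w z + complex_of_real (\<nu> z)) * w z + complex_of_real 4)) (at z)"
        unfolding g_def power2_eq_square
        by (auto intro!: derivative_eq_intros wd[OF z(1) zt] simp: algebra_simps)
      then show "(g has_vector_derivative 2 * w z * complex_of_real (\<nu> z)) (at z)"
        using nz[OF z(1) zt] by (simp add: algebra_simps)
      have "norm (w z) * \<bar>\<nu> z\<bar> \<le> m * L"
        using rm[OF zs] L[of z] z zt L0 by (intro mult_mono) (auto simp: m_def)
      then show "norm (2 * w z * complex_of_real (\<nu> z)) \<le> 2 * L * m"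
        by (simp add: norm_mult algebra_simps)
      show "((*) (2 * L * m) has_vector_derivative 2 * L * m) (at z)"
        by (auto intro!: derivative_eq_intros simp flip: has_real_derivative_iff_has_vector_derivative)
    qed (intro continuous_intros)
    then show ?thesis by simp
  qed simp
  have m0: "m \<ge> 0" by (simp add: m_def)
  \<comment> \<open>At the point where the maximum \<open>m\<close> is attained, the estimate for
    \<open>g\<close> gives \<open>m * (m - 2 * L * s) \<le> (norm (w 0))\<^sup>2 + 4 * s \<le> ?a *
    ?a\<close>. If \<open>m\<close> exceeded \<open>?a + 2 * L * s\<close>, both factors on the left
    would exceed \<open>?a\<close>.\<close>
  have mb: "m \<le> norm (w 0) + 2 * sqrt s + 2 * L * s"
  proof (rule ccontr)
    assume *: "\<not> ?thesis"
    let ?a = "norm (w 0) + 2 * sqrt s"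
    have a0: "?a \<ge> 0" using s by simp
    have "m\<^sup>2 = norm ((g r - g 0) + (w 0)\<^sup>2 - complex_of_real (4 * r))"
      by (simp add: m_def g_def norm_power)
    also have "\<dots> \<le> norm (g r - g 0) + norm ((w 0)\<^sup>2) + norm (complex_of_real (4 * r))"
      by (intro order_trans[OF norm_triangle_ineq4] add_right_mono norm_triangle_ineq)
    also have "\<dots> \<le> 2 * L * m * r + (norm (w 0))\<^sup>2 + 4 * r"
      using g[OF r] r by (simp add: norm_power)
    also have "\<dots> \<le> 2 * L * m * s + (norm (w 0))\<^sup>2 + 4 * s"
      using r L0 m0 by (intro add_mono mult_left_mono mult_nonneg_nonneg) auto
    finally have 1: "m * (m - 2 * L * s) \<le> (norm (w 0))\<^sup>2 + 4 * s"
      by (simp add: algebra_simps power2_eq_square)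
    have "?a * ?a = (norm (w 0))\<^sup>2 + 4 * (sqrt s * sqrt s) + 4 * (norm (w 0) * sqrt s)"
      by algebra
    moreover have "norm (w 0) * sqrt s \<ge> 0" "sqrt s * sqrt s = s" using s by auto
    ultimately have 2: "?a * ?a \<ge> (norm (w 0))\<^sup>2 + 4 * s" by linarith
    have "L * s \<ge> 0" using L0 s by simp
    then have "?a * ?a < m * (m - 2 * L * s)"
      using * a0 by (intro mult_strict_mono') auto
    with 1 2 show False by linarith
  qed
  then show "norm (w s) \<le> norm (w 0) + 2 * sqrt s + 2 * L * s"
    using rm[of s] s by (simp add: m_def)
  have "norm ((w s)\<^sup>2 + complex_of_real (4 * s) - (w 0)\<^sup>2) \<le> 2 * L * s * m"
    using g[of s] s by (simp add: g_def algebra_simps)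
  also have "\<dots> \<le> 2 * L * s * (norm (w 0) + 2 * sqrt s + 2 * L * s)"
    using mb L0 s by (intro mult_left_mono) auto
  finally show "norm ((w s)\<^sup>2 + complex_of_real (4 * s) - (w 0)\<^sup>2) \<le> 2 * L * s * (norm (w 0) + 2 * sqrt s + 2 * L * s)" .
qed

section \<open>The flow started at the singularity\<close>

text \<open>The flow is the uniform limit of flows started at \<open>\<i> * y\<close> with
  \<open>y\<close> tending to 0. The smallness condition keeps these in the cone
  \<open>|Re| \<le> Im\<close> up to time \<open>s1\<close>, where the equation for their
  differences is contracting; afterwards they stay away from 0 and the coefficient is
  bounded.\<close>

lemma singular_backward_flow_aux:
  fixes \<nu> :: "real \<Rightarrow> real"
  assumes t: "0 < t" and c\<nu>: "continuous_on {0..t} \<nu>" and L: "\<And>s. s \<in> {0..t} \<Longrightarrow> \<bar>\<nu> s\<bar> \<le> L"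
    and s1: "0 < s1" and y1: "0 < y1"
    and small: "\<And>y s. 0 \<le> y \<Longrightarrow> y \<le> y1 \<Longrightarrow> 0 \<le> s \<Longrightarrow> s \<le> s1 \<Longrightarrow> 2 * L * (y + 2 * sqrt s + 2 * L * s) \<le> 1"
  shows "\<exists>w. continuous_on {0..t} w \<and> w 0 = 0 \<and>
    (\<forall>s\<in>{0<..<t}. (w has_vector_derivative (- 2 / w s + complex_of_real (\<nu> s))) (at s)) \<and>
    (\<forall>s\<in>{0..t}. Im (w s) \<ge> sqrt (3 * min s s1) \<and> norm (w s) \<le> 2 * sqrt s + 2 * L * s \<and>
       norm ((w s)\<^sup>2 + complex_of_real (4 * s)) \<le> 2 * L * s * (2 * sqrt s + 2 * L * s))"
proof -
  define y where "y n = y1 / real (Suc n)" for n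
  have y: "y n > 0" "y n \<le> y1" for n using y1 by (auto simp: y_def field_simps)
  have ylim: "y \<longlonglongrightarrow> 0"
    unfolding y_def using LIMSEQ_Suc[OF lim_const_over_n[of y1]] by simp
  define P where "P n w \<longleftrightarrow> w 0 = \<i> * complex_of_real (y n) \<and>
    (\<forall>s\<in>{0..t}. (w has_vector_derivative (- 2 / w s + complex_of_real (\<nu> s))) (at s within {0..t})) \<and>
    (\<forall>r s. 0 \<le> r \<longrightarrow> r \<le> s \<longrightarrow> s \<le> t \<longrightarrow> Im (w r) \<le> Im (w s))" for n w
  have "\<exists>w. P n w" for n
    by (rule regular_backward_flow[OF less_imp_le[OF t] c\<nu> y(1)[of n]]) (auto simp: P_def)
  then obtain W where W: "\<And>n. P n (W n)" by metis
  have W0: "W n 0 = \<i> * complex_of_real (y n)" for n using W by (auto simp: P_def)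
  have Wd: "(W n has_vector_derivative (- 2 / W n s + complex_of_real (\<nu> s))) (at s within {0..t})" if "s \<in> {0..t}" for n s
    using W that by (auto simp: P_def)
  have Wm: "Im (W n r) \<le> Im (W n s)" if "0 \<le> r" "r \<le> s" "s \<le> t" for n r s
    using W that by (auto simp: P_def)
  have Wc: "continuous_on {0..t} (W n)" for n
    by (rule has_vector_derivative_imp_continuous_on[OF Wd])
  have Wi: "(W n has_vector_derivative (- 2 / W n s + complex_of_real (\<nu> s))) (at s)" if "0 < s" "s < t" for n s
    by (rule has_vector_derivative_interior[OF Wd]) (use that in auto)
  have Wy: "y n \<le> Im (W n s)" if "s \<in> {0..t}" for n s
    using Wm[of 0 s n] that by (simp add: W0)
  have Wnz: "W n s \<noteq> 0" if "s \<in> {0..t}" for n s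
    using Wy[OF that, of n] y(1)[of n] by auto
  have nW0: "norm (W n 0) = y n" "(W n 0)\<^sup>2 = - complex_of_real ((y n)\<^sup>2)" for n
    using y(1)[of n] by (auto simp: W0 norm_mult power_mult_distrib)
  have ap1: "norm (W n s) \<le> y n + 2 * sqrt s + 2 * L * s" if "s \<in> {0..t}" for n s
    using backward_flow_apriori(1)[OF Wc Wi Wnz L, of s n] that by (auto simp: nW0)
  have ap2: "norm ((W n s)\<^sup>2 + complex_of_real (4 * s) + complex_of_real ((y n)\<^sup>2)) \<le> 2 * L * s * (y n + 2 * sqrt s + 2 * L * s)" if "s \<in> {0..t}" for n s
    using backward_flow_apriori(2)[OF Wc Wi Wnz L, of s n] that by (auto simp: nW0)
  \<comment> \<open>The real part of the a priori estimate. Smallness makes its right-hand side at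
    most \<open>s\<close>, so
    \<open>Re ((W n s)\<^sup>2) \<le> - 3 * s - (y n)\<^sup>2\<close>.\<close>
  have sq: "(Re (W n s))\<^sup>2 + 3 * s \<le> (Im (W n s))\<^sup>2" if s: "s \<in> {0..t}" "s \<le> s1" for n s
  proof -
    have "Re ((W n s)\<^sup>2 + complex_of_real (4 * s) + complex_of_real ((y n)\<^sup>2)) \<le> s * (2 * L * (y n + 2 * sqrt s + 2 * L * s))"
      using order_trans[OF complex_Re_le_cmod ap2[OF s(1), of n]] by (simp add: algebra_simps)
    also have "\<dots> \<le> s * 1"
      using small[of "y n" s] y[of n] s by (intro mult_left_mono) auto
    finally have "(Re (W n s))\<^sup>2 - (Im (W n s))\<^sup>2 + 4 * s + (y n)\<^sup>2 \<le> s"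
      by (simp add: Re_power2)
    then show ?thesis using zero_le_power2[of "y n"] by linarith
  qed
  have Wpos: "Im (W n s) > 0" if "s \<in> {0..t}" for n s
    using Wy[OF that, of n] y(1)[of n] by simp
  have ReIm: "\<bar>Re (W n s)\<bar> \<le> Im (W n s)" if s: "s \<in> {0..t}" "s \<le> s1" for n s
    using sq[OF s, of n] Wpos[OF s(1), of n] s abs_le_square_iff[of "Re (W n s)" "Im (W n s)"] by auto
  \<comment> \<open>After \<open>s1\<close> the monotone imaginary part keeps at least the height
    reached at \<open>s1\<close>, hence the minimum.\<close>
  have low: "sqrt (3 * min s s1) \<le> Im (W n s)" if s: "s \<in> {0..t}" for n s
  proof -
    let ?r = "min s s1"
    have r: "?r \<in> {0..t}" "?r \<le> s1" using s s1 by auto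
    have "3 * ?r \<le> (Im (W n ?r))\<^sup>2" using sq[OF r, of n] zero_le_power2[of "Re (W n ?r)"] by linarith
    then have "sqrt (3 * ?r) \<le> Im (W n ?r)" using Wpos[OF r(1), of n] by (intro real_le_lsqrt) auto
    also have "\<dots> \<le> Im (W n s)" using r s by (intro Wm) auto
    finally show ?thesis .
  qed
  \<comment> \<open>Beyond \<open>s1\<close> every flow has norm at least
    \<open>sqrt (3 * s1)\<close>, so twice the real part of the coefficient
    \<open>2 / (W m s * W n s)\<close> is at most \<open>4 / (3 * s1)\<close>.\<close>
  define K where "K = 4 / (3 * s1)"
  have K0: "K > 0" using s1 by (simp add: K_def)
  have cauchy: "norm (W m s - W n s) \<le> exp (K * t) * \<bar>y m - y n\<bar>" if s: "s \<in> {0..t}" for m n s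
  proof -
    have "(norm (W m s - W n s))\<^sup>2 \<le> exp (K * s - K * 0) * (norm (W m 0 - W n 0))\<^sup>2"
    proof (rule linear_ode_growth[where q = "\<lambda>s. 2 / (W m s * W n s)" and k' = "\<lambda>s. K"])
      show "continuous_on {0..s} (\<lambda>s. W m s - W n s)"
        by (intro continuous_intros continuous_on_subset[OF Wc]) (use s in auto)
      fix r assume r: "0 < r" "r < s"
      then have rt: "r < t" and r': "r \<in> {0..t}" using s by auto
      have "((\<lambda>s. W m s - W n s) has_vector_derivative
          (- 2 / W m r + complex_of_real (\<nu> r)) - (- 2 / W n r + complex_of_real (\<nu> r))) (at r)"
        by (intro has_vector_derivative_diff Wi r rt)
      also have "(- 2 / W m r + complex_of_real (\<nu> r)) - (- 2 / W n r + complex_of_real (\<nu> r)) = 2 / (W m r * W n r) * (W m r - W n r)"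
        using Wnz[OF r', of m] Wnz[OF r', of n] by (simp add: field_simps)
      finally show "((\<lambda>s. W m s - W n s) has_vector_derivative 2 / (W m r * W n r) * (W m r - W n r)) (at r)" .
      show "2 * Re (2 / (W m r * W n r)) \<le> K"
      proof (cases "r \<le> s1")
        case True
        \<comment> \<open>Two points of the cone \<open>|Re| \<le> Im\<close> have a product with
          nonpositive real part, and so has the reciprocal of the product.\<close>
        have "\<bar>Re (W m r) * Re (W n r)\<bar> \<le> Im (W m r) * Im (W n r)"
          unfolding abs_mult using ReIm[OF r' True, of m] ReIm[OF r' True, of n] by (intro mult_mono) auto
        then have "Re (W m r * W n r) \<le> 0" by simp
        then have "Re (2 / (W m r * W n r)) \<le> 0"
          by (simp add: Re_divide divide_nonpos_nonneg)
        then show ?thesis using K0 by linarith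
      next
        case False
        then have "sqrt (3 * s1) \<le> norm (W k r)" for k
          using low[OF r', of k] abs_Im_le_cmod[of "W k r"] by (simp add: min_def)
        then have "sqrt (3 * s1) * sqrt (3 * s1) \<le> norm (W m r) * norm (W n r)"
          using s1 by (intro mult_mono) auto
        then have "3 * s1 \<le> norm (W m r * W n r)" using s1 by (simp add: norm_mult)
        then have "norm (2 / (W m r * W n r)) \<le> 2 / (3 * s1)"
          using s1 frac_le[of 2 2 "3 * s1" "norm (W m r * W n r)"] unfolding norm_divide[of 2] by simp
        then show ?thesis using complex_Re_le_cmod[of "2 / (W m r * W n r)"] by (simp add: K_def)
      qed
    qed (use s in \<open>auto intro!: continuous_intros derivative_eq_intros\<close>)
    also have "\<dots> = exp (K * s) * \<bar>y m - y n\<bar>\<^sup>2"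
      by (simp add: W0 norm_mult flip: right_diff_distrib of_real_diff)
    also have "\<dots> \<le> (exp (K * t))\<^sup>2 * \<bar>y m - y n\<bar>\<^sup>2"
      using s K0 t mult_left_mono[of s t K]
      by (intro mult_right_mono) (auto simp: power2_eq_square simp flip: exp_add)
    finally have "(norm (W m s - W n s))\<^sup>2 \<le> (exp (K * t) * \<bar>y m - y n\<bar>)\<^sup>2"
      by (simp add: power_mult_distrib)
    then show ?thesis by (rule power2_le_imp_le) simp
  qed
  have "uniformly_Cauchy_on {0..t} W"
  proof (rule uniformly_Cauchy_onI)
    fix e :: real assume e: "e > 0"
    have "Cauchy y" using ylim LIMSEQ_imp_Cauchy by blast
    then obtain M where M: "\<And>m n. m \<ge> M \<Longrightarrow> n \<ge> M \<Longrightarrow> norm (y m - y n) < e / exp (K * t)"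
      using e by (meson CauchyD divide_pos_pos exp_gt_zero)
    show "\<exists>M. \<forall>x\<in>{0..t}. \<forall>m\<ge>M. \<forall>n\<ge>M. dist (W m x) (W n x) < e"
    proof (intro exI ballI allI impI)
      fix x m n assume *: "x \<in> {0..t}" "m \<ge> M" "n \<ge> M"
      have "exp (K * t) * \<bar>y m - y n\<bar> < e" using M[OF *(2,3)] by (simp add: field_simps)
      with cauchy[OF *(1), of m n] show "dist (W m x) (W n x) < e" by (simp add: dist_norm)
    qed
  qed
  then obtain w where ul: "uniform_limit {0..t} W w sequentially"
    using Cauchy_uniformly_convergent uniformly_convergent_on_def by blast
  have pw: "(\<lambda>n. W n s) \<longlonglongrightarrow> w s" if "s \<in> {0..t}" for s
    using tendsto_uniform_limitI[OF ul that] .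
  have cw: "continuous_on {0..t} w"
    by (rule uniform_limit_theorem[OF _ ul]) (auto simp: Wc)
  have w0: "w 0 = 0"
  proof -
    have "(\<lambda>n. W n 0) \<longlonglongrightarrow> \<i> * complex_of_real 0"
      unfolding W0 by (intro tendsto_intros ylim)
    with pw[of 0] t show ?thesis using LIMSEQ_unique by fastforce
  qed
  have Imw: "sqrt (3 * min s s1) \<le> Im (w s)" if s: "s \<in> {0..t}" for s
    by (rule tendsto_lowerbound[OF tendsto_Im[OF pw[OF s]]]) (auto simp: low[OF s])
  have nw: "norm (w s) \<le> 2 * sqrt s + 2 * L * s" if s: "s \<in> {0..t}" for s
  proof (rule LIMSEQ_le)
    show "(\<lambda>n. norm (W n s)) \<longlonglongrightarrow> norm (w s)" by (intro tendsto_intros pw s)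
    show "(\<lambda>n. y n + 2 * sqrt s + 2 * L * s) \<longlonglongrightarrow> 2 * sqrt s + 2 * L * s"
      by (rule tendsto_eq_intros ylim refl | simp)+
  qed (use ap1[OF s] in auto)
  have nw2: "norm ((w s)\<^sup>2 + complex_of_real (4 * s)) \<le> 2 * L * s * (2 * sqrt s + 2 * L * s)" if s: "s \<in> {0..t}" for s
  proof (rule LIMSEQ_le)
    have "(\<lambda>n. norm ((W n s)\<^sup>2 + complex_of_real (4 * s) + complex_of_real ((y n)\<^sup>2)))
       \<longlonglongrightarrow> norm ((w s)\<^sup>2 + complex_of_real (4 * s) + complex_of_real (0\<^sup>2))"
      by (intro tendsto_intros pw s ylim)
    then show "(\<lambda>n. norm ((W n s)\<^sup>2 + complex_of_real (4 * s) + complex_of_real ((y n)\<^sup>2)))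
       \<longlonglongrightarrow> norm ((w s)\<^sup>2 + complex_of_real (4 * s))" by simp
    show "(\<lambda>n. 2 * L * s * (y n + 2 * sqrt s + 2 * L * s)) \<longlonglongrightarrow> 2 * L * s * (2 * sqrt s + 2 * L * s)"
      by (rule tendsto_eq_intros ylim refl | simp)+
  qed (use ap2[OF s] in auto)
  have wd: "(w has_vector_derivative (- 2 / w s + complex_of_real (\<nu> s))) (at s)" if s: "0 < s" "s < t" for s
  proof -
    define b where "b = sqrt (3 * min (s / 2) s1)"
    have b: "b > 0" using s s1 by (simp add: b_def)
    have bI: "b \<le> norm (W n r)" "b \<le> norm (w r)" if r: "r \<in> {s/2..t}" for n r
    proof -
      have r': "r \<in> {0..t}" using r s by auto
      have "b \<le> sqrt (3 * min r s1)" using r unfolding b_def by auto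
      then show "b \<le> norm (W n r)" "b \<le> norm (w r)"
        using low[OF r', of n] Imw[OF r'] abs_Im_le_cmod[of "W n r"] abs_Im_le_cmod[of "w r"] by linarith+
    qed
    \<comment> \<open>On \<open>{s/2..t}\<close> all flows have norm at least \<open>b\<close>, so
      the right-hand sides converge uniformly and the limit may be differentiated termwise.\<close>
    have "\<exists>g. \<forall>x\<in>{s/2..t}. (\<lambda>n. W n x) \<longlonglongrightarrow> g x \<and>
       (g has_derivative (\<lambda>h. h *\<^sub>R (- 2 / w x + complex_of_real (\<nu> x)))) (at x within {s/2..t})"
    proof (rule has_derivative_sequence)
      show "(W n has_derivative (\<lambda>h. h *\<^sub>R (- 2 / W n x + complex_of_real (\<nu> x)))) (at x within {s/2..t})"
        if "x \<in> {s/2..t}" for n x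
        using has_vector_derivative_within_subset[OF Wd, of x "{s/2..t}" n] that s
        by (auto simp: has_vector_derivative_def)
      fix e :: real assume e: "e > 0"
      have "\<forall>\<^sub>F n in sequentially. \<forall>x\<in>{0..t}. dist (W n x) (w x) < e * b\<^sup>2 / 2"
        using uniform_limitD[OF ul, of "e * b\<^sup>2 / 2"] e b by simp
      then show "\<forall>\<^sub>F n in sequentially. \<forall>x\<in>{s/2..t}. \<forall>h.
         norm (h *\<^sub>R (- 2 / W n x + complex_of_real (\<nu> x)) - h *\<^sub>R (- 2 / w x + complex_of_real (\<nu> x))) \<le> e * norm h"
      proof (eventually_elim, intro ballI allI)
        fix n x h assume *: "\<forall>x\<in>{0..t}. dist (W n x) (w x) < e * b\<^sup>2 / 2" and x: "x \<in> {s/2..t}"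
        have d: "norm (W n x - w x) \<le> e * b\<^sup>2 / 2" using *[rule_format, of x] x s by (simp add: dist_norm)
        have nz: "W n x \<noteq> 0" "w x \<noteq> 0" using bI(1)[OF x, of n] bI(2)[OF x] b by auto
        have "- 2 / W n x - - 2 / w x = 2 * (W n x - w x) / (W n x * w x)" using nz by (simp add: field_simps)
        then have "norm (- 2 / W n x - - 2 / w x) = 2 * norm (W n x - w x) / (norm (W n x) * norm (w x))"
          by (simp only: norm_divide norm_mult norm_numeral)
        also have "\<dots> \<le> 2 * (e * b\<^sup>2 / 2) / (b * b)"
          using d b bI(1)[OF x, of n] bI(2)[OF x] e by (intro frac_le mult_mono) auto
        also have "\<dots> = e" using b by (simp add: power2_eq_square)
        finally have "norm (- 2 / W n x - - 2 / w x) \<le> e" .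
        then have "\<bar>h\<bar> * norm (- 2 / W n x - - 2 / w x) \<le> \<bar>h\<bar> * e" by (rule mult_left_mono) simp
        then have "norm (h *\<^sub>R (- 2 / W n x - - 2 / w x)) \<le> e * norm h"
          unfolding norm_scaleR by (simp only: mult.commute real_norm_def)
        moreover have "h *\<^sub>R (a + b) - h *\<^sub>R (c + b) = h *\<^sub>R (a - c)" for a b c :: complex
          by (simp add: algebra_simps)
        ultimately show "norm (h *\<^sub>R (- 2 / W n x + complex_of_real (\<nu> x)) - h *\<^sub>R (- 2 / w x + complex_of_real (\<nu> x))) \<le> e * norm h"
          by (simp only:)
      qed
    next
      show "(\<lambda>n. W n s) \<longlonglongrightarrow> w s" using s by (intro pw) auto
    qed (use s in auto)
    then obtain g where g: "\<And>x. x \<in> {s/2..t} \<Longrightarrow> (\<lambda>n. W n x) \<longlonglongrightarrow> g x"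
      "\<And>x. x \<in> {s/2..t} \<Longrightarrow> (g has_vector_derivative (- 2 / w x + complex_of_real (\<nu> x))) (at x within {s/2..t})"
      unfolding has_vector_derivative_def by blast
    have gw: "g x = w x" if "x \<in> {s/2..t}" for x
      using g(1)[OF that] pw[of x] that s LIMSEQ_unique by fastforce
    have "(w has_vector_derivative (- 2 / w s + complex_of_real (\<nu> s))) (at s within {s/2..t})"
      by (rule has_vector_derivative_transform[OF _ _ g(2)]) (use s gw in auto)
    then show ?thesis by (rule has_vector_derivative_interior) (use s in auto)
  qed
  show ?thesis using cw w0 wd Imw nw nw2 by (intro exI[of _ w]) auto
qed

text \<open>Here \<open>c\<close> and \<open>C\<close> are fixed in terms of \<open>T\<close> and
  \<open>L\<close> alone. All later estimates have to be uniform over the terminal times t, and the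
  driving term changes with t as well.\<close>

lemma singular_backward_flow:
  fixes \<nu> :: "real \<Rightarrow> real \<Rightarrow> real"
  assumes T: "0 < T" and L: "0 \<le> L"
  obtains c C where "0 < c" "0 < C"
    "\<And>t \<nu>. 0 < t \<Longrightarrow> t \<le> T \<Longrightarrow> continuous_on {0..t} \<nu> \<Longrightarrow> (\<And>s. s \<in> {0..t} \<Longrightarrow> \<bar>\<nu> s\<bar> \<le> L) \<Longrightarrow>
      \<exists>w. continuous_on {0..t} w \<and> w 0 = 0 \<and>
        (\<forall>s\<in>{0<..<t}. (w has_vector_derivative (- 2 / w s + complex_of_real (\<nu> s))) (at s)) \<and>
        (\<forall>s\<in>{0..t}. Im (w s) \<ge> c * sqrt s \<and> norm (w s) \<le> C * sqrt s \<and>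
           norm ((w s)\<^sup>2 + complex_of_real (4 * s)) \<le> C * (s * sqrt s))"
proof -
  \<comment> \<open>\<open>y1\<close> and \<open>r\<close> are chosen so that the three terms of the
    smallness condition are at most 1/3, 1/3 and 1/36.\<close>
  define y1 where "y1 = 1 / (6 * (L + 1))"
  define r where "r = 1 / (12 * (L + 1))"
  have y1: "y1 > 0" and r: "r > 0" using L by (auto simp: y1_def r_def)
  have Ly: "2 * L * y1 \<le> 1/3" "2 * L * r \<le> 1/6" "L * r \<le> 1 / 12" using L by (auto simp: y1_def r_def field_simps)
  define s1 where "s1 = r\<^sup>2"
  have s1: "s1 > 0" using r by (simp add: s1_def)
  have small: "2 * L * (y + 2 * sqrt s + 2 * L * s) \<le> 1" if "0 \<le> y" "y \<le> y1" "0 \<le> s" "s \<le> s1" for y s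
  proof -
    have sr: "sqrt s \<le> r" using that r by (intro real_le_lsqrt) (auto simp: s1_def)
    have 1: "2 * L * y \<le> 2 * L * y1" using that L by (intro mult_left_mono) auto
    have 2: "2 * L * sqrt s \<le> 2 * L * r" using sr L by (intro mult_left_mono) auto
    have "L * L * s \<le> L * L * r\<^sup>2" using that L by (intro mult_left_mono) (auto simp: s1_def)
    also have "\<dots> = (L * r) * (L * r)" by (simp add: power2_eq_square)
    also have "\<dots> \<le> (1/12) * (1/12)" using Ly(3) L r by (intro mult_mono) auto
    finally have "L * L * s \<le> 1/144" by simp
    then show ?thesis using 1 2 Ly by (simp add: algebra_simps)
  qed
  \<comment> \<open>On \<open>{0..T}\<close> one has
    \<open>s * min 1 (s1 / T) \<le> min s s1\<close>, which turns the lower bound for the imaginary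
    part into a multiple of \<open>sqrt s\<close>.\<close>
  define c where "c = sqrt (3 * min 1 (s1 / T))"
  define C' where "C' = 2 + 2 * L * sqrt T"
  define C where "C = max C' (2 * L * C')"
  have C': "C' > 0" using L T by (simp add: C'_def add_pos_nonneg)
  show thesis
  proof (rule that[of c C])
    show "c > 0" using s1 T by (simp add: c_def)
    show "C > 0" using C' by (simp add: C_def)
    fix t :: real and \<nu> :: "real \<Rightarrow> real"
    assume t: "0 < t" "t \<le> T" and \<nu>: "continuous_on {0..t} \<nu>" "\<And>s. s \<in> {0..t} \<Longrightarrow> \<bar>\<nu> s\<bar> \<le> L"
    have "\<exists>w. continuous_on {0..t} w \<and> w 0 = 0 \<and>
      (\<forall>s\<in>{0<..<t}. (w has_vector_derivative (- 2 / w s + complex_of_real (\<nu> s))) (at s)) \<and>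
      (\<forall>s\<in>{0..t}. Im (w s) \<ge> sqrt (3 * min s s1) \<and> norm (w s) \<le> 2 * sqrt s + 2 * L * s \<and>
         norm ((w s)\<^sup>2 + complex_of_real (4 * s)) \<le> 2 * L * s * (2 * sqrt s + 2 * L * s))"
      by (rule singular_backward_flow_aux[OF t(1) \<nu>(1) _ s1 y1, of L]) (use \<nu>(2) small in blast)+
    then obtain w where w': "continuous_on {0..t} w \<and> w 0 = 0 \<and>
      (\<forall>s\<in>{0<..<t}. (w has_vector_derivative (- 2 / w s + complex_of_real (\<nu> s))) (at s)) \<and>
      (\<forall>s\<in>{0..t}. Im (w s) \<ge> sqrt (3 * min s s1) \<and> norm (w s) \<le> 2 * sqrt s + 2 * L * s \<and>
         norm ((w s)\<^sup>2 + complex_of_real (4 * s)) \<le> 2 * L * s * (2 * sqrt s + 2 * L * s))" by (elim exE)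
    have w: "Im (w s) \<ge> sqrt (3 * min s s1)" "norm (w s) \<le> 2 * sqrt s + 2 * L * s"
      "norm ((w s)\<^sup>2 + complex_of_real (4 * s)) \<le> 2 * L * s * (2 * sqrt s + 2 * L * s)" if "s \<in> {0..t}" for s
      using w' that by blast+
    have "Im (w s) \<ge> c * sqrt s \<and> norm (w s) \<le> C * sqrt s \<and>
           norm ((w s)\<^sup>2 + complex_of_real (4 * s)) \<le> C * (s * sqrt s)" if s: "s \<in> {0..t}" for s
    proof (intro conjI)
      have s': "0 \<le> s" "s \<le> T" using s t by auto
      have "s * min 1 (s1 / T) \<le> min s s1"
      proof -
        have "s * min 1 (s1 / T) \<le> s * 1" "s * min 1 (s1 / T) \<le> T * (s1 / T)"
          using s' s1 T by (intro mult_left_mono mult_mono; auto)+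
        then show ?thesis using T by auto
      qed
      then have "c * sqrt s \<le> sqrt (3 * min s s1)"
        unfolding c_def real_sqrt_mult[symmetric] by (intro real_sqrt_le_mono) (auto simp: algebra_simps)
      with w(1)[OF s] show "Im (w s) \<ge> c * sqrt s" by linarith
      have "L * s \<le> L * (sqrt T * sqrt s)"
      proof -
        have "sqrt s * sqrt s \<le> sqrt T * sqrt s" using s' by (intro mult_right_mono) auto
        then show ?thesis using L s' by (intro mult_left_mono) auto
      qed
      then have *: "2 * sqrt s + 2 * L * s \<le> C' * sqrt s" by (simp add: C'_def algebra_simps)
      have "C' * sqrt s \<le> C * sqrt s" by (intro mult_right_mono) (auto simp: C_def s')
      with * w(2)[OF s] show "norm (w s) \<le> C * sqrt s" by linarith
      have "2 * L * s * (2 * sqrt s + 2 * L * s) \<le> 2 * L * s * (C' * sqrt s)"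
        using * L s' by (intro mult_left_mono) auto
      also have "\<dots> = (2 * L * C') * (s * sqrt s)" by simp
      also have "\<dots> \<le> C * (s * sqrt s)" by (intro mult_right_mono) (auto simp: C_def s')
      finally show "norm ((w s)\<^sup>2 + complex_of_real (4 * s)) \<le> C * (s * sqrt s)" using w(3)[OF s] by linarith
    qed
    then show "\<exists>w. continuous_on {0..t} w \<and> w 0 = 0 \<and>
        (\<forall>s\<in>{0<..<t}. (w has_vector_derivative (- 2 / w s + complex_of_real (\<nu> s))) (at s)) \<and>
        (\<forall>s\<in>{0..t}. Im (w s) \<ge> c * sqrt s \<and> norm (w s) \<le> C * sqrt s \<and>
           norm ((w s)\<^sup>2 + complex_of_real (4 * s)) \<le> C * (s * sqrt s))"
      using w' by blast
  qed
qed

section \<open>Hoelder classes with a parameter\<close>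

lemma vector_derivative_bound:
  fixes f :: "real \<Rightarrow> 'a::real_normed_vector"
  assumes der: "\<And>x. x \<in> {a..b} \<Longrightarrow> (f has_vector_derivative f' x) (at x within {a..b})"
    and bnd: "\<And>x. x \<in> {a..b} \<Longrightarrow> norm (f' x) \<le> B"
    and st: "s \<in> {a..b}" "t \<in> {a..b}"
  shows "norm (f s - f t) \<le> B * \<bar>s - t\<bar>"
proof -
  have main: "norm (f t - f s) \<le> B * (t - s)" if "s < t" "s \<in> {a..b}" "t \<in> {a..b}" for s t
  proof -
    have "norm (f t - f s) \<le> B * t - B * s"
    proof (rule differentiable_bound_general[OF that(1), of f "\<lambda>x. B * x" f' "\<lambda>x. B"])
      show "continuous_on {s..t} f"
        by (rule continuous_on_subset[OF has_vector_derivative_imp_continuous_on[OF der]]) (use that in auto)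
      show "(f has_vector_derivative f' x) (at x)" if x: "s < x" "x < t" for x
        by (rule has_vector_derivative_interior[OF der]) (use x that \<open>s \<in> {a..b}\<close> \<open>t \<in> {a..b}\<close> in auto)
      show "((*) B has_vector_derivative B) (at x)" for x
        by (auto intro!: derivative_eq_intros simp flip: has_real_derivative_iff_has_vector_derivative)
    qed (use that bnd in \<open>auto intro!: continuous_intros\<close>)
    then show ?thesis by (simp add: algebra_simps)
  qed
  consider "s < t" | "t < s" | "s = t" by linarith
  then show ?thesis
  proof cases
    case 1 then show ?thesis using main[of s t] st by (simp add: norm_minus_commute abs_if)
  next
    case 2 then show ?thesis using main[of t s] st by (simp add: abs_if)
  qed simp
qed

text \<open>The remainder form, with an explicit constant, is what passes through integrals over a
  parameter; \<open>has_vector_derivative_of_taylor\<close> recovers the derivative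
  afterwards.\<close>

lemma vector_derivative_taylor:
  fixes f :: "real \<Rightarrow> 'a::real_normed_vector"
  assumes der: "\<And>x. x \<in> {a..b} \<Longrightarrow> (f has_vector_derivative f' x) (at x within {a..b})"
    and hol: "\<And>x. x \<in> {a..b} \<Longrightarrow> norm (f' x - f' t) \<le> C * \<bar>x - t\<bar> powr \<alpha>"
    and st: "s \<in> {a..b}" "t \<in> {a..b}" and \<alpha>: "\<alpha> > 0" and C: "C \<ge> 0"
  shows "norm (f s - f t - (s - t) *\<^sub>R f' t) \<le> C * \<bar>s - t\<bar> powr (1 + \<alpha>)"
proof -
  have "norm ((\<lambda>x. f x - x *\<^sub>R f' t) s - (\<lambda>x. f x - x *\<^sub>R f' t) t) \<le> C * \<bar>s - t\<bar> powr \<alpha> * \<bar>s - t\<bar>"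
  proof (rule vector_derivative_bound[where a = "min s t" and b = "max s t" and f' = "\<lambda>x. f' x - f' t"])
    fix x assume x: "x \<in> {min s t..max s t}"
    then have xab: "x \<in> {a..b}" using st by auto
    have "((\<lambda>x. f x - x *\<^sub>R f' t) has_vector_derivative (f' x - (1 *\<^sub>R f' t))) (at x within {a..b})"
      by (intro has_vector_derivative_diff der xab has_vector_derivative_scaleR[where f' = "1", THEN has_vector_derivative_eq_rhs])
        (auto intro!: derivative_eq_intros)
    then show "((\<lambda>x. f x - x *\<^sub>R f' t) has_vector_derivative (f' x - f' t)) (at x within {min s t..max s t})"
      by (rule has_vector_derivative_within_subset[THEN has_vector_derivative_eq_rhs]) (use st in auto)
    have "C * \<bar>x - t\<bar> powr \<alpha> \<le> C * \<bar>s - t\<bar> powr \<alpha>"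
      using x \<alpha> C by (intro mult_left_mono powr_mono2) auto
    with hol[OF xab] show "norm (f' x - f' t) \<le> C * \<bar>s - t\<bar> powr \<alpha>" by linarith
  qed auto
  also have "C * \<bar>s - t\<bar> powr \<alpha> * \<bar>s - t\<bar> = C * \<bar>s - t\<bar> powr (1 + \<alpha>)"
    by (cases "s = t") (auto simp: powr_add)
  finally show ?thesis by (simp add: algebra_simps)
qed

lemma has_vector_derivative_of_taylor:
  fixes f :: "real \<Rightarrow> 'a::real_normed_vector"
  assumes bnd: "\<And>s. s \<in> S \<Longrightarrow> norm (f s - f t - (s - t) *\<^sub>R v) \<le> C * \<bar>s - t\<bar> powr (1 + \<alpha>)"
    and \<alpha>: "\<alpha> > 0"
  shows "(f has_vector_derivative v) (at t within S)"
  unfolding has_vector_derivative_def has_derivative_iff_norm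
proof
  show "bounded_linear (\<lambda>h. h *\<^sub>R v)" by (rule bounded_linear_scaleR_left)
  show "((\<lambda>s. norm (f s - f t - (s - t) *\<^sub>R v) / norm (s - t)) \<longlongrightarrow> 0) (at t within S)"
  proof (rule tendsto_sandwich[OF _ _ tendsto_const])
    show "\<forall>\<^sub>F s in at t within S. 0 \<le> norm (f s - f t - (s - t) *\<^sub>R v) / norm (s - t)" by simp
    show "\<forall>\<^sub>F s in at t within S. norm (f s - f t - (s - t) *\<^sub>R v) / norm (s - t) \<le> C * \<bar>s - t\<bar> powr \<alpha>"
      unfolding eventually_at_filter
    proof (rule always_eventually, intro allI impI)
      fix s assume "s \<noteq> t" "s \<in> S"
      then show "norm (f s - f t - (s - t) *\<^sub>R v) / norm (s - t) \<le> C * \<bar>s - t\<bar> powr \<alpha>"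
        using bnd[of s] by (simp add: divide_le_eq powr_add algebra_simps)
    qed
    have "((\<lambda>s. C * \<bar>s - t\<bar> powr \<alpha>) \<longlongrightarrow> C * \<bar>t - t\<bar> powr \<alpha>) (at t within S)"
      using \<alpha> by (intro tendsto_intros tendsto_powr') (auto intro!: tendsto_intros)
    then show "((\<lambda>s. C * \<bar>s - t\<bar> powr \<alpha>) \<longlongrightarrow> 0) (at t within S)" by simp
  qed
qed

text \<open>The integrands in \<rho> are controlled for positive \<rho> only, as their formulas
  divide by \<rho>. Continuity gives measurability, domination gives integrability, and the point 0
  is negligible.\<close>

lemma integrable_on_bounded_half_open:
  fixes f :: "real \<Rightarrow> complex"
  assumes c: "continuous_on {0<..r} f" and b: "\<And>x. x \<in> {0<..r} \<Longrightarrow> norm (f x) \<le> g x"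
    and g: "g integrable_on {0..r}"
  shows "f integrable_on {0..r}"
proof -
  have "f integrable_on {0<..r}"
  proof (rule measurable_bounded_by_integrable_imp_integrable)
    show "f \<in> borel_measurable (lebesgue_on {0<..r})"
      by (rule continuous_imp_measurable_on_sets_lebesgue[OF c]) simp
    show "g integrable_on {0<..r}"
      by (rule integrable_spike_set[OF g]) (auto intro!: negligible_subset[OF negligible_sing[of 0]])
  qed (use b in auto)
  then show ?thesis
    by (rule integrable_spike_set) (auto intro!: negligible_subset[OF negligible_sing[of 0]])
qed

section \<open>Function classes in (\<rho>, t) and their algebra\<close>

locale parameter_interval =
  fixes a b \<alpha> :: real
  assumes ab: "0 < a" "a < b" and \<alpha>: "0 < \<alpha>" "\<alpha> \<le> 1"
begin

text \<open>The predicates below concern functions of \<open>(\<rho>, t)\<close>, where \<open>\<rho> \<in> (0, 1]\<close> is the square root of the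
  rescaled backward time.  The predicate \<open>cls k\<close> is the Hoelder class of order \<open>k + \<alpha>\<close> in \<open>t\<close>, uniformly
  in \<open>\<rho>\<close>; \<open>zcls k\<close> says that moreover multiplication of the last derivative by \<open>\<rho>\<^sup>2\<close> gains one derivative.\<close>

definition base :: "(real \<Rightarrow> real \<Rightarrow> complex) \<Rightarrow> bool" where
  "base f \<longleftrightarrow> (\<forall>t\<in>{a..b}. continuous_on {0<..1} (\<lambda>\<rho>. f \<rho> t)) \<and>
     (\<exists>B. \<forall>\<rho>\<in>{0<..1}. \<forall>t\<in>{a..b}. norm (f \<rho> t) \<le> B)"

definition hol :: "(real \<Rightarrow> real \<Rightarrow> complex) \<Rightarrow> bool" where
  "hol f \<longleftrightarrow> (\<exists>C. \<forall>\<rho>\<in>{0<..1}. \<forall>s\<in>{a..b}. \<forall>t\<in>{a..b}. norm (f \<rho> s - f \<rho> t) \<le> C * \<bar>s - t\<bar> powr \<alpha>)"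

definition tder :: "(real \<Rightarrow> real \<Rightarrow> complex) \<Rightarrow> (real \<Rightarrow> real \<Rightarrow> complex) \<Rightarrow> bool" where
  "tder f f' \<longleftrightarrow> (\<forall>\<rho>\<in>{0<..1}. \<forall>t\<in>{a..b}. (f \<rho> has_vector_derivative f' \<rho> t) (at t within {a..b}))"

primrec cls :: "nat \<Rightarrow> (real \<Rightarrow> real \<Rightarrow> complex) \<Rightarrow> bool" where
  "cls 0 f \<longleftrightarrow> base f \<and> hol f"
| "cls (Suc k) f \<longleftrightarrow> base f \<and> (\<exists>f'. tder f f' \<and> cls k f')"

primrec zcls :: "nat \<Rightarrow> (real \<Rightarrow> real \<Rightarrow> complex) \<Rightarrow> bool" where
  "zcls 0 f \<longleftrightarrow> cls 0 f \<and> (\<exists>m'. tder (\<lambda>\<rho> t. complex_of_real (\<rho>\<^sup>2) * f \<rho> t) m' \<and> cls 0 m' \<and>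
      (\<exists>C. \<forall>\<rho>\<in>{0<..1}. \<forall>t\<in>{a..b}. norm (m' \<rho> t) \<le> C * \<rho> powr (2 * \<alpha>)))"
| "zcls (Suc k) f \<longleftrightarrow> base f \<and> (\<exists>f'. tder f f' \<and> zcls k f')"

declare cls.simps [simp del] zcls.simps [simp del]

lemma cls_0I: "base f \<Longrightarrow> hol f \<Longrightarrow> cls 0 f"
  by (simp add: cls.simps)

lemma cls_SucI: "base f \<Longrightarrow> tder f f' \<Longrightarrow> cls k f' \<Longrightarrow> cls (Suc k) f"
  by (auto simp: cls.simps)

lemma zcls_SucI: "base f \<Longrightarrow> tder f f' \<Longrightarrow> zcls k f' \<Longrightarrow> zcls (Suc k) f"
  by (auto simp: zcls.simps)

lemma cls_SucE:
  assumes "cls (Suc k) f"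
  obtains f' where "tder f f'" "cls k f'"
  using assms by (auto simp: cls.simps)

lemma zcls_SucE:
  assumes "zcls (Suc k) f"
  obtains f' where "tder f f'" "zcls k f'"
  using assms by (auto simp: zcls.simps)

lemma baseD: "base f \<Longrightarrow> t \<in> {a..b} \<Longrightarrow> continuous_on {0<..1} (\<lambda>\<rho>. f \<rho> t)"
  by (simp add: base_def)

lemma base_bound:
  assumes "base f"
  obtains B where "B > 0" "\<And>\<rho> t. \<rho> \<in> {0<..1} \<Longrightarrow> t \<in> {a..b} \<Longrightarrow> norm (f \<rho> t) \<le> B"
proof -
  obtain B where B: "\<And>\<rho> t. \<rho> \<in> {0<..1} \<Longrightarrow> t \<in> {a..b} \<Longrightarrow> norm (f \<rho> t) \<le> B"
    using assms unfolding base_def by blast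
  show thesis by (rule that[of "max B 1"]) (use B in \<open>auto simp: le_max_iff_disj\<close>)
qed

lemma baseI:
  assumes "\<And>t. t \<in> {a..b} \<Longrightarrow> continuous_on {0<..1} (\<lambda>\<rho>. f \<rho> t)"
    and "\<And>\<rho> t. \<rho> \<in> {0<..1} \<Longrightarrow> t \<in> {a..b} \<Longrightarrow> norm (f \<rho> t) \<le> B"
  shows "base f"
  unfolding base_def using assms by blast

lemma hol_bound:
  assumes "hol f"
  obtains C where "C > 0" "\<And>\<rho> s t. \<rho> \<in> {0<..1} \<Longrightarrow> s \<in> {a..b} \<Longrightarrow> t \<in> {a..b} \<Longrightarrow> norm (f \<rho> s - f \<rho> t) \<le> C * \<bar>s - t\<bar> powr \<alpha>"
proof -
  obtain C where C: "\<And>\<rho> s t. \<rho> \<in> {0<..1} \<Longrightarrow> s \<in> {a..b} \<Longrightarrow> t \<in> {a..b} \<Longrightarrow> norm (f \<rho> s - f \<rho> t) \<le> C * \<bar>s - t\<bar> powr \<alpha>"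
    using assms unfolding hol_def by blast
  show thesis
  proof (rule that[of "max C 1"])
    fix \<rho> s t :: real assume *: "\<rho> \<in> {0<..1}" "s \<in> {a..b}" "t \<in> {a..b}"
    have "C * \<bar>s - t\<bar> powr \<alpha> \<le> max C 1 * \<bar>s - t\<bar> powr \<alpha>" by (intro mult_right_mono) auto
    with C[OF *] show "norm (f \<rho> s - f \<rho> t) \<le> max C 1 * \<bar>s - t\<bar> powr \<alpha>" by linarith
  qed simp
qed

lemma holI:
  assumes "\<And>\<rho> s t. \<rho> \<in> {0<..1} \<Longrightarrow> s \<in> {a..b} \<Longrightarrow> t \<in> {a..b} \<Longrightarrow> norm (f \<rho> s - f \<rho> t) \<le> C * \<bar>s - t\<bar> powr \<alpha>"
  shows "hol f"
  unfolding hol_def using assms by blast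

lemma tderD: "tder f f' \<Longrightarrow> \<rho> \<in> {0<..1} \<Longrightarrow> t \<in> {a..b} \<Longrightarrow> (f \<rho> has_vector_derivative f' \<rho> t) (at t within {a..b})"
  by (auto simp: tder_def)

lemma tderI: "(\<And>\<rho> t. \<rho> \<in> {0<..1} \<Longrightarrow> t \<in> {a..b} \<Longrightarrow> (f \<rho> has_vector_derivative f' \<rho> t) (at t within {a..b})) \<Longrightarrow> tder f f'"
  by (auto simp: tder_def)

text \<open>The surplus power \<open>|s - t| powr (1 - \<alpha>)\<close> is bounded by the same
  power of the length of the interval.\<close>

lemma lipschitz_imp_powr:
  assumes "s \<in> {a..b}" "t \<in> {a..b}"
  shows "\<bar>s - t\<bar> \<le> (b - a) powr (1 - \<alpha>) * \<bar>s - t\<bar> powr \<alpha>"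
proof (cases "s = t")
  case False
  have "\<bar>s - t\<bar> = \<bar>s - t\<bar> powr (1 - \<alpha>) * \<bar>s - t\<bar> powr \<alpha>"
    using False by (simp flip: powr_add)
  also have "\<dots> \<le> (b - a) powr (1 - \<alpha>) * \<bar>s - t\<bar> powr \<alpha>"
    using assms \<alpha> by (intro mult_right_mono powr_mono2) auto
  finally show ?thesis .
qed simp

lemma hol_of_lipschitz:
  assumes "\<And>\<rho> s t. \<rho> \<in> {0<..1} \<Longrightarrow> s \<in> {a..b} \<Longrightarrow> t \<in> {a..b} \<Longrightarrow> norm (f \<rho> s - f \<rho> t) \<le> C * \<bar>s - t\<bar>"
    and "C \<ge> 0"
  shows "hol f"
proof (rule holI)
  fix \<rho> s t :: real assume *: "\<rho> \<in> {0<..1}" "s \<in> {a..b}" "t \<in> {a..b}"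
  have "norm (f \<rho> s - f \<rho> t) \<le> C * \<bar>s - t\<bar>" using assms(1)[OF *] .
  also have "\<dots> \<le> C * ((b - a) powr (1 - \<alpha>) * \<bar>s - t\<bar> powr \<alpha>)"
    using assms(2) by (intro mult_left_mono lipschitz_imp_powr *)
  finally show "norm (f \<rho> s - f \<rho> t) \<le> (C * (b - a) powr (1 - \<alpha>)) * \<bar>s - t\<bar> powr \<alpha>" by (simp add: mult.assoc)
qed

lemma tder_lipschitz:
  assumes "tder f f'" "base f'"
  obtains C where "C > 0" "\<And>\<rho> s t. \<rho> \<in> {0<..1} \<Longrightarrow> s \<in> {a..b} \<Longrightarrow> t \<in> {a..b} \<Longrightarrow> norm (f \<rho> s - f \<rho> t) \<le> C * \<bar>s - t\<bar>"
proof -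
  obtain B where B: "B > 0" "\<And>\<rho> t. \<rho> \<in> {0<..1} \<Longrightarrow> t \<in> {a..b} \<Longrightarrow> norm (f' \<rho> t) \<le> B"
    using base_bound[OF assms(2)] by blast
  show thesis
    by (rule that[OF B(1)], rule vector_derivative_bound[OF tderD[OF assms(1)] B(2)])
qed

lemma tder_hol: "tder f f' \<Longrightarrow> base f' \<Longrightarrow> hol f"
  by (erule (1) tder_lipschitz) (rule hol_of_lipschitz, auto)

lemma cls_base: "cls k f \<Longrightarrow> base f"
  by (cases k) (auto simp: cls.simps)

lemma cls_0_hol: "cls 0 f \<Longrightarrow> hol f"
  by (auto simp: cls.simps)

lemma cls_Suc: "cls (Suc k) f \<Longrightarrow> cls k f"
proof (induction k arbitrary: f)
  case 0
  then obtain f' where f': "tder f f'" "cls 0 f'" by (rule cls_SucE)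
  show ?case by (rule cls_0I[OF cls_base[OF 0] tder_hol[OF f'(1) cls_base[OF f'(2)]]])
next
  case (Suc k)
  obtain f' where f': "tder f f'" "cls (Suc k) f'" by (rule cls_SucE[OF Suc.prems])
  show ?case by (rule cls_SucI[OF cls_base[OF Suc.prems] f'(1) Suc.IH[OF f'(2)]])
qed

lemma cls_le: "cls k f \<Longrightarrow> j \<le> k \<Longrightarrow> cls j f"
  by (induction k) (use cls_Suc le_Suc_eq in auto)

lemma cls_hol: "cls k f \<Longrightarrow> hol f"
  using cls_le[of k f 0] cls_0_hol by simp

lemma tder_taylor:
  assumes "tder f f'" "hol f'"
  obtains C where "C > 0" "\<And>\<rho> s t. \<rho> \<in> {0<..1} \<Longrightarrow> s \<in> {a..b} \<Longrightarrow> t \<in> {a..b} \<Longrightarrow>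
     norm (f \<rho> s - f \<rho> t - (s - t) *\<^sub>R f' \<rho> t) \<le> C * \<bar>s - t\<bar> powr (1 + \<alpha>)"
proof -
  obtain C where C: "C > 0" "\<And>\<rho> s t. \<rho> \<in> {0<..1} \<Longrightarrow> s \<in> {a..b} \<Longrightarrow> t \<in> {a..b} \<Longrightarrow> norm (f' \<rho> s - f' \<rho> t) \<le> C * \<bar>s - t\<bar> powr \<alpha>"
    using hol_bound[OF assms(2)] by blast
  show thesis
  proof (rule that[OF C(1)])
    fix \<rho> s t :: real assume *: "\<rho> \<in> {0<..1}" "s \<in> {a..b}" "t \<in> {a..b}"
    show "norm (f \<rho> s - f \<rho> t - (s - t) *\<^sub>R f' \<rho> t) \<le> C * \<bar>s - t\<bar> powr (1 + \<alpha>)"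
      using C(1) \<alpha>(1) by (intro vector_derivative_taylor[OF tderD[OF assms(1) *(1)]] C(2) *) auto
  qed
qed

lemma base_cong: "(\<And>\<rho> t. \<rho> \<in> {0<..1} \<Longrightarrow> t \<in> {a..b} \<Longrightarrow> f \<rho> t = g \<rho> t) \<Longrightarrow> base f \<Longrightarrow> base g"
  unfolding base_def using continuous_on_cong[of "{0<..1}" "{0<..1}" "\<lambda>\<rho>. f \<rho> t" "\<lambda>\<rho>. g \<rho> t" for t] by auto

lemma hol_cong: "(\<And>\<rho> t. \<rho> \<in> {0<..1} \<Longrightarrow> t \<in> {a..b} \<Longrightarrow> f \<rho> t = g \<rho> t) \<Longrightarrow> hol f \<Longrightarrow> hol g"
  unfolding hol_def by simp

lemma tder_cong: "(\<And>\<rho> t. \<rho> \<in> {0<..1} \<Longrightarrow> t \<in> {a..b} \<Longrightarrow> f \<rho> t = g \<rho> t) \<Longrightarrow> tder f f' \<Longrightarrow> tder g f'"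
proof (rule tderI)
  fix \<rho> t :: real
  assume eq: "\<And>\<rho> t. \<rho> \<in> {0<..1} \<Longrightarrow> t \<in> {a..b} \<Longrightarrow> f \<rho> t = g \<rho> t" and f: "tder f f'"
    and \<rho>: "\<rho> \<in> {0<..1}" and t: "t \<in> {a..b}"
  show "(g \<rho> has_vector_derivative f' \<rho> t) (at t within {a..b})"
    by (rule has_vector_derivative_transform[OF t _ tderD[OF f \<rho> t]]) (use eq \<rho> in auto)
qed

lemma cls_cong:
  assumes eq: "\<And>\<rho> t. \<rho> \<in> {0<..1} \<Longrightarrow> t \<in> {a..b} \<Longrightarrow> f \<rho> t = g \<rho> t" and f: "cls k f"
  shows "cls k g"
proof (cases k)
  case 0
  from f have bf: "base f" and hf: "hol f" using cls_base cls_hol by blast+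
  have "base g" by (rule base_cong[OF eq bf])
  moreover have "hol g" by (rule hol_cong[OF eq hf])
  ultimately show ?thesis unfolding 0 by (rule cls_0I)
next
  case (Suc j)
  obtain f' where f': "tder f f'" "cls j f'" by (rule cls_SucE[OF f[unfolded Suc]])
  show ?thesis unfolding Suc
    by (rule cls_SucI[OF base_cong[OF eq cls_base[OF f]] tder_cong[OF eq f'(1)] f'(2)])
qed

lemma zcls_base: "zcls k f \<Longrightarrow> base f"
  by (cases k) (auto simp: zcls.simps dest: cls_base)

lemma zcls_0D:
  assumes "zcls 0 f"
  obtains m' C where "tder (\<lambda>\<rho> t. complex_of_real (\<rho>\<^sup>2) * f \<rho> t) m'" "cls 0 m'"
    "\<And>\<rho> t. \<rho> \<in> {0<..1} \<Longrightarrow> t \<in> {a..b} \<Longrightarrow> norm (m' \<rho> t) \<le> C * \<rho> powr (2 * \<alpha>)" "C > 0"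
proof -
  obtain m' C where m': "tder (\<lambda>\<rho> t. complex_of_real (\<rho>\<^sup>2) * f \<rho> t) m'" "cls 0 m'"
    "\<And>\<rho> t. \<rho> \<in> {0<..1} \<Longrightarrow> t \<in> {a..b} \<Longrightarrow> norm (m' \<rho> t) \<le> C * \<rho> powr (2 * \<alpha>)"
    using assms unfolding zcls.simps by blast
  show thesis
  proof (rule that[OF m'(1,2), of "max C 1"])
    fix \<rho> t :: real assume *: "\<rho> \<in> {0<..1}" "t \<in> {a..b}"
    have "C * \<rho> powr (2 * \<alpha>) \<le> max C 1 * \<rho> powr (2 * \<alpha>)" by (intro mult_right_mono) auto
    with m'(3)[OF *] show "norm (m' \<rho> t) \<le> max C 1 * \<rho> powr (2 * \<alpha>)" by linarith
  qed simp
qed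

lemma zcls_0I:
  assumes "cls 0 f" "tder (\<lambda>\<rho> t. complex_of_real (\<rho>\<^sup>2) * f \<rho> t) m'" "cls 0 m'"
    "\<And>\<rho> t. \<rho> \<in> {0<..1} \<Longrightarrow> t \<in> {a..b} \<Longrightarrow> norm (m' \<rho> t) \<le> C * \<rho> powr (2 * \<alpha>)"
  shows "zcls 0 f"
  unfolding zcls.simps
  by (intro conjI exI[of _ m'] exI[of _ C] ballI assms)

lemma base_const: "continuous_on {0<..1} g \<Longrightarrow> (\<And>\<rho>. \<rho> \<in> {0<..1} \<Longrightarrow> norm (g \<rho>) \<le> B) \<Longrightarrow> base (\<lambda>\<rho> t. g \<rho>)"
  by (rule baseI)

lemma cls_zero: "cls k (\<lambda>\<rho> t. 0)"
proof (induction k)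
  case 0
  show ?case by (rule cls_0I[OF base_const[of _ 0] holI[of _ 0]]) auto
next
  case (Suc k)
  show ?case by (rule cls_SucI[OF base_const[of _ 0] tderI Suc]) auto
qed

lemma cls_const:
  assumes "continuous_on {0<..1} g" "\<And>\<rho>. \<rho> \<in> {0<..1} \<Longrightarrow> norm (g \<rho>) \<le> B"
  shows "cls k (\<lambda>\<rho> t. g \<rho>)"
proof (cases k)
  case 0
  show ?thesis unfolding 0 by (rule cls_0I[OF base_const[OF assms] holI[of _ 0]]) auto
next
  case (Suc j)
  show ?thesis unfolding Suc by (rule cls_SucI[OF base_const[OF assms] tderI cls_zero]) auto
qed

lemma cls_complex_const [simp]: "cls k (\<lambda>\<rho> t. c)"
  by (rule cls_const[of _ "norm c"]) auto

lemma cls_rho_power [simp]: "cls k (\<lambda>\<rho> t. complex_of_real (\<rho> ^ j))"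
  by (rule cls_const[of _ 1]) (auto intro!: continuous_intros power_le_one simp: norm_power)

lemma cls_rho [simp]: "cls k (\<lambda>\<rho> t. complex_of_real \<rho>)"
  using cls_rho_power[of k 1] by simp

lemma base_add: "base f \<Longrightarrow> base g \<Longrightarrow> base (\<lambda>\<rho> t. f \<rho> t + g \<rho> t)"
proof -
  assume f: "base f" and g: "base g"
  obtain B where B: "\<And>\<rho> t. \<rho> \<in> {0<..1} \<Longrightarrow> t \<in> {a..b} \<Longrightarrow> norm (f \<rho> t) \<le> B"
    using base_bound[OF f] by metis
  obtain C where C: "\<And>\<rho> t. \<rho> \<in> {0<..1} \<Longrightarrow> t \<in> {a..b} \<Longrightarrow> norm (g \<rho> t) \<le> C"
    using base_bound[OF g] by metis
  show ?thesis
  proof (rule baseI[of _ "B + C"])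
    fix \<rho> t :: real assume *: "\<rho> \<in> {0<..1}" "t \<in> {a..b}"
    show "norm (f \<rho> t + g \<rho> t) \<le> B + C" by (rule norm_triangle_mono[OF B[OF *] C[OF *]])
  qed (intro continuous_intros baseD f g)
qed

lemma base_mult: "base f \<Longrightarrow> base g \<Longrightarrow> base (\<lambda>\<rho> t. f \<rho> t * g \<rho> t)"
proof -
  assume f: "base f" and g: "base g"
  obtain B where B: "\<And>\<rho> t. \<rho> \<in> {0<..1} \<Longrightarrow> t \<in> {a..b} \<Longrightarrow> norm (f \<rho> t) \<le> B" "B > 0"
    using base_bound[OF f] by metis
  obtain C where C: "\<And>\<rho> t. \<rho> \<in> {0<..1} \<Longrightarrow> t \<in> {a..b} \<Longrightarrow> norm (g \<rho> t) \<le> C" "C > 0"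
    using base_bound[OF g] by metis
  show ?thesis
  proof (rule baseI[of _ "B * C"])
    fix \<rho> t :: real assume *: "\<rho> \<in> {0<..1}" "t \<in> {a..b}"
    show "norm (f \<rho> t * g \<rho> t) \<le> B * C"
      unfolding norm_mult by (rule mult_mono[OF B(1)[OF *] C(1)[OF *]]) (use B(2) in auto)
  qed (intro continuous_intros baseD f g)
qed

lemma hol_add: "hol f \<Longrightarrow> hol g \<Longrightarrow> hol (\<lambda>\<rho> t. f \<rho> t + g \<rho> t)"
proof -
  assume f: "hol f" and g: "hol g"
  obtain C where C: "\<And>\<rho> s t. \<rho> \<in> {0<..1} \<Longrightarrow> s \<in> {a..b} \<Longrightarrow> t \<in> {a..b} \<Longrightarrow> norm (f \<rho> s - f \<rho> t) \<le> C * \<bar>s - t\<bar> powr \<alpha>"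
    using hol_bound[OF f] by metis
  obtain D where D: "\<And>\<rho> s t. \<rho> \<in> {0<..1} \<Longrightarrow> s \<in> {a..b} \<Longrightarrow> t \<in> {a..b} \<Longrightarrow> norm (g \<rho> s - g \<rho> t) \<le> D * \<bar>s - t\<bar> powr \<alpha>"
    using hol_bound[OF g] by metis
  show ?thesis
  proof (rule holI)
    fix \<rho> s t :: real assume *: "\<rho> \<in> {0<..1}" "s \<in> {a..b}" "t \<in> {a..b}"
    have "norm (f \<rho> s + g \<rho> s - (f \<rho> t + g \<rho> t)) \<le> norm (f \<rho> s - f \<rho> t) + norm (g \<rho> s - g \<rho> t)"
      by (metis add_diff_add norm_triangle_ineq)
    also have "\<dots> \<le> (C + D) * \<bar>s - t\<bar> powr \<alpha>" using C[OF *] D[OF *] by (simp add: algebra_simps)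
    finally show "norm (f \<rho> s + g \<rho> s - (f \<rho> t + g \<rho> t)) \<le> (C + D) * \<bar>s - t\<bar> powr \<alpha>" .
  qed
qed

lemma hol_mult:
  assumes f: "hol f" "base f" and g: "hol g" "base g"
  shows "hol (\<lambda>\<rho> t. f \<rho> t * g \<rho> t)"
proof -
  obtain C where C: "\<And>\<rho> s t. \<rho> \<in> {0<..1} \<Longrightarrow> s \<in> {a..b} \<Longrightarrow> t \<in> {a..b} \<Longrightarrow> norm (f \<rho> s - f \<rho> t) \<le> C * \<bar>s - t\<bar> powr \<alpha>" "C > 0"
    using hol_bound[OF f(1)] by metis
  obtain D where D: "\<And>\<rho> s t. \<rho> \<in> {0<..1} \<Longrightarrow> s \<in> {a..b} \<Longrightarrow> t \<in> {a..b} \<Longrightarrow> norm (g \<rho> s - g \<rho> t) \<le> D * \<bar>s - t\<bar> powr \<alpha>" "D > 0"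
    using hol_bound[OF g(1)] by metis
  obtain B where B: "\<And>\<rho> t. \<rho> \<in> {0<..1} \<Longrightarrow> t \<in> {a..b} \<Longrightarrow> norm (f \<rho> t) \<le> B" "B > 0"
    using base_bound[OF f(2)] by metis
  obtain E where E: "\<And>\<rho> t. \<rho> \<in> {0<..1} \<Longrightarrow> t \<in> {a..b} \<Longrightarrow> norm (g \<rho> t) \<le> E" "E > 0"
    using base_bound[OF g(2)] by metis
  show ?thesis
  proof (rule holI)
    fix \<rho> s t :: real assume *: "\<rho> \<in> {0<..1}" "s \<in> {a..b}" "t \<in> {a..b}"
    have "norm (f \<rho> s * g \<rho> s - f \<rho> t * g \<rho> t) = norm (f \<rho> s * (g \<rho> s - g \<rho> t) + (f \<rho> s - f \<rho> t) * g \<rho> t)"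
      by (simp add: algebra_simps)
    also have "\<dots> \<le> norm (f \<rho> s) * norm (g \<rho> s - g \<rho> t) + norm (f \<rho> s - f \<rho> t) * norm (g \<rho> t)"
      by (metis norm_mult norm_triangle_ineq)
    also have "\<dots> \<le> B * (D * \<bar>s - t\<bar> powr \<alpha>) + (C * \<bar>s - t\<bar> powr \<alpha>) * E"
      by (rule add_mono[OF mult_mono[OF B(1)[OF *(1,2)] D(1)[OF *]] mult_mono[OF C(1)[OF *] E(1)[OF *(1,3)]]])
        (use B(2) C(2) in auto)
    finally show "norm (f \<rho> s * g \<rho> s - f \<rho> t * g \<rho> t) \<le> (B * D + C * E) * \<bar>s - t\<bar> powr \<alpha>"
      by (simp add: algebra_simps)
  qed
qed

lemma tder_add: "tder f f' \<Longrightarrow> tder g g' \<Longrightarrow> tder (\<lambda>\<rho> t. f \<rho> t + g \<rho> t) (\<lambda>\<rho> t. f' \<rho> t + g' \<rho> t)"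
  unfolding tder_def by (auto intro!: has_vector_derivative_add)

lemma tder_mult: "tder f f' \<Longrightarrow> tder g g' \<Longrightarrow> tder (\<lambda>\<rho> t. f \<rho> t * g \<rho> t) (\<lambda>\<rho> t. f \<rho> t * g' \<rho> t + f' \<rho> t * g \<rho> t)"
  unfolding tder_def by (auto intro!: has_vector_derivative_mult)

lemma cls_add: "cls k f \<Longrightarrow> cls k g \<Longrightarrow> cls k (\<lambda>\<rho> t. f \<rho> t + g \<rho> t)"
proof (induction k arbitrary: f g)
  case (Suc k)
  then obtain f' g' where "tder f f'" "cls k f'" "tder g g'" "cls k g'" by (elim cls_SucE)
  then have "cls k (\<lambda>\<rho> t. f' \<rho> t + g' \<rho> t)" "tder (\<lambda>\<rho> t. f \<rho> t + g \<rho> t) (\<lambda>\<rho> t. f' \<rho> t + g' \<rho> t)"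
    using Suc.IH[of f' g'] tder_add[of f f' g g'] by simp_all
  then show ?case by (intro cls_SucI[OF base_add[OF Suc.prems[THEN cls_base]]])
qed (auto intro!: cls_0I base_add hol_add dest: cls_base cls_0_hol)

lemma cls_mult: "cls k f \<Longrightarrow> cls k g \<Longrightarrow> cls k (\<lambda>\<rho> t. f \<rho> t * g \<rho> t)"
proof (induction k arbitrary: f g)
  case (Suc k)
  then obtain f' g' where "tder f f'" "cls k f'" "tder g g'" "cls k g'" by (elim cls_SucE)
  moreover have "cls k f" "cls k g" using Suc.prems cls_Suc by blast+
  ultimately have "cls k (\<lambda>\<rho> t. f \<rho> t * g' \<rho> t + f' \<rho> t * g \<rho> t)" "tder (\<lambda>\<rho> t. f \<rho> t * g \<rho> t) (\<lambda>\<rho> t. f \<rho> t * g' \<rho> t + f' \<rho> t * g \<rho> t)"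
    using cls_add[OF Suc.IH[of f g'] Suc.IH[of f' g]] tder_mult[of f f' g g'] by simp_all
  then show ?case by (intro cls_SucI[OF base_mult[OF Suc.prems[THEN cls_base]]])
qed (auto intro!: cls_0I base_mult hol_mult dest: cls_base cls_0_hol)

lemma cls_cmult: "cls k f \<Longrightarrow> cls k (\<lambda>\<rho> t. c * f \<rho> t)"
  by (rule cls_mult) simp_all

lemma base_inverse:
  assumes f: "base f" and c: "c > 0" "\<And>\<rho> t. \<rho> \<in> {0<..1} \<Longrightarrow> t \<in> {a..b} \<Longrightarrow> c \<le> norm (f \<rho> t)"
  shows "base (\<lambda>\<rho> t. inverse (f \<rho> t))"
proof (rule baseI[of _ "inverse c"])
  fix t assume t: "t \<in> {a..b}"
  show "continuous_on {0<..1} (\<lambda>\<rho>. inverse (f \<rho> t))"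
  proof (intro continuous_intros baseD f t ballI)
    fix \<rho> assume "\<rho> \<in> {0<..1::real}"
    from c(2)[OF this t] c(1) show "f \<rho> t \<noteq> 0" by auto
  qed
next
  fix \<rho> t :: real assume "\<rho> \<in> {0<..1}" "t \<in> {a..b}"
  then show "norm (inverse (f \<rho> t)) \<le> inverse c"
    using c unfolding norm_inverse by (intro le_imp_inverse_le) auto
qed

lemma hol_inverse:
  assumes f: "hol f" and c: "c > 0" "\<And>\<rho> t. \<rho> \<in> {0<..1} \<Longrightarrow> t \<in> {a..b} \<Longrightarrow> c \<le> norm (f \<rho> t)"
  shows "hol (\<lambda>\<rho> t. inverse (f \<rho> t))"
proof -
  obtain C where C: "\<And>\<rho> s t. \<rho> \<in> {0<..1} \<Longrightarrow> s \<in> {a..b} \<Longrightarrow> t \<in> {a..b} \<Longrightarrow> norm (f \<rho> s - f \<rho> t) \<le> C * \<bar>s - t\<bar> powr \<alpha>" "C > 0"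
    using hol_bound[OF f(1)] by metis
  show ?thesis
  proof (rule holI)
    fix \<rho> s t :: real assume *: "\<rho> \<in> {0<..1}" "s \<in> {a..b}" "t \<in> {a..b}"
    have nz: "f \<rho> s \<noteq> 0" "f \<rho> t \<noteq> 0" using c(2)[OF *(1,2)] c(2)[OF *(1,3)] c(1) by auto
    then have "inverse (f \<rho> s) - inverse (f \<rho> t) = (f \<rho> t - f \<rho> s) / (f \<rho> s * f \<rho> t)"
      by (simp add: field_simps)
    then have "norm (inverse (f \<rho> s) - inverse (f \<rho> t)) = norm (f \<rho> s - f \<rho> t) / (norm (f \<rho> s) * norm (f \<rho> t))"
      by (simp add: norm_divide norm_mult norm_minus_commute)
    also have "\<dots> \<le> (C * \<bar>s - t\<bar> powr \<alpha>) / (c * c)"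
      by (rule frac_le[OF _ C(1)[OF *] _ mult_mono[OF c(2)[OF *(1,2)] c(2)[OF *(1,3)]]]) (use c(1) C(2) in auto)
    finally show "norm (inverse (f \<rho> s) - inverse (f \<rho> t)) \<le> (C / (c * c)) * \<bar>s - t\<bar> powr \<alpha>" by simp
  qed
qed

lemma tder_inverse:
  assumes f: "tder f f'" and nz: "\<And>\<rho> t. \<rho> \<in> {0<..1} \<Longrightarrow> t \<in> {a..b} \<Longrightarrow> f \<rho> t \<noteq> 0"
  shows "tder (\<lambda>\<rho> t. inverse (f \<rho> t)) (\<lambda>\<rho> t. (- 1) * (f' \<rho> t * (inverse (f \<rho> t) * inverse (f \<rho> t))))"
proof (rule tderI)
  fix \<rho> t :: real assume *: "\<rho> \<in> {0<..1}" "t \<in> {a..b}"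
  then have "(inverse has_field_derivative - (inverse (f \<rho> t) * inverse (f \<rho> t))) (at (f \<rho> t))"
    using DERIV_inverse[of "f \<rho> t" UNIV] nz by (simp add: power2_eq_square)
  from field_vector_diff_chain_within[OF tderD[OF f *] has_field_derivative_at_within[OF this]]
  show "((\<lambda>t. inverse (f \<rho> t)) has_vector_derivative (- 1) * (f' \<rho> t * (inverse (f \<rho> t) * inverse (f \<rho> t)))) (at t within {a..b})"
    by (simp add: o_def)
qed

text \<open>The derivative of the inverse contains the inverse itself, but one order lower, so the
  induction hypothesis applies to the same \<open>f\<close> by \<open>cls_Suc\<close>. The lower
  bound \<open>c\<close> keeps all constants uniform in \<rho>.\<close>

lemma cls_inverse:
  assumes "cls k f" and c: "c > 0" "\<And>\<rho> t. \<rho> \<in> {0<..1} \<Longrightarrow> t \<in> {a..b} \<Longrightarrow> c \<le> norm (f \<rho> t)"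
  shows "cls k (\<lambda>\<rho> t. inverse (f \<rho> t))"
  using assms(1)
proof (induction k)
  case 0
  show ?case by (rule cls_0I[OF base_inverse[OF cls_base[OF 0] c] hol_inverse[OF cls_0_hol[OF 0] c]])
next
  case (Suc k)
  then obtain f' where f': "tder f f'" "cls k f'" by (elim cls_SucE)
  have "cls k (\<lambda>\<rho> t. inverse (f \<rho> t))" by (rule Suc.IH[OF cls_Suc[OF Suc.prems]])
  then have *: "cls k (\<lambda>\<rho> t. (- 1) * (f' \<rho> t * (inverse (f \<rho> t) * inverse (f \<rho> t))))"
    using f'(2) by (intro cls_mult cls_complex_const)
  have nz: "f \<rho> t \<noteq> 0" if "\<rho> \<in> {0<..1}" "t \<in> {a..b}" for \<rho> t
    using c(2)[OF that] c(1) by auto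
  from cls_SucI[OF base_inverse[OF cls_base[OF Suc.prems] c] tder_inverse[OF f'(1) nz] *] show ?case by simp
qed

lemma base_exp: "base f \<Longrightarrow> base (\<lambda>\<rho> t. exp (f \<rho> t))"
proof -
  assume f: "base f"
  obtain B where B: "\<And>\<rho> t. \<rho> \<in> {0<..1} \<Longrightarrow> t \<in> {a..b} \<Longrightarrow> norm (f \<rho> t) \<le> B" "B > 0"
    using base_bound[OF f] by metis
  show ?thesis
  proof (rule baseI[of _ "exp B"])
    fix \<rho> t :: real assume "\<rho> \<in> {0<..1}" "t \<in> {a..b}"
    then show "norm (exp (f \<rho> t)) \<le> exp B"
      using B(1)[of \<rho> t] complex_Re_le_cmod[of "f \<rho> t"] by (simp add: norm_exp_eq_Re)
  qed (intro continuous_intros baseD f)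
qed

lemma exp_lipschitz:
  fixes x y :: complex
  assumes "norm x \<le> B" "norm y \<le> B"
  shows "norm (exp x - exp y) \<le> exp B * norm (x - y)"
proof (rule field_differentiable_bound[of "cball 0 B" exp exp])
  fix z :: complex assume "z \<in> cball 0 B"
  then show "norm (exp z) \<le> exp B"
    using complex_Re_le_cmod[of z] by (simp add: norm_exp_eq_Re)
qed (use assms in \<open>auto intro!: derivative_eq_intros\<close>)

lemma hol_exp:
  assumes f: "hol f" "base f"
  shows "hol (\<lambda>\<rho> t. exp (f \<rho> t))"
proof -
  obtain C where C: "\<And>\<rho> s t. \<rho> \<in> {0<..1} \<Longrightarrow> s \<in> {a..b} \<Longrightarrow> t \<in> {a..b} \<Longrightarrow> norm (f \<rho> s - f \<rho> t) \<le> C * \<bar>s - t\<bar> powr \<alpha>" "C > 0"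
    using hol_bound[OF f(1)] by metis
  obtain B where B: "\<And>\<rho> t. \<rho> \<in> {0<..1} \<Longrightarrow> t \<in> {a..b} \<Longrightarrow> norm (f \<rho> t) \<le> B" "B > 0"
    using base_bound[OF f(2)] by metis
  show ?thesis
  proof (rule holI)
    fix \<rho> s t :: real assume *: "\<rho> \<in> {0<..1}" "s \<in> {a..b}" "t \<in> {a..b}"
    have "norm (exp (f \<rho> s) - exp (f \<rho> t)) \<le> exp B * norm (f \<rho> s - f \<rho> t)"
      by (intro exp_lipschitz B *)
    also have "\<dots> \<le> exp B * (C * \<bar>s - t\<bar> powr \<alpha>)" by (intro mult_left_mono C *) simp
    finally show "norm (exp (f \<rho> s) - exp (f \<rho> t)) \<le> (exp B * C) * \<bar>s - t\<bar> powr \<alpha>" by (simp add: mult.assoc)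
  qed
qed

lemma tder_exp:
  assumes "tder f f'"
  shows "tder (\<lambda>\<rho> t. exp (f \<rho> t)) (\<lambda>\<rho> t. f' \<rho> t * exp (f \<rho> t))"
proof (rule tderI)
  fix \<rho> t :: real assume *: "\<rho> \<in> {0<..1}" "t \<in> {a..b}"
  from field_vector_diff_chain_within[OF tderD[OF assms *] has_field_derivative_at_within[OF DERIV_exp]]
  show "((\<lambda>t. exp (f \<rho> t)) has_vector_derivative f' \<rho> t * exp (f \<rho> t)) (at t within {a..b})"
    by (simp add: o_def)
qed

lemma cls_exp: "cls k f \<Longrightarrow> cls k (\<lambda>\<rho> t. exp (f \<rho> t))"
proof (induction k)
  case 0
  show ?case by (rule cls_0I[OF base_exp[OF cls_base[OF 0]] hol_exp[OF cls_0_hol[OF 0] cls_base[OF 0]]])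
next
  case (Suc k)
  then obtain f' where f': "tder f f'" "cls k f'" by (elim cls_SucE)
  have "cls k (\<lambda>\<rho> t. exp (f \<rho> t))" by (rule Suc.IH[OF cls_Suc[OF Suc.prems]])
  then have *: "cls k (\<lambda>\<rho> t. f' \<rho> t * exp (f \<rho> t))" using f'(2) by (intro cls_mult)
  then show ?case by (rule cls_SucI[OF base_exp[OF cls_base[OF Suc.prems]] tder_exp[OF f'(1)]])
qed

lemma base_t: "continuous_on {a..b} g \<Longrightarrow> base (\<lambda>\<rho> t. g t)"
proof -
  assume c: "continuous_on {a..b} g"
  have "compact (g ` {a..b})" by (intro compact_continuous_image c) simp
  then obtain B where "\<And>t. t \<in> {a..b} \<Longrightarrow> norm (g t) \<le> B"
    by (metis bounded_iff compact_imp_bounded image_eqI)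
  then show ?thesis by (intro baseI) auto
qed

text \<open>Powers of t are smooth to every order because t stays above \<open>a > 0\<close>. The
  scaling introduces such powers, which is why the estimates are made away from time 0.\<close>

lemma cls_powr [simp]: "cls k (\<lambda>\<rho> t. complex_of_real (t powr p))"
proof -
  have bs: "base (\<lambda>\<rho> t. complex_of_real (t powr p))" for p
    using ab by (intro base_t continuous_intros) auto
  have td: "tder (\<lambda>\<rho> t. complex_of_real (t powr p)) (\<lambda>\<rho> t. complex_of_real p * complex_of_real (t powr (p - 1)))" for p
  proof (rule tderI)
    fix \<rho> t :: real assume "t \<in> {a..b}"
    then have "((\<lambda>t. t powr p) has_real_derivative p * t powr (p - 1)) (at t within {a..b})"
      using ab by (auto intro!: derivative_eq_intros)
    then show "((\<lambda>t. complex_of_real (t powr p)) has_vector_derivative complex_of_real p * complex_of_real (t powr (p - 1))) (at t within {a..b})"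
      using has_vector_derivative_of_real by fastforce
  qed
  show ?thesis
  proof (induction k arbitrary: p)
    case 0
    show ?case by (rule cls_0I[OF bs tder_hol[OF td base_mult[OF cls_base[OF cls_complex_const] bs]]])
  next
    case (Suc k)
    show ?case by (rule cls_SucI[OF bs td cls_cmult[OF Suc.IH]])
  qed
qed

text \<open>At \<rho> = 1 the rescaled backward time is the full time t. Freezing \<rho> there makes
  boundary values available as coefficients.\<close>

lemma cls_at_1: "cls k f \<Longrightarrow> cls k (\<lambda>\<rho> t. f 1 t)"
proof (induction k arbitrary: f)
  case 0
  obtain B where "\<And>\<rho> t. \<rho> \<in> {0<..1} \<Longrightarrow> t \<in> {a..b} \<Longrightarrow> norm (f \<rho> t) \<le> B"
    using base_bound[OF cls_base[OF 0]] by metis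
  then have "base (\<lambda>\<rho> t. f 1 t)" by (intro baseI[of _ B]) auto
  moreover have "hol (\<lambda>\<rho> t. f 1 t)"
  proof -
    obtain C where "\<And>\<rho> s t. \<rho> \<in> {0<..1} \<Longrightarrow> s \<in> {a..b} \<Longrightarrow> t \<in> {a..b} \<Longrightarrow> norm (f \<rho> s - f \<rho> t) \<le> C * \<bar>s - t\<bar> powr \<alpha>"
      using hol_bound[OF cls_hol[OF 0]] by metis
    then show ?thesis by (intro holI[of _ C]) simp
  qed
  ultimately show ?case by (rule cls_0I)
next
  case (Suc k)
  then obtain f' where f': "tder f f'" "cls k f'" by (elim cls_SucE)
  obtain B where "\<And>\<rho> t. \<rho> \<in> {0<..1} \<Longrightarrow> t \<in> {a..b} \<Longrightarrow> norm (f \<rho> t) \<le> B"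
    using base_bound[OF cls_base[OF Suc.prems]] by metis
  then have "base (\<lambda>\<rho> t. f 1 t)" by (intro baseI[of _ B]) auto
  moreover have "tder (\<lambda>\<rho> t. f 1 t) (\<lambda>\<rho> t. f' 1 t)" using f'(1) by (auto simp: tder_def)
  ultimately show ?case by (rule cls_SucI[OF _ _ Suc.IH[OF f'(2)]])
qed

end

section \<open>Weighted means in \<rho>\<close>

lemma integral_norm_bound_half_open:
  fixes f :: "real \<Rightarrow> complex"
  assumes f: "f integrable_on {0..r}" and g: "g integrable_on {0..r}"
    and le: "\<And>x. x \<in> {0<..r} \<Longrightarrow> norm (f x) \<le> g x"
  shows "norm (integral {0..r} f) \<le> integral {0..r} g"
proof -
  let ?f = "\<lambda>x. if x = 0 then 0 else f x" and ?g = "\<lambda>x. if x = 0 then 0 else g x"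
  have "integral {0..r} f = integral {0..r} ?f" "integral {0..r} g = integral {0..r} ?g"
    by (rule integral_spike[OF negligible_sing[of 0]]; simp)+
  moreover have "?f integrable_on {0..r}" "?g integrable_on {0..r}"
    by (rule integrable_spike[OF f negligible_sing[of 0]], simp) (rule integrable_spike[OF g negligible_sing[of 0]], simp)
  then have "norm (integral {0..r} ?f) \<le> integral {0..r} ?g"
    by (rule integral_norm_bound_integral) (use le in auto)
  ultimately show ?thesis by simp
qed

text \<open>The bounded solution \<open>u\<close> of
  \<open>(\<rho> ^ Suc j * u)' = \<rho> ^ j * f\<close>, a Hardy averaging operator. The singular
  linear equations in \<rho> are solved in this form, in which nothing blows up as \<rho> tends to
  0.\<close>

definition radial_mean :: "nat \<Rightarrow> (real \<Rightarrow> complex) \<Rightarrow> real \<Rightarrow> complex" where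
  "radial_mean j f \<rho> = integral {0..\<rho>} (\<lambda>r. complex_of_real (r ^ j) * f r) / complex_of_real (\<rho> ^ Suc j)"

lemma radial_integrable:
  assumes c: "continuous_on {0<..1} f" and b: "\<And>r. r \<in> {0<..1} \<Longrightarrow> norm (f r) \<le> B" and \<rho>: "\<rho> \<in> {0<..1}"
  shows "(\<lambda>r. complex_of_real (r ^ j) * f r) integrable_on {0..\<rho>}"
proof (rule integrable_on_bounded_half_open[where g = "\<lambda>r. B"])
  show "continuous_on {0<..\<rho>} (\<lambda>r. complex_of_real (r ^ j) * f r)"
    by (intro continuous_intros continuous_on_subset[OF c]) (use \<rho> in auto)
  fix r assume "r \<in> {0<..\<rho>}"
  then have r: "r \<in> {0<..1}" using \<rho> by auto
  have "r ^ j * norm (f r) \<le> 1 * B"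
    using r b[OF r] by (intro mult_mono power_le_one) auto
  then show "norm (complex_of_real (r ^ j) * f r) \<le> B"
    using r by (simp add: norm_mult norm_power)
qed auto

text \<open>Only values of \<open>f\<close> on \<open>{0<..\<rho>}\<close> enter, so a decay of
  \<open>f\<close> as \<rho> tends to 0 is inherited by the mean.\<close>

lemma radial_mean_bound:
  assumes c: "continuous_on {0<..1} f" and b: "\<And>r. r \<in> {0<..1} \<Longrightarrow> norm (f r) \<le> B" and \<rho>: "\<rho> \<in> {0<..1}"
    and b': "\<And>r. r \<in> {0<..\<rho>} \<Longrightarrow> norm (f r) \<le> B'"
  shows "norm (radial_mean j f \<rho>) \<le> B'"
proof -
  have \<rho>0: "\<rho> > 0" using \<rho> by simp
  have B'0: "B' \<ge> 0" by (rule order_trans[OF norm_ge_zero b'[of \<rho>]]) (use \<rho> in auto)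
  have "norm (integral {0..\<rho>} (\<lambda>r. complex_of_real (r ^ j) * f r)) \<le> integral {0..\<rho>} (\<lambda>r. \<rho> ^ j * B')"
  proof (rule integral_norm_bound_half_open[OF radial_integrable[OF c b \<rho>]])
    fix r assume r: "r \<in> {0<..\<rho>}"
    have "r ^ j * norm (f r) \<le> \<rho> ^ j * B'"
      using r b'[OF r] by (intro mult_mono power_mono) auto
    then show "norm (complex_of_real (r ^ j) * f r) \<le> \<rho> ^ j * B'"
      using r by (simp add: norm_mult norm_power)
  qed auto
  also have "\<dots> = \<rho> ^ Suc j * B'" using \<rho>0 by simp
  finally show ?thesis
    using \<rho>0 unfolding radial_mean_def by (simp add: norm_divide norm_power divide_le_eq mult.commute norm_mult)
qed

lemma radial_mean_continuous:
  assumes c: "continuous_on {0<..1} f" and b: "\<And>r. r \<in> {0<..1} \<Longrightarrow> norm (f r) \<le> B"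
  shows "continuous_on {0<..1} (radial_mean j f)"
  unfolding radial_mean_def
proof (intro continuous_intros ballI)
  have "(\<lambda>r. complex_of_real (r ^ j) * f r) integrable_on {0..1}"
    by (rule radial_integrable[OF c b]) auto
  then have "continuous_on {0..1} (\<lambda>\<rho>. integral {0..\<rho>} (\<lambda>r. complex_of_real (r ^ j) * f r))"
    by (rule indefinite_integral_continuous_1)
  then show "continuous_on {0<..1} (\<lambda>\<rho>. integral {0..\<rho>} (\<lambda>r. complex_of_real (r ^ j) * f r))"
    by (rule continuous_on_subset) auto
qed auto

lemma radial_mean_diff:
  assumes "continuous_on {0<..1} f" "\<And>r. r \<in> {0<..1} \<Longrightarrow> norm (f r) \<le> B"
    "continuous_on {0<..1} g" "\<And>r. r \<in> {0<..1} \<Longrightarrow> norm (g r) \<le> C" "\<rho> \<in> {0<..1}"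
  shows "radial_mean j (\<lambda>r. f r - g r) \<rho> = radial_mean j f \<rho> - radial_mean j g \<rho>"
  unfolding radial_mean_def
  by (simp only: right_diff_distrib diff_divide_distrib integral_diff[OF radial_integrable[OF assms(1,2,5)] radial_integrable[OF assms(3,4,5)]])

lemma radial_mean_scaleR:
  "radial_mean j (\<lambda>r. c *\<^sub>R f r) \<rho> = c *\<^sub>R radial_mean j f \<rho>"
  by (simp only: radial_mean_def mult_scaleR_right integral_cmul) (simp add: scaleR_conv_of_real)

context parameter_interval
begin

definition Av :: "nat \<Rightarrow> (real \<Rightarrow> real \<Rightarrow> complex) \<Rightarrow> real \<Rightarrow> real \<Rightarrow> complex" where
  "Av j f \<rho> t = radial_mean j (\<lambda>r. f r t) \<rho>"

lemma Av_bound: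
  assumes f: "base f" and \<rho>: "\<rho> \<in> {0<..1}" and t: "t \<in> {a..b}"
    and b: "\<And>r. r \<in> {0<..\<rho>} \<Longrightarrow> norm (f r t) \<le> B'"
  shows "norm (Av j f \<rho> t) \<le> B'"
proof -
  obtain B where B: "\<And>\<rho> t. \<rho> \<in> {0<..1} \<Longrightarrow> t \<in> {a..b} \<Longrightarrow> norm (f \<rho> t) \<le> B"
    using base_bound[OF f] by metis
  show ?thesis unfolding Av_def
    by (rule radial_mean_bound[OF baseD[OF f t] B[OF _ t] \<rho> b])
qed

lemma base_Av: "base f \<Longrightarrow> base (Av j f)"
proof -
  assume f: "base f"
  obtain B where B: "\<And>\<rho> t. \<rho> \<in> {0<..1} \<Longrightarrow> t \<in> {a..b} \<Longrightarrow> norm (f \<rho> t) \<le> B"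
    using base_bound[OF f] by metis
  show ?thesis
  proof (rule baseI[of _ B])
    fix t assume t: "t \<in> {a..b}"
    show "continuous_on {0<..1} (\<lambda>\<rho>. Av j f \<rho> t)"
      unfolding Av_def by (rule radial_mean_continuous[OF baseD[OF f t] B[OF _ t]])
  next
    fix \<rho> t :: real assume *: "\<rho> \<in> {0<..1}" "t \<in> {a..b}"
    show "norm (Av j f \<rho> t) \<le> B" by (rule Av_bound[OF f *]) (use * B in auto)
  qed
qed

text \<open>The means act on \<rho> only, so an expansion in t with a remainder uniform in \<rho> is
  averaged term by term. Taking \<open>c = 0\<close> yields Hoelder continuity, taking
  \<open>c = s - t\<close> differentiability.\<close>

lemma Av_diff_bound:
  assumes f: "base f" and g: "base g" and \<rho>: "\<rho> \<in> {0<..1}" and st: "s \<in> {a..b}" "t \<in> {a..b}"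
    and b: "\<And>r. r \<in> {0<..1} \<Longrightarrow> norm (f r s - f r t - c *\<^sub>R g r t) \<le> B'"
  shows "norm (Av j f \<rho> s - Av j f \<rho> t - c *\<^sub>R Av j g \<rho> t) \<le> B'"
proof -
  obtain B where B: "\<And>\<rho> t. \<rho> \<in> {0<..1} \<Longrightarrow> t \<in> {a..b} \<Longrightarrow> norm (f \<rho> t) \<le> B"
    using base_bound[OF f] by metis
  obtain C where C: "\<And>\<rho> t. \<rho> \<in> {0<..1} \<Longrightarrow> t \<in> {a..b} \<Longrightarrow> norm (g \<rho> t) \<le> C"
    using base_bound[OF g] by metis
  have c1: "continuous_on {0<..1} (\<lambda>r. f r s)" "continuous_on {0<..1} (\<lambda>r. f r t)" "continuous_on {0<..1} (\<lambda>r. c *\<^sub>R g r t)"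
    by (intro continuous_intros baseD f g st)+
  have c2: "continuous_on {0<..1} (\<lambda>r. f r s - f r t)"
    by (intro continuous_intros c1)
  have b2: "norm (f r s - f r t) \<le> B + B" if "r \<in> {0<..1}" for r
    by (rule order_trans[OF norm_triangle_ineq4 add_mono[OF B[OF that st(1)] B[OF that st(2)]]])
  have b3: "norm (c *\<^sub>R g r t) \<le> \<bar>c\<bar> * C" if "r \<in> {0<..1}" for r
    using C[OF that st(2)] by (simp add: mult_left_mono)
  have "Av j f \<rho> s - Av j f \<rho> t - c *\<^sub>R Av j g \<rho> t = radial_mean j (\<lambda>r. f r s - f r t - c *\<^sub>R g r t) \<rho>"
    unfolding Av_def radial_mean_scaleR[symmetric]
    by (simp only: radial_mean_diff[OF c2 b2 c1(3) b3 \<rho>] radial_mean_diff[OF c1(1) B[OF _ st(1)] c1(2) B[OF _ st(2)] \<rho>])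
  also have "norm \<dots> \<le> B'"
    by (rule radial_mean_bound[OF _ b \<rho> b]) (use \<rho> in \<open>auto intro!: continuous_intros c1 c2\<close>)
  finally show ?thesis .
qed

lemma hol_Av:
  assumes f: "hol f" "base f"
  shows "hol (Av j f)"
proof -
  obtain C where C: "\<And>\<rho> s t. \<rho> \<in> {0<..1} \<Longrightarrow> s \<in> {a..b} \<Longrightarrow> t \<in> {a..b} \<Longrightarrow> norm (f \<rho> s - f \<rho> t) \<le> C * \<bar>s - t\<bar> powr \<alpha>" "C > 0"
    using hol_bound[OF f(1)] by metis
  show ?thesis
  proof (rule holI)
    fix \<rho> s t :: real assume *: "\<rho> \<in> {0<..1}" "s \<in> {a..b}" "t \<in> {a..b}"
    have "norm (Av j f \<rho> s - Av j f \<rho> t - 0 *\<^sub>R Av j f \<rho> t) \<le> C * \<bar>s - t\<bar> powr \<alpha>"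
      by (rule Av_diff_bound[OF f(2,2) *]) (use C(1)[OF _ *(2,3)] in simp)
    then show "norm (Av j f \<rho> s - Av j f \<rho> t) \<le> C * \<bar>s - t\<bar> powr \<alpha>" by simp
  qed
qed

lemma tder_Av:
  assumes "tder f f'" "base f" and f': "hol f'" "base f'"
  shows "tder (Av j f) (Av j f')"
proof -
  obtain C where C: "C > 0" "\<And>\<rho> s t. \<rho> \<in> {0<..1} \<Longrightarrow> s \<in> {a..b} \<Longrightarrow> t \<in> {a..b} \<Longrightarrow>
     norm (f \<rho> s - f \<rho> t - (s - t) *\<^sub>R f' \<rho> t) \<le> C * \<bar>s - t\<bar> powr (1 + \<alpha>)"
    using tder_taylor[OF assms(1) f'(1)] by metis
  show ?thesis
  proof (rule tderI, rule has_vector_derivative_of_taylor[OF _ \<alpha>(1)])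
    fix \<rho> t s :: real assume *: "\<rho> \<in> {0<..1}" "t \<in> {a..b}" "s \<in> {a..b}"
    show "norm (Av j f \<rho> s - Av j f \<rho> t - (s - t) *\<^sub>R Av j f' \<rho> t) \<le> C * \<bar>s - t\<bar> powr (1 + \<alpha>)"
      by (rule Av_diff_bound[OF assms(2) f'(2) *(1,3,2)]) (rule C(2)[OF _ *(3,2)])
  qed
qed

lemma cls_Av: "cls k f \<Longrightarrow> cls k (Av j f)"
proof (induction k arbitrary: f)
  case 0
  show ?case by (rule cls_0I[OF base_Av[OF cls_base[OF 0]] hol_Av[OF cls_0_hol[OF 0] cls_base[OF 0]]])
next
  case (Suc k)
  obtain f' where f': "tder f f'" "cls k f'" by (rule cls_SucE[OF Suc.prems])
  show ?case
    by (rule cls_SucI[OF base_Av[OF cls_base[OF Suc.prems]]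
      tder_Av[OF f'(1) cls_base[OF Suc.prems] cls_hol[OF f'(2)] cls_base[OF f'(2)]] Suc.IH[OF f'(2)]])
qed

lemma tder_rho_mult: "tder f f' \<Longrightarrow> tder (\<lambda>\<rho> t. g \<rho> * f \<rho> t) (\<lambda>\<rho> t. g \<rho> * f' \<rho> t)"
  unfolding tder_def by (auto intro!: has_vector_derivative_mult_right)

lemma rho_square_le:
  assumes "\<rho> \<in> {0<..1}"
  shows "\<rho>\<^sup>2 \<le> \<rho> powr (2 * \<alpha>)"
proof -
  have "\<rho> powr 2 \<le> \<rho> powr (2 * \<alpha>)"
    using assms \<alpha> by (intro powr_mono') auto
  then show ?thesis using assms by (simp add: powr_numeral)
qed

text \<open>With a full extra derivative available, \<open>\<rho>\<^sup>2 * f'\<close> is the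
  derivative wanted, and its decay follows from
  \<open>\<rho>\<^sup>2 \<le> \<rho> powr (2 * \<alpha>)\<close>.\<close>

lemma cls_imp_zcls: "cls (Suc k) f \<Longrightarrow> zcls k f"
proof (induction k arbitrary: f)
  case 0
  obtain f' where f': "tder f f'" "cls 0 f'" by (rule cls_SucE[OF 0])
  obtain B where B: "B > 0" "\<And>\<rho> t. \<rho> \<in> {0<..1} \<Longrightarrow> t \<in> {a..b} \<Longrightarrow> norm (f' \<rho> t) \<le> B"
    using base_bound[OF cls_base[OF f'(2)]] by metis
  show ?case
  proof (rule zcls_0I[OF cls_Suc[OF 0] tder_rho_mult[OF f'(1)]])
    show "cls 0 (\<lambda>\<rho> t. complex_of_real (\<rho>\<^sup>2) * f' \<rho> t)"
      by (rule cls_mult[OF cls_rho_power f'(2)])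
    fix \<rho> t :: real assume *: "\<rho> \<in> {0<..1}" "t \<in> {a..b}"
    have "norm (complex_of_real (\<rho>\<^sup>2) * f' \<rho> t) = \<rho>\<^sup>2 * norm (f' \<rho> t)"
      by (simp add: norm_mult norm_power)
    also have "\<dots> \<le> \<rho> powr (2 * \<alpha>) * B"
      by (rule mult_mono[OF rho_square_le[OF *(1)] B(2)[OF *]]) auto
    finally show "norm (complex_of_real (\<rho>\<^sup>2) * f' \<rho> t) \<le> B * \<rho> powr (2 * \<alpha>)" by (simp add: mult.commute)
  qed
next
  case (Suc k)
  obtain f' where f': "tder f f'" "cls (Suc k) f'" by (rule cls_SucE[OF Suc.prems])
  show ?case by (rule zcls_SucI[OF cls_base[OF Suc.prems] f'(1) Suc.IH[OF f'(2)]])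
qed

lemma zcls_imp_cls: "zcls k f \<Longrightarrow> cls k f"
proof (induction k arbitrary: f)
  case 0
  then show ?case by (simp add: zcls.simps)
next
  case (Suc k)
  obtain f' where f': "tder f f'" "zcls k f'" by (rule zcls_SucE[OF Suc.prems])
  show ?case by (rule cls_SucI[OF zcls_base[OF Suc.prems] f'(1) Suc.IH[OF f'(2)]])
qed

lemma zcls_Suc: "zcls (Suc k) f \<Longrightarrow> zcls k f"
  using cls_imp_zcls zcls_imp_cls by blast

lemma zcls_add: "zcls k f \<Longrightarrow> zcls k g \<Longrightarrow> zcls k (\<lambda>\<rho> t. f \<rho> t + g \<rho> t)"
proof (induction k arbitrary: f g)
  case 0
  obtain m C where m: "tder (\<lambda>\<rho> t. complex_of_real (\<rho>\<^sup>2) * f \<rho> t) m" "cls 0 m"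
    "\<And>\<rho> t. \<rho> \<in> {0<..1} \<Longrightarrow> t \<in> {a..b} \<Longrightarrow> norm (m \<rho> t) \<le> C * \<rho> powr (2 * \<alpha>)" "C > 0"
    by (rule zcls_0D[OF 0(1)]) (rule that)
  obtain n D where n: "tder (\<lambda>\<rho> t. complex_of_real (\<rho>\<^sup>2) * g \<rho> t) n" "cls 0 n"
    "\<And>\<rho> t. \<rho> \<in> {0<..1} \<Longrightarrow> t \<in> {a..b} \<Longrightarrow> norm (n \<rho> t) \<le> D * \<rho> powr (2 * \<alpha>)" "D > 0"
    by (rule zcls_0D[OF 0(2)]) (rule that)
  show ?case
  proof (rule zcls_0I)
    show "cls 0 (\<lambda>\<rho> t. f \<rho> t + g \<rho> t)" by (rule cls_add[OF zcls_imp_cls[OF 0(1)] zcls_imp_cls[OF 0(2)]])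
    show "cls 0 (\<lambda>\<rho> t. m \<rho> t + n \<rho> t)" by (rule cls_add[OF m(2) n(2)])
    show "tder (\<lambda>\<rho> t. complex_of_real (\<rho>\<^sup>2) * (f \<rho> t + g \<rho> t)) (\<lambda>\<rho> t. m \<rho> t + n \<rho> t)"
      using tder_add[OF m(1) n(1)] by (simp add: distrib_left)
    fix \<rho> t :: real assume *: "\<rho> \<in> {0<..1}" "t \<in> {a..b}"
    show "norm (m \<rho> t + n \<rho> t) \<le> (C + D) * \<rho> powr (2 * \<alpha>)"
      unfolding distrib_right by (rule norm_triangle_mono[OF m(3)[OF *] n(3)[OF *]])
  qed
next
  case (Suc k)
  obtain f' where f': "tder f f'" "zcls k f'" by (rule zcls_SucE[OF Suc.prems(1)])
  obtain g' where g': "tder g g'" "zcls k g'" by (rule zcls_SucE[OF Suc.prems(2)])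
  show ?case
    by (rule zcls_SucI[OF base_add[OF Suc.prems[THEN zcls_base]] tder_add[OF f'(1) g'(1)] Suc.IH[OF f'(2) g'(2)]])
qed

text \<open>The multiplier has one derivative more than \<open>f\<close> because the product rule
  for \<open>g * (\<rho>\<^sup>2 * f)\<close> differentiates it. The term with \<open>g'\<close>
  still carries \<open>\<rho>\<^sup>2\<close> and so decays as required.\<close>

lemma zcls_mult: "cls (Suc k) g \<Longrightarrow> zcls k f \<Longrightarrow> zcls k (\<lambda>\<rho> t. g \<rho> t * f \<rho> t)"
proof (induction k arbitrary: f g)
  case 0
  obtain m C where m: "tder (\<lambda>\<rho> t. complex_of_real (\<rho>\<^sup>2) * f \<rho> t) m" "cls 0 m"
    "\<And>\<rho> t. \<rho> \<in> {0<..1} \<Longrightarrow> t \<in> {a..b} \<Longrightarrow> norm (m \<rho> t) \<le> C * \<rho> powr (2 * \<alpha>)" "C > 0"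
    by (rule zcls_0D[OF 0(2)]) (rule that)
  obtain g' where g': "tder g g'" "cls 0 g'" by (rule cls_SucE[OF 0(1)])
  have cg: "cls 0 g" and cf: "cls 0 f" using cls_Suc[OF 0(1)] zcls_imp_cls[OF 0(2)] .
  have cr: "cls 0 (\<lambda>\<rho> t. complex_of_real (\<rho>\<^sup>2) * f \<rho> t)" by (rule cls_mult[OF cls_rho_power cf])
  have cgf: "cls 0 (\<lambda>\<rho> t. g' \<rho> t * f \<rho> t)" by (rule cls_mult[OF g'(2) cf])
  obtain B where B: "B > 0" "\<And>\<rho> t. \<rho> \<in> {0<..1} \<Longrightarrow> t \<in> {a..b} \<Longrightarrow> norm (g' \<rho> t * f \<rho> t) \<le> B"
    using base_bound[OF cls_base[OF cgf]] by metis
  obtain D where D: "D > 0" "\<And>\<rho> t. \<rho> \<in> {0<..1} \<Longrightarrow> t \<in> {a..b} \<Longrightarrow> norm (g \<rho> t) \<le> D"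
    using base_bound[OF cls_base[OF cg]] by metis
  show ?case
  proof (rule zcls_0I)
    show "cls 0 (\<lambda>\<rho> t. g \<rho> t * f \<rho> t)" by (rule cls_mult[OF cg cf])
    show "cls 0 (\<lambda>\<rho> t. g \<rho> t * m \<rho> t + g' \<rho> t * (complex_of_real (\<rho>\<^sup>2) * f \<rho> t))"
      by (rule cls_add[OF cls_mult[OF cg m(2)] cls_mult[OF g'(2) cr]])
    have "(\<lambda>\<rho> t. complex_of_real (\<rho>\<^sup>2) * (g \<rho> t * f \<rho> t)) = (\<lambda>\<rho> t. g \<rho> t * (complex_of_real (\<rho>\<^sup>2) * f \<rho> t))"
      by (simp add: mult_ac)
    then show "tder (\<lambda>\<rho> t. complex_of_real (\<rho>\<^sup>2) * (g \<rho> t * f \<rho> t)) (\<lambda>\<rho> t. g \<rho> t * m \<rho> t + g' \<rho> t * (complex_of_real (\<rho>\<^sup>2) * f \<rho> t))"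
      using tder_mult[OF g'(1) m(1)] by (simp only:)
    fix \<rho> t :: real assume *: "\<rho> \<in> {0<..1}" "t \<in> {a..b}"
    have "norm (g \<rho> t * m \<rho> t) \<le> D * (C * \<rho> powr (2 * \<alpha>))"
      unfolding norm_mult by (rule mult_mono[OF D(2)[OF *] m(3)[OF *]]) (use D(1) in auto)
    moreover have "norm (g' \<rho> t * (complex_of_real (\<rho>\<^sup>2) * f \<rho> t)) = \<rho>\<^sup>2 * norm (g' \<rho> t * f \<rho> t)"
      by (simp add: norm_mult norm_power)
    moreover have "\<rho>\<^sup>2 * norm (g' \<rho> t * f \<rho> t) \<le> \<rho> powr (2 * \<alpha>) * B"
      by (rule mult_mono[OF rho_square_le[OF *(1)] B(2)[OF *]]) auto
    ultimately have "norm (g \<rho> t * m \<rho> t + g' \<rho> t * (complex_of_real (\<rho>\<^sup>2) * f \<rho> t)) \<le> D * (C * \<rho> powr (2 * \<alpha>)) + \<rho> powr (2 * \<alpha>) * B"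
      by (intro norm_triangle_mono) simp_all
    then show "norm (g \<rho> t * m \<rho> t + g' \<rho> t * (complex_of_real (\<rho>\<^sup>2) * f \<rho> t)) \<le> (D * C + B) * \<rho> powr (2 * \<alpha>)"
      by (simp add: algebra_simps)
  qed
next
  case (Suc k)
  obtain f' where f': "tder f f'" "zcls k f'" by (rule zcls_SucE[OF Suc.prems(2)])
  obtain g' where g': "tder g g'" "cls (Suc k) g'" by (rule cls_SucE[OF Suc.prems(1)])
  have "zcls k (\<lambda>\<rho> t. g \<rho> t * f' \<rho> t + g' \<rho> t * f \<rho> t)"
    by (rule zcls_add[OF Suc.IH[OF cls_Suc[OF Suc.prems(1)] f'(2)] Suc.IH[OF g'(2) zcls_Suc[OF Suc.prems(2)]]])
  then show ?case
    by (rule zcls_SucI[OF base_mult[OF cls_base[OF Suc.prems(1)] zcls_base[OF Suc.prems(2)]] tder_mult[OF g'(1) f'(1)]])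
qed

text \<open>The weight 2 is exactly right:
  \<open>\<rho>\<^sup>2 * Av 2 f = Av 0 (\<rho>\<^sup>2 * f)\<close>, so the factor that gains a
  derivative moves inside the mean. The decay survives because its bound increases with
  \<rho>.\<close>

lemma zcls_Av2: "zcls k f \<Longrightarrow> zcls k (Av 2 f)"
proof (induction k arbitrary: f)
  case 0
  obtain m C where m: "tder (\<lambda>\<rho> t. complex_of_real (\<rho>\<^sup>2) * f \<rho> t) m" "cls 0 m"
    "\<And>\<rho> t. \<rho> \<in> {0<..1} \<Longrightarrow> t \<in> {a..b} \<Longrightarrow> norm (m \<rho> t) \<le> C * \<rho> powr (2 * \<alpha>)" "C > 0"
    by (rule zcls_0D[OF 0(1)]) (rule that)
  have cf: "cls 0 f" by (rule zcls_imp_cls[OF 0])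
  have cr: "cls 0 (\<lambda>\<rho> t. complex_of_real (\<rho>\<^sup>2) * f \<rho> t)" by (rule cls_mult[OF cls_rho_power cf])
  show ?case
  proof (rule zcls_0I[OF cls_Av[OF cf]])
    show "cls 0 (Av 0 m)" by (rule cls_Av[OF m(2)])
    have "tder (Av 0 (\<lambda>\<rho> t. complex_of_real (\<rho>\<^sup>2) * f \<rho> t)) (Av 0 m)"
      by (rule tder_Av[OF m(1) cls_base[OF cr] cls_hol[OF m(2)] cls_base[OF m(2)]])
    then show "tder (\<lambda>\<rho> t. complex_of_real (\<rho>\<^sup>2) * Av 2 f \<rho> t) (Av 0 m)"
    proof (rule tder_cong[rotated])
      fix \<rho> t :: real assume "\<rho> \<in> {0<..1}"
      then show "Av 0 (\<lambda>\<rho> t. complex_of_real (\<rho>\<^sup>2) * f \<rho> t) \<rho> t = complex_of_real (\<rho>\<^sup>2) * Av 2 f \<rho> t"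
        by (simp add: Av_def radial_mean_def power2_eq_square field_simps numeral_eq_Suc)
    qed
    fix \<rho> t :: real assume *: "\<rho> \<in> {0<..1}" "t \<in> {a..b}"
    show "norm (Av 0 m \<rho> t) \<le> C * \<rho> powr (2 * \<alpha>)"
    proof (rule Av_bound[OF cls_base[OF m(2)] *])
      fix r assume r: "r \<in> {0<..\<rho>}"
      then have r1: "r \<in> {0<..1}" using *(1) by auto
      have "norm (m r t) \<le> C * r powr (2 * \<alpha>)" by (rule m(3)[OF r1 *(2)])
      also have "\<dots> \<le> C * \<rho> powr (2 * \<alpha>)"
        using r \<alpha> m(4) by (intro mult_left_mono powr_mono2) auto
      finally show "norm (m r t) \<le> C * \<rho> powr (2 * \<alpha>)" .
    qed
  qed
next
  case (Suc k)
  obtain f' where f': "tder f f'" "zcls k f'" by (rule zcls_SucE[OF Suc.prems])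
  have cf': "cls k f'" by (rule zcls_imp_cls[OF f'(2)])
  show ?case
    by (rule zcls_SucI[OF base_Av[OF zcls_base[OF Suc.prems]] tder_Av[OF f'(1) zcls_base[OF Suc.prems] cls_hol[OF cf'] cls_base[OF cf']] Suc.IH[OF f'(2)]])
qed

text \<open>The integral over \<open>{0..1}\<close> is \<open>Av 0\<close> at \<rho> = 1, so
  differentiation under the integral is an instance of \<open>tder_Av\<close>.\<close>

lemma tder_integral:
  assumes "tder f f'" "base f" "cls k f'" "t \<in> {a..b}"
  shows "((\<lambda>t. integral {0..1} (\<lambda>\<rho>. f \<rho> t)) has_vector_derivative integral {0..1} (\<lambda>\<rho>. f' \<rho> t)) (at t within {a..b})"
proof -
  have eq: "Av 0 g 1 = (\<lambda>t. integral {0..1} (\<lambda>\<rho>. g \<rho> t))" for g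
    by (rule ext) (simp add: Av_def radial_mean_def)
  have "(Av 0 f 1 has_vector_derivative Av 0 f' 1 t) (at t within {a..b})"
    by (rule tderD[OF tder_Av[OF assms(1,2) cls_hol[OF assms(3)] cls_base[OF assms(3)]] _ assms(4)]) simp
  then show ?thesis unfolding eq .
qed

end

section \<open>Gaining half a derivative by integration\<close>

lemma has_integral_powr_to_1:
  fixes x p :: real
  assumes x: "0 < x" "x \<le> 1" and p: "p \<noteq> -1"
  shows "((\<lambda>r. r powr p) has_integral (1 - x powr (p + 1)) / (p + 1)) {x..1}"
proof -
  have "((\<lambda>r. r powr p) has_integral (1 powr (p + 1) / (p + 1) - x powr (p + 1) / (p + 1))) {x..1}"
  proof (rule fundamental_theorem_of_calculus[OF x(2)])
    fix r assume "r \<in> {x..1}"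
    then have "((\<lambda>r. r powr (p + 1) / (p + 1)) has_real_derivative r powr p) (at r within {x..1})"
      using x p by (auto intro!: derivative_eq_intros)
    then show "((\<lambda>r. r powr (p + 1) / (p + 1)) has_vector_derivative r powr p) (at r within {x..1})"
      by (simp add: has_real_derivative_iff_has_vector_derivative)
  qed
  then show ?thesis by (simp add: diff_divide_distrib)
qed

lemma mult_powr_minus_half:
  fixes x p :: real
  assumes "x > 0"
  shows "x * x powr (p - 1/2) = x powr (p + 1/2)"
proof -
  have "p + 1/2 = 1 + (p - 1/2)" by simp
  then show ?thesis using assms by (simp only: powr_add powr_one)
qed

text \<open>The constants of one function of class \<open>zcls 0\<close>, with \<open>m\<close> the
  t-derivative of \<open>\<rho>\<^sup>2 * f\<close>. The decay of \<open>m\<close> separates the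
  three cases: the bound for \<open>m / \<rho>\<^sup>2\<close> is a multiple of
  \<open>\<rho> powr (2 * \<alpha> - 2)\<close>, which is integrable at 0 exactly when \<alpha> >
  1/2.\<close>

locale taylor_data = parameter_interval +
  fixes f m :: "real \<Rightarrow> real \<Rightarrow> complex" and B C D E :: real
  assumes cf: "cls 0 f" and cm: "cls 0 m"
    and B: "\<And>\<rho> t. \<rho> \<in> {0<..1} \<Longrightarrow> t \<in> {a..b} \<Longrightarrow> norm (f \<rho> t) \<le> B"
    and C: "\<And>\<rho> s t. \<rho> \<in> {0<..1} \<Longrightarrow> s \<in> {a..b} \<Longrightarrow> t \<in> {a..b} \<Longrightarrow> norm (f \<rho> s - f \<rho> t) \<le> C * \<bar>s - t\<bar> powr \<alpha>"
    and D: "\<And>\<rho> s t. \<rho> \<in> {0<..1} \<Longrightarrow> s \<in> {a..b} \<Longrightarrow> t \<in> {a..b} \<Longrightarrow>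
      norm (complex_of_real (\<rho>\<^sup>2) * f \<rho> s - complex_of_real (\<rho>\<^sup>2) * f \<rho> t - (s - t) *\<^sub>R m \<rho> t) \<le> D * \<bar>s - t\<bar> powr (1 + \<alpha>)"
    and E: "\<And>\<rho> t. \<rho> \<in> {0<..1} \<Longrightarrow> t \<in> {a..b} \<Longrightarrow> norm (m \<rho> t) \<le> E * \<rho> powr (2 * \<alpha>)"
    and pos: "0 < B" "0 < C" "0 < D" "0 < E"
begin

definition F where "F t = integral {0..1} (\<lambda>\<rho>. f \<rho> t)"
text \<open>The candidate for the derivative of \<open>F\<close> at the resolution \<delta>: the
  range of \<rho> below \<open>sqrt \<delta>\<close> is not differentiated.\<close>

definition A where "A \<delta> t = integral {sqrt \<delta>..1} (\<lambda>\<rho>. m \<rho> t / complex_of_real (\<rho>\<^sup>2))"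

lemma F_integrable:
  assumes "t \<in> {a..b}"
  shows "(\<lambda>\<rho>. f \<rho> t) integrable_on {0..1}"
  by (rule integrable_on_bounded_half_open[OF baseD[OF cls_base[OF cf] assms] B[OF _ assms]]) auto

lemma F_bound: "t \<in> {a..b} \<Longrightarrow> norm (F t) \<le> B"
  unfolding F_def
  using integral_norm_bound_half_open[OF F_integrable, of t "\<lambda>\<rho>. B"] B by auto

lemma m_bound: "\<rho> \<in> {0<..1} \<Longrightarrow> t \<in> {a..b} \<Longrightarrow> norm (m \<rho> t / complex_of_real (\<rho>\<^sup>2)) \<le> E * \<rho> powr (2 * \<alpha> - 2)"
  using E[of \<rho> t] by (simp add: norm_divide norm_power powr_diff powr_numeral divide_right_mono)

lemma m_continuous: "t \<in> {a..b} \<Longrightarrow> continuous_on {0<..1} (\<lambda>\<rho>. m \<rho> t / complex_of_real (\<rho>\<^sup>2))"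
  by (intro continuous_intros baseD[OF cls_base[OF cm]]) auto

text \<open>Below \<open>sqrt \<delta>\<close> Hoelder continuity gives
  \<open>C * \<delta> powr \<alpha>\<close> on an interval of length \<open>sqrt \<delta>\<close>.
  Above it, the expansion of \<open>\<rho>\<^sup>2 * f\<close> divided by
  \<open>\<rho>\<^sup>2\<close> gives \<open>D * \<delta> powr (1 + \<alpha>)\<close> times the
  integral of \<open>\<rho> powr (-2)\<close>, which is at most \<open>\<delta> powr (-1/2)\<close>.
  The cut is placed where both orders agree.\<close>

lemma taylor_truncated:
  assumes st: "s \<in> {a..b}" "t \<in> {a..b}" and \<delta>: "0 < \<delta>" "\<delta> \<le> 1" "\<bar>s - t\<bar> \<le> \<delta>"
  shows "norm (F s - F t - (s - t) *\<^sub>R A \<delta> t) \<le> (C + D) * \<delta> powr (\<alpha> + 1/2)"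
proof -
  let ?x = "sqrt \<delta>"
  have x: "0 < ?x" "?x \<le> 1" using \<delta> by auto
  have xs: "{?x..1} \<subseteq> {0<..1}" using less_le_trans[OF x(1)] by auto
  have x_powr: "?x = \<delta> powr (1/2)" using \<delta> by (simp add: powr_half_sqrt)
  have sub: "(\<lambda>\<rho>. f \<rho> t) integrable_on {0..?x}" "(\<lambda>\<rho>. f \<rho> t) integrable_on {?x..1}" if "t \<in> {a..b}" for t
    by (rule integrable_on_subinterval[OF F_integrable[OF that]]; use x in simp)+
  have mi: "(\<lambda>\<rho>. m \<rho> t / complex_of_real (\<rho>\<^sup>2)) integrable_on {?x..1}"
    by (rule integrable_continuous_real, rule continuous_on_subset[OF m_continuous[OF st(2)] xs])
  have split: "F t = integral {0..?x} (\<lambda>\<rho>. f \<rho> t) + integral {?x..1} (\<lambda>\<rho>. f \<rho> t)" if "t \<in> {a..b}" for t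
    unfolding F_def by (rule Henstock_Kurzweil_Integration.integral_combine[symmetric, OF _ _ F_integrable[OF that]]) (use x in auto)
  have eq: "F s - F t - (s - t) *\<^sub>R A \<delta> t
     = integral {0..?x} (\<lambda>\<rho>. f \<rho> s - f \<rho> t)
     + integral {?x..1} (\<lambda>\<rho>. f \<rho> s - f \<rho> t - (s - t) *\<^sub>R (m \<rho> t / complex_of_real (\<rho>\<^sup>2)))"
    unfolding A_def split[OF st(1)] split[OF st(2)]
    by (simp add: integral_diff[OF sub(1)[OF st(1)] sub(1)[OF st(2)]]
        integral_diff[OF integrable_diff[OF sub(2)[OF st(1)] sub(2)[OF st(2)]] integrable_cmul[OF mi]]
        integral_diff[OF sub(2)[OF st(1)] sub(2)[OF st(2)]] del: of_real_power)
  have \<delta>\<alpha>: "\<bar>s - t\<bar> powr \<alpha> \<le> \<delta> powr \<alpha>" "\<bar>s - t\<bar> powr (1 + \<alpha>) \<le> \<delta> powr (1 + \<alpha>)"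
    using \<delta> \<alpha> by (auto intro!: powr_mono2)
  have "norm (integral {0..?x} (\<lambda>\<rho>. f \<rho> s - f \<rho> t)) \<le> integral {0..?x} (\<lambda>\<rho>. C * \<delta> powr \<alpha>)"
  proof (rule integral_norm_bound_half_open[OF integrable_diff[OF sub(1)[OF st(1)] sub(1)[OF st(2)]]])
    fix \<rho> assume "\<rho> \<in> {0<..?x}"
    then have \<rho>: "\<rho> \<in> {0<..1}" using order_trans[OF _ x(2)] by auto
    show "norm (f \<rho> s - f \<rho> t) \<le> C * \<delta> powr \<alpha>"
      by (rule order_trans[OF C[OF \<rho> st] mult_left_mono[OF \<delta>\<alpha>(1)]]) (use pos in simp)
  qed auto
  also have "\<dots> = C * \<delta> powr (\<alpha> + 1/2)" using x \<delta> by (simp add: powr_add x_powr)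
  finally have 1: "norm (integral {0..?x} (\<lambda>\<rho>. f \<rho> s - f \<rho> t)) \<le> C * \<delta> powr (\<alpha> + 1/2)" .
  have hi: "((\<lambda>\<rho>. D * \<delta> powr (1 + \<alpha>) * \<rho> powr (-2)) has_integral D * \<delta> powr (1 + \<alpha>) * ((1 - ?x powr (-2 + 1)) / (-2 + 1))) {?x..1}"
    by (rule has_integral_mult_right[OF has_integral_powr_to_1[OF x]]) simp
  have "norm (integral {?x..1} (\<lambda>\<rho>. f \<rho> s - f \<rho> t - (s - t) *\<^sub>R (m \<rho> t / complex_of_real (\<rho>\<^sup>2))))
     \<le> integral {?x..1} (\<lambda>\<rho>. D * \<delta> powr (1 + \<alpha>) * \<rho> powr (-2))"
  proof (rule integral_norm_bound_integral)
    show "(\<lambda>\<rho>. f \<rho> s - f \<rho> t - (s - t) *\<^sub>R (m \<rho> t / complex_of_real (\<rho>\<^sup>2))) integrable_on {?x..1}"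
      by (rule integrable_diff[OF integrable_diff[OF sub(2)[OF st(1)] sub(2)[OF st(2)]] integrable_cmul[OF mi]])
    show "(\<lambda>\<rho>. D * \<delta> powr (1 + \<alpha>) * \<rho> powr (-2)) integrable_on {?x..1}" using hi by blast
    fix \<rho> assume "\<rho> \<in> {?x..1}"
    then have \<rho>: "\<rho> \<in> {0<..1}" using xs by blast
    have "f \<rho> s - f \<rho> t - (s - t) *\<^sub>R (m \<rho> t / complex_of_real (\<rho>\<^sup>2))
      = (complex_of_real (\<rho>\<^sup>2) * f \<rho> s - complex_of_real (\<rho>\<^sup>2) * f \<rho> t - (s - t) *\<^sub>R m \<rho> t) / complex_of_real (\<rho>\<^sup>2)"
      using \<rho> by (simp add: field_simps scaleR_conv_of_real)
    then have "norm (f \<rho> s - f \<rho> t - (s - t) *\<^sub>R (m \<rho> t / complex_of_real (\<rho>\<^sup>2)))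
      = norm (complex_of_real (\<rho>\<^sup>2) * f \<rho> s - complex_of_real (\<rho>\<^sup>2) * f \<rho> t - (s - t) *\<^sub>R m \<rho> t) / \<rho>\<^sup>2"
      by (simp only: norm_divide norm_of_real) simp
    also have "\<dots> \<le> D * \<delta> powr (1 + \<alpha>) / \<rho>\<^sup>2"
      by (rule divide_right_mono[OF order_trans[OF D[OF \<rho> st] mult_left_mono[OF \<delta>\<alpha>(2)]]]) (use pos in simp_all)
    also have "\<dots> = D * \<delta> powr (1 + \<alpha>) * \<rho> powr (-2)"
      using \<rho> by (simp add: powr_minus powr_numeral field_simps)
    finally show "norm (f \<rho> s - f \<rho> t - (s - t) *\<^sub>R (m \<rho> t / complex_of_real (\<rho>\<^sup>2))) \<le> D * \<delta> powr (1 + \<alpha>) * \<rho> powr (-2)" .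
  qed
  also have "\<dots> = D * \<delta> powr (1 + \<alpha>) * (?x powr (-1) - 1)" using integral_unique[OF hi] by simp
  also have "\<dots> \<le> D * \<delta> powr (1 + \<alpha>) * ?x powr (-1)" using pos by (intro mult_left_mono) auto
  also have "\<dots> = D * \<delta> powr (\<alpha> + 1/2)"
    unfolding x_powr powr_powr mult.assoc powr_add[symmetric] by (simp add: add.commute)
  finally have 2: "norm (integral {?x..1} (\<lambda>\<rho>. f \<rho> s - f \<rho> t - (s - t) *\<^sub>R (m \<rho> t / complex_of_real (\<rho>\<^sup>2)))) \<le> D * \<delta> powr (\<alpha> + 1/2)" .
  show ?thesis unfolding eq distrib_right by (rule norm_triangle_mono[OF 1 2])
qed

text \<open>Here \<open>A \<delta> t\<close> grows at most like
  \<open>\<delta> powr (\<alpha> - 1/2)\<close>, so the linear term has the same order as the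
  remainder. The summand \<open>2 * B\<close> covers increments longer than 1.\<close>

lemma holder_case:
  assumes \<alpha>2: "\<alpha> < 1/2" and st: "s \<in> {a..b}" "t \<in> {a..b}"
  shows "norm (F s - F t) \<le> (2 * B + C + D + E / (1 - 2 * \<alpha>)) * \<bar>s - t\<bar> powr (\<alpha> + 1/2)"
proof -
  define \<delta> where "\<delta> = \<bar>s - t\<bar>"
  have Ek: "E / (1 - 2 * \<alpha>) > 0" using pos \<alpha>2 by simp
  consider "\<delta> = 0" | "0 < \<delta>" "\<delta> \<le> 1" | "1 < \<delta>" unfolding \<delta>_def by linarith
  then have "norm (F s - F t) \<le> (2 * B + C + D + E / (1 - 2 * \<alpha>)) * \<delta> powr (\<alpha> + 1/2)"
  proof cases
    case 1
    then show ?thesis by (simp add: \<delta>_def)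
  next
    case 2
    let ?x = "sqrt \<delta>"
    have x: "0 < ?x" "?x \<le> 1" using 2 by auto
    have xs: "{?x..1} \<subseteq> {0<..1}" using less_le_trans[OF x(1)] by auto
    have x_powr: "?x = \<delta> powr (1/2)" using 2 by (simp add: powr_half_sqrt)
    have hi: "((\<lambda>\<rho>. E * \<rho> powr (2 * \<alpha> - 2)) has_integral E * ((1 - ?x powr (2 * \<alpha> - 2 + 1)) / (2 * \<alpha> - 2 + 1))) {?x..1}"
      by (rule has_integral_mult_right[OF has_integral_powr_to_1[OF x]]) (use \<alpha>2 in simp)
    have "norm (A \<delta> t) \<le> integral {?x..1} (\<lambda>\<rho>. E * \<rho> powr (2 * \<alpha> - 2))"
      unfolding A_def
    proof (rule integral_norm_bound_integral)
      show "(\<lambda>\<rho>. m \<rho> t / complex_of_real (\<rho>\<^sup>2)) integrable_on {?x..1}"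
        by (rule integrable_continuous_real, rule continuous_on_subset[OF m_continuous[OF st(2)] xs])
      show "(\<lambda>\<rho>. E * \<rho> powr (2 * \<alpha> - 2)) integrable_on {?x..1}" using hi by blast
      fix \<rho> assume "\<rho> \<in> {?x..1}"
      then have \<rho>: "\<rho> \<in> {0<..1}" using xs by blast
      show "norm (m \<rho> t / complex_of_real (\<rho>\<^sup>2)) \<le> E * \<rho> powr (2 * \<alpha> - 2)" by (rule m_bound[OF \<rho> st(2)])
    qed
    also have "\<dots> = E * ((1 - ?x powr (2 * \<alpha> - 1)) / (2 * \<alpha> - 1))" using integral_unique[OF hi] by simp
    also have "\<dots> = E / (1 - 2 * \<alpha>) * (?x powr (2 * \<alpha> - 1) - 1)"
      using \<alpha>2 by (simp add: field_simps)
    also have "\<dots> \<le> E / (1 - 2 * \<alpha>) * (?x powr (2 * \<alpha> - 1))" using Ek by (intro mult_left_mono) auto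
    also have "?x powr (2 * \<alpha> - 1) = \<delta> powr (\<alpha> - 1/2)" unfolding x_powr powr_powr by (simp add: algebra_simps)
    finally have "\<delta> * norm (A \<delta> t) \<le> \<delta> * (E / (1 - 2 * \<alpha>) * \<delta> powr (\<alpha> - 1/2))"
      using 2 by (intro mult_left_mono) auto
    also have "\<dots> = E / (1 - 2 * \<alpha>) * \<delta> powr (\<alpha> + 1/2)"
      using mult_powr_minus_half[OF 2(1), of \<alpha>] by (metis mult.left_commute)
    finally have A: "norm ((s - t) *\<^sub>R A \<delta> t) \<le> E / (1 - 2 * \<alpha>) * \<delta> powr (\<alpha> + 1/2)" by (simp add: \<delta>_def)
    have "F s - F t = (F s - F t - (s - t) *\<^sub>R A \<delta> t) + (s - t) *\<^sub>R A \<delta> t" by simp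
    also have "norm \<dots> \<le> (C + D) * \<delta> powr (\<alpha> + 1/2) + E / (1 - 2 * \<alpha>) * \<delta> powr (\<alpha> + 1/2)"
      by (rule norm_triangle_mono[OF taylor_truncated[OF st 2] A]) (simp add: \<delta>_def)
    also have "\<dots> \<le> (2 * B + C + D + E / (1 - 2 * \<alpha>)) * \<delta> powr (\<alpha> + 1/2)"
      unfolding distrib_right[symmetric] using pos by (intro mult_right_mono) auto
    finally show ?thesis .
  next
    case 3
    have "norm (F s - F t) \<le> B + B"
      by (rule order_trans[OF norm_triangle_ineq4 add_mono[OF F_bound[OF st(1)] F_bound[OF st(2)]]])
    also have "\<dots> \<le> (2 * B + C + D + E / (1 - 2 * \<alpha>)) * 1" using pos Ek by simp
    also have "\<dots> \<le> (2 * B + C + D + E / (1 - 2 * \<alpha>)) * \<delta> powr (\<alpha> + 1/2)"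
      using 3 \<alpha> pos Ek by (intro mult_left_mono ge_one_powr_ge_zero) auto
    finally show ?thesis .
  qed
  then show ?thesis by (simp add: \<delta>_def)
qed

text \<open>At the critical exponent the bound for \<open>A \<delta> t\<close> is logarithmic in
  \<delta> and would spoil a first-order estimate. In the second difference the same
  \<open>A \<delta> t\<close> occurs with opposite signs and cancels. The summand
  \<open>4 * B\<close> covers \<delta> > 1.\<close>

lemma zygmund_case:
  assumes \<alpha>2: "\<alpha> = 1/2" and \<delta>: "\<delta> > 0" and t: "t \<in> {a..b}" "t + \<delta> \<in> {a..b}" "t - \<delta> \<in> {a..b}"
  shows "norm (F (t + \<delta>) + F (t - \<delta>) - 2 *\<^sub>R F t) \<le> (2 * (C + D) + 4 * B) * \<delta>"
proof (cases "\<delta> \<le> 1")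
  case True
  have "F (t + \<delta>) + F (t - \<delta>) - 2 *\<^sub>R F t = (F (t + \<delta>) - F t - ((t + \<delta>) - t) *\<^sub>R A \<delta> t) + (F (t - \<delta>) - F t - ((t - \<delta>) - t) *\<^sub>R A \<delta> t)"
    by (simp add: algebra_simps scaleR_2)
  also have "norm \<dots> \<le> (C + D) * \<delta> powr (\<alpha> + 1/2) + (C + D) * \<delta> powr (\<alpha> + 1/2)"
    using \<delta> True t by (intro norm_triangle_mono taylor_truncated) auto
  also have "\<alpha> + 1/2 = 1" using \<alpha>2 by simp
  also have "(C + D) * \<delta> powr 1 + (C + D) * \<delta> powr 1 = 2 * (C + D) * \<delta>" using \<delta> by simp
  also have "\<dots> \<le> (2 * (C + D) + 4 * B) * \<delta>" using pos \<delta> by (intro mult_right_mono) auto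
  finally show ?thesis .
next
  case False
  have "norm (F (t + \<delta>) + F (t - \<delta>) - 2 *\<^sub>R F t) \<le> norm (F (t + \<delta>)) + norm (F (t - \<delta>)) + norm (2 *\<^sub>R F t)"
    by (intro order_trans[OF norm_triangle_ineq4] add_right_mono norm_triangle_ineq)
  also have "\<dots> \<le> B + B + 2 * B"
    using F_bound[OF t(1)] F_bound[OF t(2)] F_bound[OF t(3)] by simp
  also have "\<dots> \<le> (2 * (C + D) + 4 * B) * 1" using pos by simp
  also have "\<dots> \<le> (2 * (C + D) + 4 * B) * \<delta>" using False pos by (intro mult_left_mono) auto
  finally show ?thesis .
qed

text \<open>Now \<open>m / \<rho>\<^sup>2\<close> is integrable down to 0, and replacing
  \<open>A \<delta> t\<close> by the full integral \<open>A0 t\<close> costs only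
  \<open>\<delta> powr (\<alpha> - 1/2)\<close>. The remainder of order \<alpha> + 1/2 > 1 yields
  the derivative and, expanded around both end points, the Hoelder bound for it.\<close>

lemma differentiable_case:
  assumes \<alpha>2: "\<alpha> > 1/2"
  obtains K A0 where "K \<ge> 0" "\<And>t. t \<in> {a..b} \<Longrightarrow> (F has_vector_derivative A0 t) (at t within {a..b})"
    "\<And>s t. s \<in> {a..b} \<Longrightarrow> t \<in> {a..b} \<Longrightarrow> norm (A0 s - A0 t) \<le> K * \<bar>s - t\<bar> powr (\<alpha> - 1/2)"
proof -
  define A0 where "A0 t = integral {0..1} (\<lambda>\<rho>. m \<rho> t / complex_of_real (\<rho>\<^sup>2))" for t
  define G where "G = E / (2 * \<alpha> - 1)"
  have G: "G > 0" using pos \<alpha>2 by (simp add: G_def)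
  have hi: "((\<lambda>\<rho>. E * \<rho> powr (2 * \<alpha> - 2)) has_integral E * (x powr (2 * \<alpha> - 2 + 1) / (2 * \<alpha> - 2 + 1))) {0..x}" if "x \<ge> 0" for x
    by (rule has_integral_mult_right[OF has_integral_powr_from_0]) (use that \<alpha>2 in auto)
  have hi': "integral {0..x} (\<lambda>\<rho>. E * \<rho> powr (2 * \<alpha> - 2)) = G * x powr (2 * \<alpha> - 1)" if "x \<ge> 0" for x
    using integral_unique[OF hi[OF that]] by (simp add: G_def algebra_simps)
  have gi: "(\<lambda>\<rho>. E * \<rho> powr (2 * \<alpha> - 2)) integrable_on {0..x}" if "x \<ge> 0" for x
    using hi[OF that] by blast
  have mi: "(\<lambda>\<rho>. m \<rho> t / complex_of_real (\<rho>\<^sup>2)) integrable_on {0..1}" if "t \<in> {a..b}" for t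
    by (rule integrable_on_bounded_half_open[OF m_continuous[OF that] m_bound[OF _ that] gi]) auto
  have A0b: "norm (A0 t) \<le> G" if "t \<in> {a..b}" for t
  proof -
    have "norm (A0 t) \<le> integral {0..1} (\<lambda>\<rho>. E * \<rho> powr (2 * \<alpha> - 2))"
      unfolding A0_def by (rule integral_norm_bound_half_open[OF mi[OF that] gi m_bound[OF _ that]]) auto
    also have "\<dots> = G" by (simp only: hi'[OF zero_le_one]) simp
    finally show ?thesis .
  qed
  have A0A: "norm (A \<delta> t - A0 t) \<le> G * \<delta> powr (\<alpha> - 1/2)" if t: "t \<in> {a..b}" and \<delta>: "0 < \<delta>" "\<delta> \<le> 1" for \<delta> t
  proof -
    let ?x = "sqrt \<delta>"
    have x: "0 < ?x" "?x \<le> 1" using \<delta> by auto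
  have xs: "{?x..1} \<subseteq> {0<..1}" using less_le_trans[OF x(1)] by auto
    have x_powr: "?x = \<delta> powr (1/2)" using \<delta> by (simp add: powr_half_sqrt)
    have "A0 t = integral {0..?x} (\<lambda>\<rho>. m \<rho> t / complex_of_real (\<rho>\<^sup>2)) + A \<delta> t"
      unfolding A0_def A_def by (rule Henstock_Kurzweil_Integration.integral_combine[symmetric, OF _ _ mi[OF t]]) (use x in auto)
    then have "norm (A \<delta> t - A0 t) = norm (integral {0..?x} (\<lambda>\<rho>. m \<rho> t / complex_of_real (\<rho>\<^sup>2)))"
      by (simp add: norm_minus_commute)
    also have "\<dots> \<le> integral {0..?x} (\<lambda>\<rho>. E * \<rho> powr (2 * \<alpha> - 2))"
    proof (rule integral_norm_bound_half_open)
      show "(\<lambda>\<rho>. m \<rho> t / complex_of_real (\<rho>\<^sup>2)) integrable_on {0..?x}"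
        by (rule integrable_on_subinterval[OF mi[OF t]]) (use x in auto)
      show "(\<lambda>\<rho>. E * \<rho> powr (2 * \<alpha> - 2)) integrable_on {0..?x}" by (rule gi) (use x in auto)
      fix \<rho> assume "\<rho> \<in> {0<..?x}"
      then have \<rho>: "\<rho> \<in> {0<..1}" using order_trans[OF _ x(2)] by auto
      show "norm (m \<rho> t / complex_of_real (\<rho>\<^sup>2)) \<le> E * \<rho> powr (2 * \<alpha> - 2)" by (rule m_bound[OF \<rho> t])
    qed
    also have "\<dots> = G * ?x powr (2 * \<alpha> - 1)" by (rule hi') (use x in auto)
    also have "?x powr (2 * \<alpha> - 1) = \<delta> powr (\<alpha> - 1/2)" unfolding x_powr powr_powr by (simp add: algebra_simps)
    finally show ?thesis .
  qed
  define K where "K = 2 * B + C + D + G"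
  have K: "K > 0" using pos G by (simp add: K_def)
  have main: "norm (F s - F t - (s - t) *\<^sub>R A0 t) \<le> K * \<bar>s - t\<bar> powr (1 + (\<alpha> - 1/2))" if st: "s \<in> {a..b}" "t \<in> {a..b}" for s t
  proof -
    define \<delta> where "\<delta> = \<bar>s - t\<bar>"
    consider "\<delta> = 0" | "0 < \<delta>" "\<delta> \<le> 1" | "1 < \<delta>" unfolding \<delta>_def by linarith
    then have "norm (F s - F t - (s - t) *\<^sub>R A0 t) \<le> K * \<delta> powr (\<alpha> + 1/2)"
    proof cases
      case 1
      then show ?thesis by (simp add: \<delta>_def)
    next
      case 2
      have "norm ((s - t) *\<^sub>R (A \<delta> t - A0 t)) \<le> \<delta> * (G * \<delta> powr (\<alpha> - 1/2))"
        using A0A[OF st(2) 2] 2 by (simp add: \<delta>_def mult_left_mono)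
      also have "\<dots> = G * \<delta> powr (\<alpha> + 1/2)"
        using mult_powr_minus_half[OF 2(1), of \<alpha>] by (metis mult.left_commute)
      finally have 3: "norm ((s - t) *\<^sub>R (A \<delta> t - A0 t)) \<le> G * \<delta> powr (\<alpha> + 1/2)" .
      have "F s - F t - (s - t) *\<^sub>R A0 t = (F s - F t - (s - t) *\<^sub>R A \<delta> t) + (s - t) *\<^sub>R (A \<delta> t - A0 t)"
        by (simp add: scaleR_right_diff_distrib)
      also have "norm \<dots> \<le> (C + D) * \<delta> powr (\<alpha> + 1/2) + G * \<delta> powr (\<alpha> + 1/2)"
        by (rule norm_triangle_mono[OF taylor_truncated[OF st 2] 3]) (simp add: \<delta>_def)
      also have "\<dots> \<le> K * \<delta> powr (\<alpha> + 1/2)"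
        unfolding distrib_right[symmetric] K_def using pos by (intro mult_right_mono) auto
      finally show ?thesis .
    next
      case 3
      have 1: "1 \<le> \<delta> powr (\<alpha> + 1/2)" "\<delta> \<le> \<delta> powr (\<alpha> + 1/2)"
        using 3 \<alpha> \<alpha>2 powr_mono[of 1 "\<alpha> + 1/2" \<delta>] by (auto intro!: ge_one_powr_ge_zero)
      have "norm (F s - F t - (s - t) *\<^sub>R A0 t) \<le> norm (F s) + norm (F t) + norm ((s - t) *\<^sub>R A0 t)"
        using norm_triangle_ineq4[of "F s - F t" "(s - t) *\<^sub>R A0 t"] norm_triangle_ineq4[of "F s" "F t"] by linarith
      also have "\<dots> \<le> B + B + \<delta> * G"
        using F_bound[OF st(1)] F_bound[OF st(2)] A0b[OF st(2)] by (intro add_mono) (auto simp: \<delta>_def mult_left_mono)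
      also have "\<dots> \<le> (2 * B) * \<delta> powr (\<alpha> + 1/2) + \<delta> powr (\<alpha> + 1/2) * G"
        using 1 pos G mult_left_mono[OF 1(1), of "2 * B"] by (intro add_mono mult_right_mono) auto
      also have "\<dots> \<le> K * \<delta> powr (\<alpha> + 1/2)"
        unfolding K_def using pos G 1 by (simp add: algebra_simps add_increasing)
      finally show ?thesis .
    qed
    then show ?thesis by (simp add: \<delta>_def add.commute)
  qed
  show thesis
  proof (rule that[of "2 * K" A0])
    show "2 * K \<ge> 0" using K by simp
    show "(F has_vector_derivative A0 t) (at t within {a..b})" if "t \<in> {a..b}" for t
      by (rule has_vector_derivative_of_taylor[OF main[OF _ that]]) (use \<alpha>2 in auto)
    fix s t assume st: "s \<in> {a..b}" "t \<in> {a..b}"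
    show "norm (A0 s - A0 t) \<le> 2 * K * \<bar>s - t\<bar> powr (\<alpha> - 1/2)"
    proof (cases "s = t")
      case False
      then have d: "\<bar>s - t\<bar> > 0" by simp
      \<comment> \<open>Adding the expansions around \<open>t\<close> and around \<open>s\<close>
        cancels the values of \<open>F\<close> and isolates the increment of
        \<open>A0\<close>.\<close>
      have "(s - t) *\<^sub>R (A0 s - A0 t) = (F s - F t - (s - t) *\<^sub>R A0 t) + (F t - F s - (t - s) *\<^sub>R A0 s)"
        by (simp add: algebra_simps)
      then have "\<bar>s - t\<bar> * norm (A0 s - A0 t) = norm ((F s - F t - (s - t) *\<^sub>R A0 t) + (F t - F s - (t - s) *\<^sub>R A0 s))"
        by (metis norm_scaleR)
      also have "\<dots> \<le> K * \<bar>s - t\<bar> powr (1 + (\<alpha> - 1/2)) + K * \<bar>t - s\<bar> powr (1 + (\<alpha> - 1/2))"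
        by (rule norm_triangle_mono[OF main[OF st] main[OF st(2,1)]])
      also have "\<dots> = \<bar>s - t\<bar> * (2 * K * \<bar>s - t\<bar> powr (\<alpha> - 1/2))"
        using d unfolding powr_add abs_minus_commute[of t s] by simp
      finally show ?thesis using d mult_le_cancel_left_pos by blast
    qed simp
  qed
qed

end

lemma (in parameter_interval) zcls_0_integral_regularity:
  assumes "zcls 0 f"
  shows
    "\<alpha> < 1/2 \<Longrightarrow> \<exists>K>0. \<forall>s\<in>{a..b}. \<forall>t\<in>{a..b}. norm (integral {0..1} (\<lambda>\<rho>. f \<rho> s) - integral {0..1} (\<lambda>\<rho>. f \<rho> t)) \<le> K * \<bar>s - t\<bar> powr (\<alpha> + 1/2)"
    "\<alpha> = 1/2 \<Longrightarrow> \<exists>K. \<forall>t \<delta>. \<delta> > 0 \<and> t - \<delta> \<in> {a..b} \<and> t + \<delta> \<in> {a..b} \<longrightarrow>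
        norm (integral {0..1} (\<lambda>\<rho>. f \<rho> (t + \<delta>)) + integral {0..1} (\<lambda>\<rho>. f \<rho> (t - \<delta>)) - 2 *\<^sub>R integral {0..1} (\<lambda>\<rho>. f \<rho> t)) \<le> K * \<delta>"
    "\<alpha> > 1/2 \<Longrightarrow> \<exists>K A0. K \<ge> 0 \<and> (\<forall>t\<in>{a..b}. ((\<lambda>t. integral {0..1} (\<lambda>\<rho>. f \<rho> t)) has_vector_derivative A0 t) (at t within {a..b})) \<and>
        (\<forall>s\<in>{a..b}. \<forall>t\<in>{a..b}. norm (A0 s - A0 t) \<le> K * \<bar>s - t\<bar> powr (\<alpha> - 1/2))"
proof -
  obtain m E where m: "tder (\<lambda>\<rho> t. complex_of_real (\<rho>\<^sup>2) * f \<rho> t) m" "cls 0 m"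
    "\<And>\<rho> t. \<rho> \<in> {0<..1} \<Longrightarrow> t \<in> {a..b} \<Longrightarrow> norm (m \<rho> t) \<le> E * \<rho> powr (2 * \<alpha>)" "E > 0"
    by (rule zcls_0D[OF assms]) (rule that)
  have cf: "cls 0 f" by (rule zcls_imp_cls[OF assms])
  obtain B where HB: "B > 0" "\<And>\<rho> t. \<rho> \<in> {0<..1} \<Longrightarrow> t \<in> {a..b} \<Longrightarrow> norm (f \<rho> t) \<le> B"
    using base_bound[OF cls_base[OF cf]] by metis
  obtain C where HC: "\<And>\<rho> s t. \<rho> \<in> {0<..1} \<Longrightarrow> s \<in> {a..b} \<Longrightarrow> t \<in> {a..b} \<Longrightarrow> norm (f \<rho> s - f \<rho> t) \<le> C * \<bar>s - t\<bar> powr \<alpha>" "C > 0"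
    using hol_bound[OF cls_hol[OF cf]] by metis
  obtain D where HD: "D > 0" "\<And>\<rho> s t. \<rho> \<in> {0<..1} \<Longrightarrow> s \<in> {a..b} \<Longrightarrow> t \<in> {a..b} \<Longrightarrow>
      norm (complex_of_real (\<rho>\<^sup>2) * f \<rho> s - complex_of_real (\<rho>\<^sup>2) * f \<rho> t - (s - t) *\<^sub>R m \<rho> t) \<le> D * \<bar>s - t\<bar> powr (1 + \<alpha>)"
    using tder_taylor[OF m(1) cls_hol[OF m(2)]] by metis
  interpret taylor_data a b \<alpha> f m B C D E
    by unfold_locales (fact cf m(2) HB HC HD m(3,4))+
  show "\<exists>K>0. \<forall>s\<in>{a..b}. \<forall>t\<in>{a..b}. norm (integral {0..1} (\<lambda>\<rho>. f \<rho> s) - integral {0..1} (\<lambda>\<rho>. f \<rho> t)) \<le> K * \<bar>s - t\<bar> powr (\<alpha> + 1/2)" if "\<alpha> < 1/2"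
  proof (intro exI[of _ "2 * B + C + D + E / (1 - 2 * \<alpha>)"] conjI ballI)
    show "2 * B + C + D + E / (1 - 2 * \<alpha>) > 0" using that HB(1) HC(2) HD(1) m(4) by (intro add_pos_pos) auto
    show "norm (integral {0..1} (\<lambda>\<rho>. f \<rho> s) - integral {0..1} (\<lambda>\<rho>. f \<rho> t)) \<le> (2 * B + C + D + E / (1 - 2 * \<alpha>)) * \<bar>s - t\<bar> powr (\<alpha> + 1/2)" if "s \<in> {a..b}" "t \<in> {a..b}" for s t
      using holder_case[OF \<open>\<alpha> < 1/2\<close> that] unfolding F_def .
  qed
  show "\<exists>K. \<forall>t \<delta>. \<delta> > 0 \<and> t - \<delta> \<in> {a..b} \<and> t + \<delta> \<in> {a..b} \<longrightarrow>
        norm (integral {0..1} (\<lambda>\<rho>. f \<rho> (t + \<delta>)) + integral {0..1} (\<lambda>\<rho>. f \<rho> (t - \<delta>)) - 2 *\<^sub>R integral {0..1} (\<lambda>\<rho>. f \<rho> t)) \<le> K * \<delta>" if "\<alpha> = 1/2"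
  proof (intro exI[of _ "2 * (C + D) + 4 * B"] allI impI)
    fix t \<delta> assume **: "\<delta> > 0 \<and> t - \<delta> \<in> {a..b} \<and> t + \<delta> \<in> {a..b}"
    then have t: "t \<in> {a..b}" by auto
    show "norm (integral {0..1} (\<lambda>\<rho>. f \<rho> (t + \<delta>)) + integral {0..1} (\<lambda>\<rho>. f \<rho> (t - \<delta>)) - 2 *\<^sub>R integral {0..1} (\<lambda>\<rho>. f \<rho> t)) \<le> (2 * (C + D) + 4 * B) * \<delta>"
      using zygmund_case[OF \<open>\<alpha> = 1/2\<close> _ t] ** unfolding F_def by blast
  qed
  show "\<exists>K A0. K \<ge> 0 \<and> (\<forall>t\<in>{a..b}. ((\<lambda>t. integral {0..1} (\<lambda>\<rho>. f \<rho> t)) has_vector_derivative A0 t) (at t within {a..b})) \<and>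
        (\<forall>s\<in>{a..b}. \<forall>t\<in>{a..b}. norm (A0 s - A0 t) \<le> K * \<bar>s - t\<bar> powr (\<alpha> - 1/2))" if "\<alpha> > 1/2"
  proof -
    have F: "F = (\<lambda>t. integral {0..1} (\<lambda>\<rho>. f \<rho> t))" by (rule ext) (rule F_def)
    obtain K A0 where K: "K \<ge> 0" "\<And>t. t \<in> {a..b} \<Longrightarrow> (F has_vector_derivative A0 t) (at t within {a..b})"
      "\<And>s t. s \<in> {a..b} \<Longrightarrow> t \<in> {a..b} \<Longrightarrow> norm (A0 s - A0 t) \<le> K * \<bar>s - t\<bar> powr (\<alpha> - 1/2)"
      by (rule differentiable_case[OF \<open>\<alpha> > 1/2\<close>]) (rule that)
    show ?thesis
      by (intro exI[of _ K] exI[of _ A0] conjI ballI K(1,3)) (use K(2) in \<open>simp_all add: F\<close>)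
  qed
qed

section \<open>Smoothness of the rescaled flow\<close>

lemma one_minus_power_le:
  fixes x :: real
  assumes "0 \<le> x" "x \<le> 1"
  shows "0 \<le> 1 - (1 - x) ^ j" "1 - (1 - x) ^ j \<le> real j * x"
  using assms Bernoulli_inequality[of "- x" j] by (auto intro: power_le_one)

context parameter_interval
begin

text \<open>Hoelder classes of order k + \<alpha> for the driving function and its derivatives. The
  interval starts at 0 and not at \<open>a\<close>, since the shifted time
  \<open>t * (1 - \<rho>\<^sup>2)\<close> runs down to 0.\<close>

primrec rcls :: "nat \<Rightarrow> (real \<Rightarrow> real) \<Rightarrow> bool" where
  "rcls 0 f \<longleftrightarrow> continuous_on {0..b} f \<and> (\<exists>C. \<forall>s\<in>{0..b}. \<forall>t\<in>{0..b}. \<bar>f s - f t\<bar> \<le> C * \<bar>s - t\<bar> powr \<alpha>)"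
| "rcls (Suc k) f \<longleftrightarrow> (\<exists>f'. (\<forall>t\<in>{0..b}. (f has_real_derivative f' t) (at t within {0..b})) \<and> rcls k f')"

declare rcls.simps [simp del]

lemma rcls_SucE:
  assumes "rcls (Suc k) f"
  obtains f' where "\<And>t. t \<in> {0..b} \<Longrightarrow> (f has_real_derivative f' t) (at t within {0..b})" "rcls k f'"
  using assms unfolding rcls.simps by blast

lemma rcls_SucI:
  "(\<And>t. t \<in> {0..b} \<Longrightarrow> (f has_real_derivative f' t) (at t within {0..b})) \<Longrightarrow> rcls k f' \<Longrightarrow> rcls (Suc k) f"
  unfolding rcls.simps by blast

lemma rcls_continuous:
  assumes "rcls k f"
  shows "continuous_on {0..b} f"
proof (cases k)
  case 0
  then show ?thesis using assms by (simp add: rcls.simps)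
next
  case (Suc j)
  obtain f' where f': "\<And>t. t \<in> {0..b} \<Longrightarrow> (f has_real_derivative f' t) (at t within {0..b})" "rcls j f'"
    by (rule rcls_SucE[OF assms[unfolded Suc]]) (rule that)
  show ?thesis by (rule DERIV_continuous_on[OF f'(1)])
qed

lemma rcls_bound:
  assumes "rcls k f"
  obtains M where "M > 0" "\<And>t. t \<in> {0..b} \<Longrightarrow> \<bar>f t\<bar> \<le> M"
proof -
  have "compact (f ` {0..b})" by (rule compact_continuous_image[OF rcls_continuous[OF assms]]) simp
  then have "bounded (f ` {0..b})" by (rule compact_imp_bounded)
  then obtain M where "\<forall>x\<in>f ` {0..b}. norm x \<le> M" unfolding bounded_iff by blast
  then have M: "\<bar>f t\<bar> \<le> M" if "t \<in> {0..b}" for t using that by simp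
  show thesis
  proof (rule that[of "max M 1"])
    show "\<bar>f t\<bar> \<le> max M 1" if "t \<in> {0..b}" for t using M[OF that] by simp
  qed simp
qed

lemma rcls_lipschitz:
  assumes d: "\<And>t. t \<in> {0..b} \<Longrightarrow> (f has_real_derivative f' t) (at t within {0..b})"
    and M: "\<And>t. t \<in> {0..b} \<Longrightarrow> \<bar>f' t\<bar> \<le> M" and st: "s \<in> {0..b}" "t \<in> {0..b}"
  shows "\<bar>f s - f t\<bar> \<le> M * \<bar>s - t\<bar>"
  using vector_derivative_bound[of 0 b f f' M s t] d M st
  by (simp add: has_real_derivative_iff_has_vector_derivative)

lemma rcls_Suc: "rcls (Suc k) f \<Longrightarrow> rcls k f"
proof (induction k arbitrary: f)
  case 0
  obtain f' where f': "\<And>t. t \<in> {0..b} \<Longrightarrow> (f has_real_derivative f' t) (at t within {0..b})" "rcls 0 f'"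
    by (rule rcls_SucE[OF 0]) (rule that)
  obtain M where M: "M > 0" "\<And>t. t \<in> {0..b} \<Longrightarrow> \<bar>f' t\<bar> \<le> M" by (rule rcls_bound[OF f'(2)]) (rule that)
  show ?case unfolding rcls.simps
  proof (intro conjI exI[of _ "M * b powr (1 - \<alpha>)"] ballI rcls_continuous[OF 0])
    fix s t assume st: "s \<in> {0..b}" "t \<in> {0..b}"
    have "\<bar>s - t\<bar> \<le> b powr (1 - \<alpha>) * \<bar>s - t\<bar> powr \<alpha>"
    proof (cases "s = t")
      case False
      have "\<bar>s - t\<bar> = \<bar>s - t\<bar> powr (1 - \<alpha>) * \<bar>s - t\<bar> powr \<alpha>" using False by (simp flip: powr_add)
      also have "\<dots> \<le> b powr (1 - \<alpha>) * \<bar>s - t\<bar> powr \<alpha>"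
        using st \<alpha> by (intro mult_right_mono powr_mono2) auto
      finally show ?thesis .
    qed simp
    then have "M * \<bar>s - t\<bar> \<le> M * (b powr (1 - \<alpha>) * \<bar>s - t\<bar> powr \<alpha>)" using M(1) by (intro mult_left_mono) auto
    with rcls_lipschitz[OF f'(1) M(2) st] show "\<bar>f s - f t\<bar> \<le> M * b powr (1 - \<alpha>) * \<bar>s - t\<bar> powr \<alpha>"
      by (simp add: mult.assoc)
  qed
next
  case (Suc k)
  obtain f' where f': "\<And>t. t \<in> {0..b} \<Longrightarrow> (f has_real_derivative f' t) (at t within {0..b})" "rcls (Suc k) f'"
    by (rule rcls_SucE[OF Suc.prems]) (rule that)
  show ?case by (rule rcls_SucI[OF f'(1) Suc.IH[OF f'(2)]])
qed

lemma rcls_holder: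
  assumes "rcls k f"
  obtains C where "C > 0" "\<And>s t. s \<in> {0..b} \<Longrightarrow> t \<in> {0..b} \<Longrightarrow> \<bar>f s - f t\<bar> \<le> C * \<bar>s - t\<bar> powr \<alpha>"
proof -
  have "rcls 0 f" using assms by (induction k) (auto dest: rcls_Suc)
  then obtain C where C: "\<And>s t. s \<in> {0..b} \<Longrightarrow> t \<in> {0..b} \<Longrightarrow> \<bar>f s - f t\<bar> \<le> C * \<bar>s - t\<bar> powr \<alpha>"
    unfolding rcls.simps by blast
  show thesis
  proof (rule that[of "max C 1"])
    fix s t assume *: "s \<in> {0..b}" "t \<in> {0..b}"
    have "C * \<bar>s - t\<bar> powr \<alpha> \<le> max C 1 * \<bar>s - t\<bar> powr \<alpha>" by (intro mult_right_mono) auto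
    with C[OF *] show "\<bar>f s - f t\<bar> \<le> max C 1 * \<bar>s - t\<bar> powr \<alpha>" by linarith
  qed simp
qed

context
  fixes \<theta> :: "real \<Rightarrow> real"
  assumes \<theta>: "continuous_on {0<..1} \<theta>" "\<And>\<rho>. \<rho> \<in> {0<..1} \<Longrightarrow> 0 \<le> \<theta> \<rho> \<and> \<theta> \<rho> \<le> 1"
begin

lemma scaled_range: "\<rho> \<in> {0<..1} \<Longrightarrow> t \<in> {a..b} \<Longrightarrow> t * \<theta> \<rho> \<in> {0..b}"
  using \<theta>(2)[of \<rho>] ab mult_mono[of t b "\<theta> \<rho>" 1] by auto

lemma scaled_base: "rcls k f \<Longrightarrow> base (\<lambda>\<rho> t. complex_of_real (\<theta> \<rho> ^ j * f (t * \<theta> \<rho>)))"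
proof -
  assume f: "rcls k f"
  obtain M where M: "M > 0" "\<And>t. t \<in> {0..b} \<Longrightarrow> \<bar>f t\<bar> \<le> M" by (rule rcls_bound[OF f]) (rule that)
  show ?thesis
  proof (rule baseI[of _ M])
    fix t assume t: "t \<in> {a..b}"
    show "continuous_on {0<..1} (\<lambda>\<rho>. complex_of_real (\<theta> \<rho> ^ j * f (t * \<theta> \<rho>)))"
      by (intro continuous_intros \<theta>(1) continuous_on_compose2[OF rcls_continuous[OF f]])
        (use scaled_range t in auto)
  next
    fix \<rho> t :: real assume *: "\<rho> \<in> {0<..1}" "t \<in> {a..b}"
    have "\<theta> \<rho> ^ j * \<bar>f (t * \<theta> \<rho>)\<bar> \<le> 1 * M"
      using \<theta>(2)[OF *(1)] M(2)[OF scaled_range[OF *]] by (intro mult_mono power_le_one) auto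
    then show "norm (complex_of_real (\<theta> \<rho> ^ j * f (t * \<theta> \<rho>))) \<le> M"
      using \<theta>(2)[OF *(1)] by (simp add: norm_mult norm_power)
  qed
qed

lemma scaled_tder:
  assumes f': "\<And>t. t \<in> {0..b} \<Longrightarrow> (f has_real_derivative f' t) (at t within {0..b})"
  shows "tder (\<lambda>\<rho> t. complex_of_real (\<theta> \<rho> ^ j * f (t * \<theta> \<rho>))) (\<lambda>\<rho> t. complex_of_real (\<theta> \<rho> ^ Suc j * f' (t * \<theta> \<rho>)))"
proof (rule tderI)
  fix \<rho> t :: real assume *: "\<rho> \<in> {0<..1}" "t \<in> {a..b}"
  have "((\<lambda>t. f (t * \<theta> \<rho>)) has_real_derivative f' (t * \<theta> \<rho>) * \<theta> \<rho>) (at t within {a..b})"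
    by (rule DERIV_image_chain[where g = "\<lambda>t. t * \<theta> \<rho>" and f = f, unfolded o_def])
      (auto intro!: derivative_eq_intros has_field_derivative_subset[OF f'[OF scaled_range[OF *]]] scaled_range[OF *(1)])
  then have "((\<lambda>t. \<theta> \<rho> ^ j * f (t * \<theta> \<rho>)) has_real_derivative \<theta> \<rho> ^ Suc j * f' (t * \<theta> \<rho>)) (at t within {a..b})"
    by (auto intro!: derivative_eq_intros)
  then show "((\<lambda>t. complex_of_real (\<theta> \<rho> ^ j * f (t * \<theta> \<rho>))) has_vector_derivative complex_of_real (\<theta> \<rho> ^ Suc j * f' (t * \<theta> \<rho>))) (at t within {a..b})"
    by (rule has_vector_derivative_of_real)
qed

text \<open>Each derivative in t brings out a factor \<open>\<theta> \<rho>\<close>; carrying the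
  power \<open>j\<close> along lets the induction close.\<close>

lemma scaled_cls: "rcls k f \<Longrightarrow> cls k (\<lambda>\<rho> t. complex_of_real (\<theta> \<rho> ^ j * f (t * \<theta> \<rho>)))"
proof (induction k arbitrary: f j)
  case 0
  obtain C where C: "C > 0" "\<And>s t. s \<in> {0..b} \<Longrightarrow> t \<in> {0..b} \<Longrightarrow> \<bar>f s - f t\<bar> \<le> C * \<bar>s - t\<bar> powr \<alpha>"
    by (rule rcls_holder[OF 0]) (rule that)
  show ?case
  proof (rule cls_0I[OF scaled_base[OF 0] holI])
    fix \<rho> s t :: real assume *: "\<rho> \<in> {0<..1}" "s \<in> {a..b}" "t \<in> {a..b}"
    have \<theta>1: "0 \<le> \<theta> \<rho>" "\<theta> \<rho> \<le> 1" using \<theta>(2)[OF *(1)] by auto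
    have "\<bar>s * \<theta> \<rho> - t * \<theta> \<rho>\<bar> = \<bar>s - t\<bar> * \<theta> \<rho>" using \<theta>1 by (simp add: abs_mult flip: left_diff_distrib)
    also have "\<dots> \<le> \<bar>s - t\<bar>" using \<theta>1 by (simp add: mult_left_le)
    finally have 1: "\<bar>s * \<theta> \<rho> - t * \<theta> \<rho>\<bar> powr \<alpha> \<le> \<bar>s - t\<bar> powr \<alpha>" using \<alpha> by (intro powr_mono2) auto
    have "\<theta> \<rho> ^ j * \<bar>f (s * \<theta> \<rho>) - f (t * \<theta> \<rho>)\<bar> \<le> 1 * (C * \<bar>s - t\<bar> powr \<alpha>)"
    proof (rule mult_mono)
      show "\<bar>f (s * \<theta> \<rho>) - f (t * \<theta> \<rho>)\<bar> \<le> C * \<bar>s - t\<bar> powr \<alpha>"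
        by (rule order_trans[OF C(2)[OF scaled_range[OF *(1,2)] scaled_range[OF *(1,3)]] mult_left_mono[OF 1]]) (use C in auto)
    qed (use \<theta>1 in \<open>auto intro: power_le_one\<close>)
    then show "norm (complex_of_real (\<theta> \<rho> ^ j * f (s * \<theta> \<rho>)) - complex_of_real (\<theta> \<rho> ^ j * f (t * \<theta> \<rho>))) \<le> C * \<bar>s - t\<bar> powr \<alpha>"
      using \<theta>1 unfolding of_real_diff[symmetric] norm_of_real right_diff_distrib[symmetric] abs_mult by simp
  qed
next
  case (Suc k)
  obtain f' where f': "\<And>t. t \<in> {0..b} \<Longrightarrow> (f has_real_derivative f' t) (at t within {0..b})" "rcls k f'"
    by (rule rcls_SucE[OF Suc.prems]) (rule that)
  show ?case by (rule cls_SucI[OF scaled_base[OF Suc.prems] scaled_tder[OF f'(1)] Suc.IH[OF f'(2)]])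
qed

end

text \<open>A difference quotient in \<open>\<rho>\<^sup>2\<close> between the times
  \<open>t\<close> and \<open>t * (1 - \<rho>\<^sup>2)\<close>. The power \<open>j\<close> records
  the inner derivatives already taken: the t-derivative of \<open>Xi j f\<close> is
  \<open>Xi (Suc j) f'\<close>.\<close>

definition Xi :: "nat \<Rightarrow> (real \<Rightarrow> real) \<Rightarrow> real \<Rightarrow> real \<Rightarrow> complex" where
  "Xi j f \<rho> t = complex_of_real ((f t - (1 - \<rho>\<^sup>2) ^ j * f (t * (1 - \<rho>\<^sup>2))) / \<rho>\<^sup>2)"

lemma one_minus_square_continuous: "continuous_on {0<..1} (\<lambda>\<rho>::real. 1 - \<rho>\<^sup>2)"
  by (intro continuous_intros)

lemma one_minus_square_range: "\<rho> \<in> {0<..1} \<Longrightarrow> 0 \<le> 1 - \<rho>\<^sup>2 \<and> 1 - \<rho>\<^sup>2 \<le> (1::real)"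
  by (auto simp: power_le_one)

lemmas one_minus_square = one_minus_square_continuous one_minus_square_range

lemma Xi_rho_mult:
  "\<rho> \<in> {0<..1} \<Longrightarrow> complex_of_real (\<rho>\<^sup>2) * Xi j f \<rho> t = complex_of_real (1 ^ 0 * f (t * 1)) + (-1) * complex_of_real ((1 - \<rho>\<^sup>2) ^ j * f (t * (1 - \<rho>\<^sup>2)))"
  by (simp add: Xi_def)

text \<open>By Bernoulli the weight differs from 1 by at most \<open>j * \<rho>\<^sup>2\<close>, an
  error that the division by \<open>\<rho>\<^sup>2\<close> absorbs.\<close>

lemma Xi_bound_aux:
  assumes M: "\<And>t. t \<in> {0..b} \<Longrightarrow> \<bar>f t\<bar> \<le> M" and *: "\<rho> \<in> {0<..1}" "t \<in> {a..b}"
  shows "\<bar>f t - (1 - \<rho>\<^sup>2) ^ j * f (t * (1 - \<rho>\<^sup>2))\<bar> \<le> \<bar>f t - f (t * (1 - \<rho>\<^sup>2))\<bar> + real j * M * \<rho>\<^sup>2"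
proof -
  let ?s = "t * (1 - \<rho>\<^sup>2)"
  have r: "0 \<le> \<rho>\<^sup>2" "\<rho>\<^sup>2 \<le> 1" using * by (auto simp: power_le_one)
  have s: "?s \<in> {0..b}" by (rule scaled_range[OF one_minus_square *])
  have "\<bar>f t - (1 - \<rho>\<^sup>2) ^ j * f ?s\<bar> = \<bar>(f t - f ?s) + (1 - (1 - \<rho>\<^sup>2) ^ j) * f ?s\<bar>"
    by (simp add: algebra_simps)
  also have "\<dots> \<le> \<bar>f t - f ?s\<bar> + \<bar>(1 - (1 - \<rho>\<^sup>2) ^ j) * f ?s\<bar>" by (rule abs_triangle_ineq)
  also have "\<bar>(1 - (1 - \<rho>\<^sup>2) ^ j) * f ?s\<bar> \<le> (real j * \<rho>\<^sup>2) * M"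
    unfolding abs_mult using one_minus_power_le[OF r, of j] M[OF s] by (intro mult_mono) auto
  finally show ?thesis by (simp add: mult_ac)
qed

lemma Xi_base:
  assumes f: "rcls (Suc k) f"
  shows "base (Xi j f)"
proof -
  obtain f' where f': "\<And>t. t \<in> {0..b} \<Longrightarrow> (f has_real_derivative f' t) (at t within {0..b})" "rcls k f'"
    by (rule rcls_SucE[OF f]) (rule that)
  obtain M where M: "M > 0" "\<And>t. t \<in> {0..b} \<Longrightarrow> \<bar>f t\<bar> \<le> M" by (rule rcls_bound[OF f]) (rule that)
  obtain M' where M': "M' > 0" "\<And>t. t \<in> {0..b} \<Longrightarrow> \<bar>f' t\<bar> \<le> M'" by (rule rcls_bound[OF f'(2)]) (rule that)
  show ?thesis
  proof (rule baseI[of _ "M' * b + real j * M"])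
    fix t assume t: "t \<in> {a..b}"
    have "continuous_on {0<..1} (\<lambda>\<rho>. f (t * (1 - \<rho>\<^sup>2)))"
      by (intro continuous_intros continuous_on_compose2[OF rcls_continuous[OF f]])
        (use scaled_range[OF one_minus_square _ t] in auto)
    then show "continuous_on {0<..1} (\<lambda>\<rho>. Xi j f \<rho> t)"
      unfolding Xi_def by (intro continuous_intros) auto
  next
    fix \<rho> t :: real assume *: "\<rho> \<in> {0<..1}" "t \<in> {a..b}"
    let ?s = "t * (1 - \<rho>\<^sup>2)"
    have s: "?s \<in> {0..b}" by (rule scaled_range[OF one_minus_square *])
    have "\<bar>f t - f ?s\<bar> \<le> M' * \<bar>t - ?s\<bar>" by (rule rcls_lipschitz[OF f'(1) M'(2) _ s]) (use * ab in auto)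
    also have "\<bar>t - ?s\<bar> = t * \<rho>\<^sup>2" using * ab by (simp add: algebra_simps)
    also have "M' * (t * \<rho>\<^sup>2) \<le> M' * (b * \<rho>\<^sup>2)" using M'(1) * by (intro mult_left_mono mult_right_mono) auto
    finally have "\<bar>f t - (1 - \<rho>\<^sup>2) ^ j * f ?s\<bar> \<le> (M' * b + real j * M) * \<rho>\<^sup>2"
      using Xi_bound_aux[where f = f and M = M and j = j, OF M(2) *] by (simp add: algebra_simps)
    then show "norm (Xi j f \<rho> t) \<le> M' * b + real j * M"
      using * unfolding Xi_def norm_of_real abs_divide by (simp add: divide_le_eq)
  qed
qed

lemma Xi_tder:
  assumes f': "\<And>t. t \<in> {0..b} \<Longrightarrow> (f has_real_derivative f' t) (at t within {0..b})"
  shows "tder (Xi j f) (Xi (Suc j) f')"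
proof (rule tderI)
  fix \<rho> t :: real assume *: "\<rho> \<in> {0<..1}" "t \<in> {a..b}"
  let ?g = "\<lambda>\<rho> t. complex_of_real ((1 - \<rho>\<^sup>2) ^ j * f (t * (1 - \<rho>\<^sup>2)))"
  let ?g' = "\<lambda>\<rho> t. complex_of_real ((1 - \<rho>\<^sup>2) ^ Suc j * f' (t * (1 - \<rho>\<^sup>2)))"
  have 1: "(?g \<rho> has_vector_derivative ?g' \<rho> t) (at t within {a..b})"
    by (rule tderD[OF scaled_tder[OF one_minus_square f'] *])
  have "(f has_real_derivative f' t) (at t within {a..b})"
    by (rule has_field_derivative_subset[OF f']) (use * ab in auto)
  then have 2: "((\<lambda>t. complex_of_real (f t)) has_vector_derivative complex_of_real (f' t)) (at t within {a..b})"
    by (rule has_vector_derivative_of_real)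
  have "((\<lambda>t. complex_of_real (1 / \<rho>\<^sup>2) * (complex_of_real (f t) - ?g \<rho> t)) has_vector_derivative
     complex_of_real (1 / \<rho>\<^sup>2) * (complex_of_real (f' t) - ?g' \<rho> t)) (at t within {a..b})"
    by (intro has_vector_derivative_mult_right has_vector_derivative_diff 1 2)
  then show "(Xi j f \<rho> has_vector_derivative Xi (Suc j) f' \<rho> t) (at t within {a..b})"
    unfolding Xi_def by simp
qed

lemma cls_Xi_rho:
  assumes "rcls k f"
  shows "cls k (\<lambda>\<rho> t. complex_of_real (\<rho>\<^sup>2) * Xi j f \<rho> t)"
proof (rule cls_cong[OF Xi_rho_mult[symmetric]])
  show "cls k (\<lambda>\<rho> t. complex_of_real (1 ^ 0 * f (t * 1)) + (-1) * complex_of_real ((1 - \<rho>\<^sup>2) ^ j * f (t * (1 - \<rho>\<^sup>2))))"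
    by (intro cls_add cls_cmult scaled_cls[OF one_minus_square assms] scaled_cls[of "\<lambda>\<rho>. 1", OF _ _ assms]) auto
qed

text \<open>The source of the gain. The quotient costs one derivative, but
  \<open>\<rho>\<^sup>2\<close> times it is a difference of values of \<open>f\<close> and costs
  none. The derivative of this product compares \<open>f'\<close> at two times at distance
  \<open>t * \<rho>\<^sup>2\<close>, so Hoelder continuity makes it of size
  \<open>\<rho> powr (2 * \<alpha>)\<close>.\<close>

lemma zcls_Xi: "rcls (Suc k) f \<Longrightarrow> zcls k (Xi j f)"
proof (induction k arbitrary: f j)
  case 0
  obtain f' where f': "\<And>t. t \<in> {0..b} \<Longrightarrow> (f has_real_derivative f' t) (at t within {0..b})" "rcls 0 f'"
    by (rule rcls_SucE[OF 0]) (rule that)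
  obtain M where M: "M > 0" "\<And>t. t \<in> {0..b} \<Longrightarrow> \<bar>f t\<bar> \<le> M" by (rule rcls_bound[OF 0]) (rule that)
  obtain M' where M': "M' > 0" "\<And>t. t \<in> {0..b} \<Longrightarrow> \<bar>f' t\<bar> \<le> M'" by (rule rcls_bound[OF f'(2)]) (rule that)
  obtain C where C: "C > 0" "\<And>s t. s \<in> {0..b} \<Longrightarrow> t \<in> {0..b} \<Longrightarrow> \<bar>f s - f t\<bar> \<le> C * \<bar>s - t\<bar> powr \<alpha>"
    by (rule rcls_holder[OF 0]) (rule that)
  obtain C' where C': "C' > 0" "\<And>s t. s \<in> {0..b} \<Longrightarrow> t \<in> {0..b} \<Longrightarrow> \<bar>f' s - f' t\<bar> \<le> C' * \<bar>s - t\<bar> powr \<alpha>"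
    by (rule rcls_holder[OF f'(2)]) (rule that)
  define K where "K = b * C' + M' * (b - a) powr (1 - \<alpha>)"
  have hol_Xi: "hol (Xi j f)"
  proof (rule holI)
    fix \<rho> s t :: real assume *: "\<rho> \<in> {0<..1}" "s \<in> {a..b}" "t \<in> {a..b}"
    define x where "x = \<rho>\<^sup>2"
    have x: "0 < x" "x \<le> 1" using * by (auto simp: x_def power_le_one)
    have \<theta>: "r \<in> {0..x} \<Longrightarrow> u \<in> {a..b} \<Longrightarrow> u * (1 - r) \<in> {0..b}" for u r
      using x ab mult_mono[of u b "1 - r" 1] by auto
    have scale: "\<bar>s * (1 - r) - t * (1 - r)\<bar> powr \<alpha> \<le> \<bar>s - t\<bar> powr \<alpha>" if "r \<in> {0..x}" for r
    proof -
      have "\<bar>s * (1 - r) - t * (1 - r)\<bar> = \<bar>s - t\<bar> * (1 - r)" using that x by (simp add: abs_mult flip: left_diff_distrib)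
      also have "\<dots> \<le> \<bar>s - t\<bar>" using that x by (simp add: mult_left_le)
      finally show ?thesis using \<alpha> by (intro powr_mono2) auto
    qed
    \<comment> \<open>The increment in time is put inside: its derivative in \<open>r\<close> is at
      most \<open>K * |s - t| powr \<alpha>\<close>, so its variation over \<open>{0..x}\<close>
      carries a factor \<open>x\<close> that survives the division by
      \<open>x = \<rho>\<^sup>2\<close>.\<close>
    let ?\<phi> = "\<lambda>r. f (s * (1 - r)) - f (t * (1 - r))"
    have "norm (?\<phi> 0 - ?\<phi> x) \<le> K * \<bar>s - t\<bar> powr \<alpha> * \<bar>0 - x\<bar>"
    proof (rule vector_derivative_bound[where a = 0 and b = x and f' = "\<lambda>r. f' (s * (1 - r)) * - s - f' (t * (1 - r)) * - t"])
      fix r assume r: "r \<in> {0..x}"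
      have "((\<lambda>r. f (u * (1 - r))) has_real_derivative f' (u * (1 - r)) * - u) (at r within {0..x})" if u: "u \<in> {a..b}" for u
        by (rule DERIV_image_chain[where g = "\<lambda>r. u * (1 - r)" and f = f, unfolded o_def])
          (auto intro!: derivative_eq_intros has_field_derivative_subset[OF f'(1)[OF \<theta>[OF r u]]] \<theta>[OF _ u])
      from DERIV_diff[OF this[OF *(2)] this[OF *(3)]]
      show "(?\<phi> has_vector_derivative f' (s * (1 - r)) * - s - f' (t * (1 - r)) * - t) (at r within {0..x})"
        by (simp add: has_real_derivative_iff_has_vector_derivative)
      have "f' (s * (1 - r)) * - s - f' (t * (1 - r)) * - t = - (s * (f' (s * (1 - r)) - f' (t * (1 - r))) + (s - t) * f' (t * (1 - r)))"
        by (simp add: algebra_simps)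
      then have "norm (f' (s * (1 - r)) * - s - f' (t * (1 - r)) * - t) = norm (s * (f' (s * (1 - r)) - f' (t * (1 - r))) + (s - t) * f' (t * (1 - r)))"
        by (metis norm_minus_cancel)
      also have "\<dots> \<le> b * (C' * \<bar>s - t\<bar> powr \<alpha>) + ((b - a) powr (1 - \<alpha>) * \<bar>s - t\<bar> powr \<alpha>) * M'"
      proof (rule norm_triangle_mono)
        show "norm (s * (f' (s * (1 - r)) - f' (t * (1 - r)))) \<le> b * (C' * \<bar>s - t\<bar> powr \<alpha>)"
          unfolding real_norm_def abs_mult using * ab
          by (intro mult_mono order_trans[OF C'(2)[OF \<theta>[OF r *(2)] \<theta>[OF r *(3)]] mult_left_mono[OF scale[OF r]]])
            (use C' in auto)
        show "norm ((s - t) * f' (t * (1 - r))) \<le> ((b - a) powr (1 - \<alpha>) * \<bar>s - t\<bar> powr \<alpha>) * M'"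
          unfolding real_norm_def abs_mult by (rule mult_mono[OF lipschitz_imp_powr[OF *(2,3)] M'(2)[OF \<theta>[OF r *(3)]]]) auto
      qed
      also have "\<dots> = K * \<bar>s - t\<bar> powr \<alpha>" by (simp add: K_def algebra_simps)
      finally show "norm (f' (s * (1 - r)) * - s - f' (t * (1 - r)) * - t) \<le> K * \<bar>s - t\<bar> powr \<alpha>" .
    qed (use x in auto)
    then have 1: "\<bar>?\<phi> 0 - ?\<phi> x\<bar> \<le> K * \<bar>s - t\<bar> powr \<alpha> * x" using x by simp
    have xx: "x \<in> {0..x}" using x by auto
    have 2: "\<bar>(1 - (1 - x) ^ j) * ?\<phi> x\<bar> \<le> (real j * x) * (C * \<bar>s - t\<bar> powr \<alpha>)"
      unfolding abs_mult
    proof (rule mult_mono)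
      show "\<bar>1 - (1 - x) ^ j\<bar> \<le> real j * x" using one_minus_power_le[of x j] x by simp
      show "\<bar>?\<phi> x\<bar> \<le> C * \<bar>s - t\<bar> powr \<alpha>"
        by (rule order_trans[OF C(2)[OF \<theta>[OF xx *(2)] \<theta>[OF xx *(3)]] mult_left_mono[OF scale[OF xx]]]) (use C in auto)
    qed (use x in auto)
    have "Xi j f \<rho> s - Xi j f \<rho> t = complex_of_real (((?\<phi> 0 - ?\<phi> x) + (1 - (1 - x) ^ j) * ?\<phi> x) / x)"
      unfolding Xi_def x_def[symmetric] of_real_diff[symmetric] diff_divide_distrib[symmetric]
      by (simp add: algebra_simps)
    then have "norm (Xi j f \<rho> s - Xi j f \<rho> t) = \<bar>(?\<phi> 0 - ?\<phi> x) + (1 - (1 - x) ^ j) * ?\<phi> x\<bar> / x"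
      unfolding norm_of_real using x by (simp only: norm_of_real abs_divide abs_of_pos)
    also have "\<dots> \<le> (K * \<bar>s - t\<bar> powr \<alpha> * x + (real j * x) * (C * \<bar>s - t\<bar> powr \<alpha>)) / x"
      using x by (intro divide_right_mono order_trans[OF abs_triangle_ineq add_mono[OF 1 2]]) auto
    also have "\<dots> = (K + real j * C) * \<bar>s - t\<bar> powr \<alpha>" using x by (simp add: field_simps)
    finally show "norm (Xi j f \<rho> s - Xi j f \<rho> t) \<le> (K + real j * C) * \<bar>s - t\<bar> powr \<alpha>" .
  qed
  show ?case
  proof (rule zcls_0I[OF cls_0I[OF Xi_base[OF 0] hol_Xi] tder_rho_mult[OF Xi_tder[OF f'(1)]] cls_Xi_rho[OF f'(2)]])
    fix \<rho> t :: real assume *: "\<rho> \<in> {0<..1}" "t \<in> {a..b}"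
    let ?s = "t * (1 - \<rho>\<^sup>2)"
    have s: "?s \<in> {0..b}" by (rule scaled_range[OF one_minus_square *])
    have "\<bar>t - ?s\<bar> = t * \<rho>\<^sup>2" using * ab by (simp add: algebra_simps)
    then have "\<bar>t - ?s\<bar> powr \<alpha> = t powr \<alpha> * \<rho> powr (2 * \<alpha>)"
      using * ab powr_powr[of \<rho> 2 \<alpha>] by (simp add: powr_mult powr_numeral)
    also have "\<dots> \<le> b powr \<alpha> * \<rho> powr (2 * \<alpha>)" using * ab \<alpha> by (intro mult_right_mono powr_mono2) auto
    finally have 1: "C' * \<bar>t - ?s\<bar> powr \<alpha> \<le> C' * (b powr \<alpha> * \<rho> powr (2 * \<alpha>))" using C'(1) by (intro mult_left_mono) auto
    have 2: "\<bar>f' t - f' ?s\<bar> \<le> C' * \<bar>t - ?s\<bar> powr \<alpha>" by (rule C'(2)[OF _ s]) (use * ab in auto)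
    have 3: "real (Suc j) * M' * \<rho>\<^sup>2 \<le> real (Suc j) * M' * \<rho> powr (2 * \<alpha>)"
      using rho_square_le[OF *(1)] M'(1) by (intro mult_left_mono) auto
    have "complex_of_real (\<rho>\<^sup>2) * Xi (Suc j) f' \<rho> t = complex_of_real (f' t - (1 - \<rho>\<^sup>2) ^ Suc j * f' ?s)"
      using * unfolding Xi_def by simp
    then have "norm (complex_of_real (\<rho>\<^sup>2) * Xi (Suc j) f' \<rho> t) = \<bar>f' t - (1 - \<rho>\<^sup>2) ^ Suc j * f' ?s\<bar>"
      by (simp only: norm_of_real)
    also have "\<dots> \<le> C' * (b powr \<alpha> * \<rho> powr (2 * \<alpha>)) + real (Suc j) * M' * \<rho> powr (2 * \<alpha>)"
      using Xi_bound_aux[where f = f' and M = M' and j = "Suc j", OF M'(2) *] 1 2 3 by linarith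
    finally show "norm (complex_of_real (\<rho>\<^sup>2) * Xi (Suc j) f' \<rho> t) \<le> (C' * b powr \<alpha> + real (Suc j) * M') * \<rho> powr (2 * \<alpha>)"
      by (simp only: distrib_right mult.assoc)
  qed
next
  case (Suc k)
  obtain f' where f': "\<And>t. t \<in> {0..b} \<Longrightarrow> (f has_real_derivative f' t) (at t within {0..b})" "rcls (Suc k) f'"
    by (rule rcls_SucE[OF Suc.prems]) (rule that)
  show ?case by (rule zcls_SucI[OF Xi_base[OF Suc.prems] Xi_tder[OF f'(1)] Suc.IH[OF f'(2)]])
qed

end

lemma indefinite_integral_deriv:
  fixes f :: "real \<Rightarrow> complex"
  assumes c: "continuous_on {0<..1} f" and i: "f integrable_on {0..1}" and \<rho>: "0 < \<rho>" "\<rho> < 1"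
  shows "((\<lambda>\<rho>. integral {0..\<rho>} f) has_vector_derivative f \<rho>) (at \<rho>)"
proof -
  have "continuous_on {0<..<1} f" by (rule continuous_on_subset[OF c]) auto
  then have "isCont f \<rho>" using \<rho> by (simp add: continuous_on_eq_continuous_at)
  then have "continuous (at \<rho> within {0..1} - {}) f" by (rule continuous_at_imp_continuous_at_within)
  then have "((\<lambda>\<rho>. integral {0..\<rho>} f) has_vector_derivative f \<rho>) (at \<rho> within {0..1} - {})"
    using \<rho> by (intro integral_has_vector_derivative_continuous_at[OF i]) auto
  then show ?thesis using \<rho> by (simp add: at_within_Icc_at)
qed

section \<open>The flow in scaled variables\<close>

locale scaled_flow = parameter_interval +
  fixes k :: nat and lam dlam :: "real \<Rightarrow> real" and w :: "real \<Rightarrow> real \<Rightarrow> complex" and c C :: real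
  assumes dlam: "\<And>t. t \<in> {0..b} \<Longrightarrow> (lam has_real_derivative dlam t) (at t within {0..b})"
    and rdlam: "rcls (Suc k) dlam"
    and w_cont: "\<And>t. t \<in> {a..b} \<Longrightarrow> continuous_on {0..t} (w t)"
    and w_0: "\<And>t. t \<in> {a..b} \<Longrightarrow> w t 0 = 0"
    and w_deriv: "\<And>t s. t \<in> {a..b} \<Longrightarrow> s \<in> {0<..<t} \<Longrightarrow>
      (w t has_vector_derivative (- 2 / w t s + complex_of_real (dlam (t - s)))) (at s)"
    and w_Im: "\<And>t s. t \<in> {a..b} \<Longrightarrow> s \<in> {0..t} \<Longrightarrow> c * sqrt s \<le> Im (w t s)"
    and w_norm: "\<And>t s. t \<in> {a..b} \<Longrightarrow> s \<in> {0..t} \<Longrightarrow> norm (w t s) \<le> C * sqrt s"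
    and w_sq: "\<And>t s. t \<in> {a..b} \<Longrightarrow> s \<in> {0..t} \<Longrightarrow> norm ((w t s)\<^sup>2 + complex_of_real (4 * s)) \<le> C * (s * sqrt s)"
    and cC: "0 < c" "0 < C"
begin

lemma rlam: "rcls (Suc (Suc k)) lam"
  by (rule rcls_SucI[OF dlam rdlam])

definition xi :: "real \<Rightarrow> real \<Rightarrow> complex" where
  "xi t \<rho> = w t (t * \<rho>\<^sup>2) / complex_of_real (sqrt t)"

text \<open>The square-root behaviour in both t and \<rho> is divided out: \<open>V\<close> stays
  between \<open>c\<close> and \<open>C\<close> in norm and tends to \<open>2 * \<i>\<close> as
  \<rho> tends to 0.\<close>

definition V :: "real \<Rightarrow> real \<Rightarrow> complex" where
  "V \<rho> t = xi t \<rho> / complex_of_real \<rho>"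

definition \<mu> :: "real \<Rightarrow> real \<Rightarrow> complex" where
  "\<mu> \<rho> t = complex_of_real (t powr (1/2)) * complex_of_real ((1 - \<rho>\<^sup>2) ^ 0 * dlam (t * (1 - \<rho>\<^sup>2)))"

text \<open>The driving term in integrated form: \<open>\<rho>\<^sup>2 * \<nu>\<close> is the
  primitive \<open>N\<close> of \<open>2 * \<rho> * \<mu>\<close> in \<rho>.\<close>

definition \<nu> :: "real \<Rightarrow> real \<Rightarrow> complex" where
  "\<nu> \<rho> t = complex_of_real (t powr (-1/2)) * Xi 0 lam \<rho> t"

definition d :: "real \<Rightarrow> real \<Rightarrow> complex" where
  "d \<rho> t = complex_of_real (t powr (-1/2)) * Xi 1 dlam \<rho> t
     + complex_of_real (-1/2) * complex_of_real (t powr (-3/2)) * Xi 0 lam \<rho> t"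

lemma tpos: "t \<in> {a..b} \<Longrightarrow> 0 < t"
  using ab by auto

lemma sq_range: "t \<in> {a..b} \<Longrightarrow> \<rho> \<in> {0..1} \<Longrightarrow> t * \<rho>\<^sup>2 \<in> {0..t}"
  using tpos[of t] by (auto simp: mult_le_cancel_left1 power_le_one)

lemma xi_V: "\<rho> \<in> {0<..1} \<Longrightarrow> xi t \<rho> = complex_of_real \<rho> * V \<rho> t"
  by (simp add: V_def)

lemma w_V: "\<rho> \<in> {0<..1} \<Longrightarrow> t \<in> {a..b} \<Longrightarrow> w t (t * \<rho>\<^sup>2) = complex_of_real (sqrt (t * \<rho>\<^sup>2)) * V \<rho> t"
  using tpos[of t] by (simp add: V_def xi_def real_sqrt_mult)

lemma V_bounds:
  assumes \<rho>: "\<rho> \<in> {0<..1}" and t: "t \<in> {a..b}"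
  shows "norm (V \<rho> t) \<le> C" "c \<le> Im (V \<rho> t)" "c \<le> norm (V \<rho> t)" "V \<rho> t \<noteq> 0"
    "norm ((V \<rho> t)\<^sup>2 + 4) \<le> C * sqrt b * \<rho>"
proof -
  define q where "q = sqrt (t * \<rho>\<^sup>2)"
  have q: "q > 0" using tpos[OF t] \<rho> by (simp add: q_def)
  have wq: "w t (t * \<rho>\<^sup>2) = complex_of_real q * V \<rho> t" using w_V[OF \<rho> t] by (simp add: q_def)
  have s: "t * \<rho>\<^sup>2 \<in> {0..t}" using sq_range[OF t] \<rho> by simp
  have "q * norm (V \<rho> t) \<le> q * C"
    using w_norm[OF t s] q unfolding wq by (simp add: norm_mult mult.commute flip: q_def)
  then show "norm (V \<rho> t) \<le> C" using q by simp
  have "q * c \<le> q * Im (V \<rho> t)"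
    using w_Im[OF t s] unfolding wq by (simp add: mult.commute flip: q_def)
  then show 1: "c \<le> Im (V \<rho> t)" using q by simp
  then show 2: "c \<le> norm (V \<rho> t)" using abs_Im_le_cmod[of "V \<rho> t"] by linarith
  then show "V \<rho> t \<noteq> 0" using cC by auto
  have q2: "t * \<rho>\<^sup>2 = q\<^sup>2" using tpos[OF t] by (simp add: q_def)
  have "norm (complex_of_real (q\<^sup>2) * ((V \<rho> t)\<^sup>2 + 4)) \<le> C * (q\<^sup>2 * q)"
    using w_sq[OF t s] unfolding wq q_def[symmetric] unfolding q2
    by (simp add: power_mult_distrib algebra_simps)
  then have "q\<^sup>2 * norm ((V \<rho> t)\<^sup>2 + 4) \<le> q\<^sup>2 * (C * q)"
    unfolding norm_mult norm_of_real by (simp add: mult_ac)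
  then have "norm ((V \<rho> t)\<^sup>2 + 4) \<le> C * q" using q by simp
  also have "q \<le> sqrt b * \<rho>" using t \<rho> by (simp add: q_def real_sqrt_mult)
  finally show "norm ((V \<rho> t)\<^sup>2 + 4) \<le> C * sqrt b * \<rho>" using cC by (simp add: mult.assoc)
qed

lemma xi_continuous: "t \<in> {a..b} \<Longrightarrow> continuous_on {0..1} (xi t)"
  unfolding xi_def using tpos[of t]
  by (intro continuous_intros continuous_on_compose2[OF w_cont]) (use sq_range in auto)

lemma xi_0: "t \<in> {a..b} \<Longrightarrow> xi t 0 = 0"
  by (simp add: xi_def w_0)

text \<open>Scaling removes t from the singular term; it remains only in the coefficient \<mu>, so
  flows for different t can be compared at equal \<rho>.\<close>

lemma xi_deriv:
  assumes t: "t \<in> {a..b}" and \<rho>: "0 < \<rho>" "\<rho> < 1"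
  shows "(xi t has_vector_derivative complex_of_real (2 * \<rho>) * (- 2 / xi t \<rho> + \<mu> \<rho> t)) (at \<rho>)"
proof -
  let ?s = "t * \<rho>\<^sup>2"
  have t0: "t > 0" using tpos[OF t] .
  have "\<rho>\<^sup>2 < 1" using \<rho> by (simp add: power_less_one_iff)
  then have s: "?s \<in> {0<..<t}" using t0 \<rho> by simp
  have 1: "((\<lambda>\<rho>. t * \<rho>\<^sup>2) has_vector_derivative (2 * t * \<rho>)) (at \<rho>)"
    by (auto intro!: derivative_eq_intros simp flip: has_real_derivative_iff_has_vector_derivative)
  have "((\<lambda>\<rho>. w t (t * \<rho>\<^sup>2)) has_vector_derivative (2 * t * \<rho>) *\<^sub>R (- 2 / w t ?s + complex_of_real (dlam (t - ?s)))) (at \<rho>)"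
    using vector_diff_chain_at[OF 1 w_deriv[OF t s]] by (simp add: o_def)
  then have 2: "(xi t has_vector_derivative (2 * t * \<rho>) *\<^sub>R (- 2 / w t ?s + complex_of_real (dlam (t - ?s))) / complex_of_real (sqrt t)) (at \<rho>)"
    unfolding xi_def by (rule has_vector_derivative_divide)
  have w: "w t ?s = complex_of_real (sqrt t) * xi t \<rho>" using t0 by (simp add: xi_def)
  have sq: "complex_of_real t = complex_of_real (sqrt t) * complex_of_real (sqrt t)"
    using t0 by (simp flip: of_real_mult)
  have tt: "t - ?s = t * (1 - \<rho>\<^sup>2)" by (simp add: algebra_simps)
  have "(2 * t * \<rho>) *\<^sub>R (- 2 / w t ?s + complex_of_real (dlam (t - ?s))) / complex_of_real (sqrt t)
     = complex_of_real (2 * \<rho>) * (- 2 / xi t \<rho> + \<mu> \<rho> t)"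
    unfolding w tt \<mu>_def using t0 by (simp add: scaleR_conv_of_real sq powr_half_sqrt field_simps)
  with 2 show ?thesis by simp
qed

lemma base_V: "base V"
proof (rule baseI[OF _ V_bounds(1)])
  fix t assume t: "t \<in> {a..b}"
  show "continuous_on {0<..1} (\<lambda>\<rho>. V \<rho> t)"
    unfolding V_def by (intro continuous_intros continuous_on_subset[OF xi_continuous[OF t]]) auto
qed

lemma cls_\<mu>: "cls (Suc k) \<mu>"
  unfolding \<mu>_def by (rule cls_mult[OF cls_powr scaled_cls[OF one_minus_square rdlam]])

lemma tder_\<nu>: "tder \<nu> d"
proof -
  have "tder (\<lambda>\<rho> t. complex_of_real (t powr (-1/2))) (\<lambda>\<rho> t. complex_of_real (-1/2) * complex_of_real (t powr (-3/2)))"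
  proof (rule tderI)
    fix \<rho> t :: real assume "t \<in> {a..b}"
    then have "((\<lambda>t. t powr (-1/2)) has_real_derivative (-1/2) * t powr (-3/2)) (at t within {a..b})"
      using tpos[of t] by (auto intro!: derivative_eq_intros)
    then have "((\<lambda>t. complex_of_real (t powr (-1/2))) has_vector_derivative complex_of_real ((-1/2) * t powr (-3/2))) (at t within {a..b})"
      by (rule has_vector_derivative_of_real)
    then show "((\<lambda>t. complex_of_real (t powr (-1/2))) has_vector_derivative complex_of_real (-1/2) * complex_of_real (t powr (-3/2))) (at t within {a..b})"
      by simp
  qed
  from tder_mult[OF this Xi_tder[OF dlam, of 0]] show ?thesis
    unfolding \<nu>_def[abs_def] d_def[abs_def] by simp
qed

lemma zcls_d: "zcls k d"
proof -
  have "zcls k (Xi 1 dlam)" "zcls k (Xi 0 lam)"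
    by (rule zcls_Xi[OF rdlam], rule zcls_Xi[OF rcls_Suc[OF rlam]])
  then show ?thesis unfolding d_def
    by (intro zcls_add zcls_mult cls_mult cls_complex_const cls_powr)
qed

lemma base_\<nu>: "base \<nu>"
  unfolding \<nu>_def by (rule base_mult[OF cls_base[OF cls_powr[of 0]] Xi_base[OF rlam]])

lemma N_eq: "\<rho> \<in> {0<..1} \<Longrightarrow> t \<in> {a..b} \<Longrightarrow> complex_of_real (\<rho>\<^sup>2) * \<nu> \<rho> t = complex_of_real ((lam t - lam (t * (1 - \<rho>\<^sup>2))) / sqrt t)"
  using tpos[of t] by (simp add: \<nu>_def Xi_def powr_minus powr_half_sqrt field_simps)

definition N :: "real \<Rightarrow> real \<Rightarrow> complex" where
  "N t \<rho> = complex_of_real ((lam t - lam (t * (1 - \<rho>\<^sup>2))) / sqrt t)"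

lemma N_continuous: "t \<in> {a..b} \<Longrightarrow> continuous_on {0..1} (N t)"
proof -
  assume t: "t \<in> {a..b}"
  have "t * (1 - \<rho>\<^sup>2) \<in> {0..b}" if "\<rho> \<in> {0..1}" for \<rho>
    using that t ab mult_mono[of t b "1 - \<rho>\<^sup>2" 1] by (auto simp: power_le_one)
  then show ?thesis unfolding N_def
    by (intro continuous_intros continuous_on_compose2[OF rcls_continuous[OF rlam]]) (use tpos[OF t] in auto)
qed

lemma N_deriv:
  assumes t: "t \<in> {a..b}" and \<rho>: "0 < \<rho>" "\<rho> < 1"
  shows "(N t has_vector_derivative complex_of_real (2 * \<rho>) * \<mu> \<rho> t) (at \<rho>)"
proof -
  have t0: "t > 0" using tpos[OF t] .
  let ?u = "t * (1 - \<rho>\<^sup>2)"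
  have r: "0 < \<rho>\<^sup>2" "\<rho>\<^sup>2 < 1" using \<rho> by (auto simp: power_less_one_iff)
  then have "0 < ?u" "?u < t * 1" using t0 by (simp_all only: mult_less_cancel_left_pos) auto
  then have u: "0 < ?u" "?u < b" using t by auto
  have "(lam has_real_derivative dlam ?u) (at ?u)"
    using dlam[of ?u] u by (simp add: at_within_Icc_at)
  then have "((\<lambda>\<rho>. lam (t * (1 - \<rho>\<^sup>2))) has_real_derivative dlam ?u * (t * (- (2 * \<rho>)))) (at \<rho>)"
    by (rule DERIV_chain2) (auto intro!: derivative_eq_intros)
  then have "((\<lambda>\<rho>. (lam t - lam (t * (1 - \<rho>\<^sup>2))) / sqrt t) has_real_derivative (0 - dlam ?u * (t * (- (2 * \<rho>)))) / sqrt t) (at \<rho>)"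
    by (intro DERIV_cdivide DERIV_diff DERIV_const)
  also have "(0 - dlam ?u * (t * (- (2 * \<rho>)))) / sqrt t = 2 * \<rho> * (t / sqrt t * dlam ?u)" by simp
  also have "t / sqrt t = sqrt t" using t0 by (simp add: real_div_sqrt)
  finally have "(N t has_vector_derivative complex_of_real (2 * \<rho> * (sqrt t * dlam ?u))) (at \<rho>)"
    unfolding N_def by (rule has_vector_derivative_of_real)
  then show ?thesis using t0 by (simp add: \<mu>_def powr_half_sqrt)
qed

text \<open>Integrates \<open>(\<xi>\<^sup>2 + 4 * \<rho>\<^sup>2)' = 4 * \<rho>\<^sup>2 * V *
  \<mu>\<close>, where the singular contributions have cancelled. It exhibits
  \<open>(V\<^sup>2 + 4) / \<rho>\<close> as a mean of regular functions, without a singularity at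
  0.\<close>

lemma V_sq_eq:
  assumes \<rho>: "\<rho> \<in> {0<..1}" and t: "t \<in> {a..b}"
  shows "(V \<rho> t)\<^sup>2 + 4 = 4 * complex_of_real \<rho> * Av 2 (\<lambda>\<rho> t. V \<rho> t * \<mu> \<rho> t) \<rho> t"
proof -
  define g where "g r = ((xi t r)\<^sup>2 + complex_of_real (4 * r\<^sup>2)) / 4" for r
  have "((\<lambda>r. complex_of_real (r ^ 2) * (V r t * \<mu> r t)) has_integral g \<rho> - g 0) {0..\<rho>}"
  proof (rule fundamental_theorem_of_calculus_interior)
    show "0 \<le> \<rho>" using \<rho> by simp
    show "continuous_on {0..\<rho>} g" unfolding g_def
      by (intro continuous_intros continuous_on_subset[OF xi_continuous[OF t]]) (use \<rho> in auto)
    fix r assume "r \<in> {0<..<\<rho>}"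
    then have r: "0 < r" "r < 1" "r \<in> {0<..1}" using \<rho> by auto
    let ?x' = "complex_of_real (2 * r) * (- 2 / xi t r + \<mu> r t)"
    have "((\<lambda>r. xi t r * xi t r) has_vector_derivative xi t r * ?x' + ?x' * xi t r) (at r)"
      by (rule has_vector_derivative_mult[OF xi_deriv[OF t r(1,2)] xi_deriv[OF t r(1,2)]])
    moreover have "((\<lambda>r. complex_of_real (4 * r\<^sup>2)) has_vector_derivative complex_of_real (8 * r)) (at r)"
      by (rule has_vector_derivative_of_real) (auto intro!: derivative_eq_intros)
    ultimately have "(g has_vector_derivative ((xi t r * ?x' + ?x' * xi t r) + complex_of_real (8 * r)) / 4) (at r)"
      unfolding g_def power2_eq_square[of "xi t _"] by (intro has_vector_derivative_divide has_vector_derivative_add)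
    moreover have "((xi t r * ?x' + ?x' * xi t r) + complex_of_real (8 * r)) / 4 = complex_of_real (r ^ 2) * (V r t * \<mu> r t)"
      unfolding xi_V[OF r(3)] using V_bounds(4)[OF r(3) t] r by (simp add: field_simps power2_eq_square)
    ultimately show "(g has_vector_derivative complex_of_real (r ^ 2) * (V r t * \<mu> r t)) (at r)" by simp
  qed
  then have "integral {0..\<rho>} (\<lambda>r. complex_of_real (r ^ 2) * (V r t * \<mu> r t)) = g \<rho>"
    using xi_0[OF t] by (simp add: g_def integral_unique)
  then have "Av 2 (\<lambda>\<rho> t. V \<rho> t * \<mu> \<rho> t) \<rho> t = g \<rho> / complex_of_real (\<rho> ^ 3)"
    unfolding Av_def radial_mean_def by (simp add: numeral_3_eq_3)
  also have "g \<rho> = complex_of_real (\<rho>\<^sup>2) * ((V \<rho> t)\<^sup>2 + 4) / 4"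
    by (simp add: g_def xi_V[OF \<rho>] power_mult_distrib algebra_simps)
  finally show ?thesis using \<rho> by (simp add: power2_eq_square power3_eq_cube)
qed

section \<open>The difference of two flows\<close>

text \<open>The linear equation for a difference of flows has the coefficient
  \<open>4 / (\<rho> * V \<rho> \<tau> * V \<rho> t)\<close>. Since the product of the two values of
  \<open>V\<close> tends to -4, it behaves like \<open>- 1 / \<rho>\<close>; adding
  \<open>1 / \<rho>\<close> gives this expression, which is bounded.\<close>

definition x12 :: "real \<Rightarrow> real \<Rightarrow> real \<Rightarrow> complex" where
  "x12 \<tau> t \<rho> = (4 + V \<rho> \<tau> * V \<rho> t) / (complex_of_real \<rho> * (V \<rho> \<tau> * V \<rho> t))"

text \<open>The numerator of \<open>x12\<close> is expressed through the two deviations of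
  \<open>V\<close> from \<open>2 * \<i>\<close>, each at most
  \<open>C * sqrt b * \<rho> / 2\<close>, which supplies the factor \<rho>; the denominator uses
  \<open>c\<close> twice.\<close>

definition K1 where "K1 = C * sqrt b * (C + 2) / (2 * c\<^sup>2)"

lemma K1_pos: "K1 > 0"
  using cC ab by (simp add: K1_def)

text \<open>Dividing \<open>V\<^sup>2 + 4\<close> by \<open>V + 2 * \<i>\<close> selects the right
  square root of -4: both summands have positive imaginary part, so the divisor has norm at least
  2.\<close>

lemma V_minus_2i:
  assumes \<rho>: "\<rho> \<in> {0<..1}" and t: "t \<in> {a..b}"
  shows "norm (V \<rho> t - 2 * \<i>) \<le> C * sqrt b * \<rho> / 2"
proof -
  have "2 \<le> Im (V \<rho> t + 2 * \<i>)" using V_bounds(2)[OF \<rho> t] cC by simp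
  then have 2: "2 \<le> norm (V \<rho> t + 2 * \<i>)" using abs_Im_le_cmod[of "V \<rho> t + 2 * \<i>"] by linarith
  have "(V \<rho> t)\<^sup>2 + 4 = (V \<rho> t - 2 * \<i>) * (V \<rho> t + 2 * \<i>)"
    by (simp add: algebra_simps power2_eq_square)
  then have "norm (V \<rho> t - 2 * \<i>) * norm (V \<rho> t + 2 * \<i>) \<le> C * sqrt b * \<rho>"
    using V_bounds(5)[OF \<rho> t] by (simp add: norm_mult)
  moreover have "norm (V \<rho> t - 2 * \<i>) * 2 \<le> norm (V \<rho> t - 2 * \<i>) * norm (V \<rho> t + 2 * \<i>)"
    using 2 by (intro mult_left_mono) auto
  ultimately show ?thesis by simp
qed

lemma x12_bound:
  assumes \<rho>: "\<rho> \<in> {0<..1}" and t: "\<tau> \<in> {a..b}" "t \<in> {a..b}"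
  shows "norm (x12 \<tau> t \<rho>) \<le> K1"
proof -
  have "4 + V \<rho> \<tau> * V \<rho> t = (V \<rho> \<tau> - 2 * \<i>) * V \<rho> t + 2 * \<i> * (V \<rho> t - 2 * \<i>)"
    by (simp add: algebra_simps)
  also have "norm \<dots> \<le> (C * sqrt b * \<rho> / 2) * C + 2 * (C * sqrt b * \<rho> / 2)"
  proof (rule norm_triangle_mono)
    show "norm ((V \<rho> \<tau> - 2 * \<i>) * V \<rho> t) \<le> (C * sqrt b * \<rho> / 2) * C"
      unfolding norm_mult by (rule mult_mono[OF V_minus_2i[OF \<rho> t(1)] V_bounds(1)[OF \<rho> t(2)]]) (use cC ab \<rho> in auto)
    show "norm (2 * \<i> * (V \<rho> t - 2 * \<i>)) \<le> 2 * (C * sqrt b * \<rho> / 2)"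
      using V_minus_2i[OF \<rho> t(2)] by (simp add: norm_mult)
  qed
  finally have 1: "norm (4 + V \<rho> \<tau> * V \<rho> t) \<le> \<rho> * (C * sqrt b * (C + 2) / 2)" by (simp add: field_simps)
  have 2: "\<rho> * c\<^sup>2 \<le> norm (complex_of_real \<rho> * (V \<rho> \<tau> * V \<rho> t))"
    using \<rho> mult_mono[OF V_bounds(3)[OF \<rho> t(1)] V_bounds(3)[OF \<rho> t(2)]] cC
    by (simp add: norm_mult power2_eq_square)
  have "norm (x12 \<tau> t \<rho>) \<le> \<rho> * (C * sqrt b * (C + 2) / 2) / (\<rho> * c\<^sup>2)"
    unfolding x12_def norm_divide by (rule frac_le[OF _ 1 _ 2]) (use cC ab \<rho> in auto)
  also have "\<dots> = K1" using \<rho> by (simp add: K1_def)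
  finally show ?thesis .
qed

lemma x12_continuous:
  assumes t: "\<tau> \<in> {a..b}" "t \<in> {a..b}"
  shows "continuous_on {0<..1} (x12 \<tau> t)"
  unfolding x12_def
  by (intro continuous_intros baseD[OF base_V] t) (use V_bounds(4) t in auto)

definition J :: "real \<Rightarrow> real \<Rightarrow> real \<Rightarrow> complex" where
  "J \<tau> t \<rho> = integral {0..\<rho>} (x12 \<tau> t)"

lemma x12_integrable:
  assumes t: "\<tau> \<in> {a..b}" "t \<in> {a..b}"
  shows "x12 \<tau> t integrable_on {0..1}"
  by (rule integrable_on_bounded_half_open[OF x12_continuous[OF t] x12_bound[OF _ t]]) auto

lemma J_bound:
  assumes t: "\<tau> \<in> {a..b}" "t \<in> {a..b}" and \<rho>: "\<rho> \<in> {0<..1}"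
  shows "norm (J \<tau> t \<rho>) \<le> K1"
proof -
  have "norm (J \<tau> t \<rho>) \<le> integral {0..\<rho>} (\<lambda>r. K1)"
    unfolding J_def
    by (rule integral_norm_bound_half_open[OF integrable_on_subinterval[OF x12_integrable[OF t]] _ x12_bound[OF _ t]])
      (use \<rho> in auto)
  also have "\<dots> = \<rho> * K1" using \<rho> by simp
  also have "\<dots> \<le> K1" using \<rho> K1_pos by simp
  finally show ?thesis .
qed

lemma J_continuous: "\<tau> \<in> {a..b} \<Longrightarrow> t \<in> {a..b} \<Longrightarrow> continuous_on {0..1} (J \<tau> t)"
  unfolding J_def by (rule indefinite_integral_continuous_1[OF x12_integrable])

lemma J_deriv:
  assumes t: "\<tau> \<in> {a..b}" "t \<in> {a..b}" and \<rho>: "0 < \<rho>" "\<rho> < 1"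
  shows "(J \<tau> t has_vector_derivative x12 \<tau> t \<rho>) (at \<rho>)"
  unfolding J_def
  by (rule indefinite_integral_deriv[OF continuous_on_subset[OF x12_continuous[OF t]] x12_integrable[OF t] \<rho>]) auto

lemma exp_minus_J_deriv:
  assumes t: "\<tau> \<in> {a..b}" "t \<in> {a..b}" and \<rho>: "0 < \<rho>" "\<rho> < 1"
  shows "((\<lambda>\<rho>. exp (- J \<tau> t \<rho>)) has_vector_derivative - x12 \<tau> t \<rho> * exp (- J \<tau> t \<rho>)) (at \<rho>)"
proof -
  have "((\<lambda>\<rho>. - J \<tau> t \<rho>) has_vector_derivative - x12 \<tau> t \<rho>) (at \<rho>)"
    by (rule has_vector_derivative_minus[OF J_deriv[OF t \<rho>]])
  from field_vector_diff_chain_at[OF this DERIV_exp] show ?thesis by (simp add: o_def)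
qed

text \<open>The difference of two flows solves an exact linear equation; after the substitution
  \<open>h = \<xi> - N\<close> its forcing term contains the driving function undifferentiated.\<close>
lemma V_difference:
  assumes t: "\<tau> \<in> {a..b}" "t \<in> {a..b}" and \<rho>: "\<rho> \<in> {0<..1}"
  shows "V \<rho> t - V \<rho> \<tau> = complex_of_real \<rho> * ((\<nu> \<rho> t - \<nu> \<rho> \<tau>) + exp (J \<tau> t \<rho>) *
     radial_mean 2 (\<lambda>r. (\<nu> r t - \<nu> r \<tau>) * (4 * inverse (V r \<tau>) * inverse (V r t) * exp (- J \<tau> t r))) \<rho>)"
proof -
  \<comment> \<open>Subtracting \<open>N\<close> cancels the driving terms in the derivative of
    \<open>h\<close> and leaves only the singular part.\<close>
  define h where "h r = (xi t r - N t r) - (xi \<tau> r - N \<tau> r)" for r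
  \<comment> \<open>The integrating factor is \<open>r * exp (- J \<tau> t r)\<close>:
    \<open>r\<close> belongs to the part \<open>- 1 / r\<close> of the coefficient,
    \<open>exp (- J)\<close> to the bounded rest \<open>x12\<close>. The homogeneous solution
    \<open>1 / r\<close> does not appear because \<open>g\<close> vanishes at 0.\<close>
  define g where "g r = complex_of_real r * h r * exp (- J \<tau> t r)" for r
  define F where "F r = (\<nu> r t - \<nu> r \<tau>) * (4 * inverse (V r \<tau>) * inverse (V r t) * exp (- J \<tau> t r))" for r
  have "((\<lambda>r. complex_of_real (r ^ 2) * F r) has_integral g \<rho> - g 0) {0..\<rho>}"
  proof (rule fundamental_theorem_of_calculus_interior)
    show "0 \<le> \<rho>" using \<rho> by simp
    show "continuous_on {0..\<rho>} g" unfolding g_def h_def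
      by (intro continuous_intros continuous_on_subset[OF xi_continuous[OF t(1)]] continuous_on_subset[OF xi_continuous[OF t(2)]]
        continuous_on_subset[OF N_continuous[OF t(1)]] continuous_on_subset[OF N_continuous[OF t(2)]]
        continuous_on_subset[OF J_continuous[OF t]]) (use \<rho> in auto)
    fix r assume "r \<in> {0<..<\<rho>}"
    then have r: "0 < r" "r < 1" "r \<in> {0<..1}" using \<rho> by auto
    let ?V = "V r t" and ?W = "V r \<tau>"
    let ?e = "exp (- J \<tau> t r)"
    let ?h' = "complex_of_real (2 * r) * (- 2 / xi t r + \<mu> r t) - complex_of_real (2 * r) * \<mu> r t
      - (complex_of_real (2 * r) * (- 2 / xi \<tau> r + \<mu> r \<tau>) - complex_of_real (2 * r) * \<mu> r \<tau>)"
    have h': "(h has_vector_derivative ?h') (at r)"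
      unfolding h_def by (intro has_vector_derivative_diff xi_deriv N_deriv t r)
    have id: "((\<lambda>r. complex_of_real r) has_vector_derivative 1) (at r)"
      by (auto intro!: derivative_eq_intros)
    have "(g has_vector_derivative (complex_of_real r * h r) * (- x12 \<tau> t r * ?e) + (complex_of_real r * ?h' + 1 * h r) * ?e) (at r)"
      unfolding g_def by (intro has_vector_derivative_mult id h' exp_minus_J_deriv t r)
    moreover have "(complex_of_real r * h r) * (- x12 \<tau> t r * ?e) + (complex_of_real r * ?h' + 1 * h r) * ?e = complex_of_real (r ^ 2) * F r"
    proof -
      have nz: "?V \<noteq> 0" "?W \<noteq> 0" "complex_of_real r \<noteq> 0"
        using V_bounds(4)[OF r(3)] t r by auto
      have hN: "h r + complex_of_real (r\<^sup>2) * (\<nu> r t - \<nu> r \<tau>) = complex_of_real r * (?V - ?W)"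
        unfolding right_diff_distrib N_eq[OF r(3) t(1)] N_eq[OF r(3) t(2)] h_def N_def xi_V[OF r(3)]
        by (simp add: algebra_simps)
      have h'': "complex_of_real r * ?h' = 4 * (complex_of_real r * (?V - ?W)) / (?V * ?W)"
        unfolding xi_V[OF r(3)] using nz by (simp add: field_simps)
      have rx: "complex_of_real r * x12 \<tau> t r = (4 + ?W * ?V) / (?W * ?V)"
        unfolding x12_def using nz by simp
      have "(complex_of_real r * h r) * (- x12 \<tau> t r * ?e) + (complex_of_real r * ?h' + 1 * h r) * ?e
        = (- h r * (complex_of_real r * x12 \<tau> t r) + complex_of_real r * ?h' + h r) * ?e"
        by (simp add: algebra_simps)
      also have "\<dots> = (- h r * ((4 + ?W * ?V) / (?W * ?V)) + 4 * (h r + complex_of_real (r\<^sup>2) * (\<nu> r t - \<nu> r \<tau>)) / (?V * ?W) + h r) * ?e"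
        unfolding rx h'' hN ..
      also have "\<dots> = complex_of_real (r ^ 2) * F r"
        unfolding F_def using nz by (simp add: field_simps)
      finally show ?thesis .
    qed
    ultimately show "(g has_vector_derivative complex_of_real (r ^ 2) * F r) (at r)" by simp
  qed
  then have "integral {0..\<rho>} (\<lambda>r. complex_of_real (r ^ 2) * F r) = g \<rho>"
    by (simp add: g_def integral_unique)
  then have rm: "radial_mean 2 F \<rho> = g \<rho> / complex_of_real (\<rho> ^ 3)"
    unfolding radial_mean_def by (simp add: numeral_3_eq_3)
  have \<rho>0: "complex_of_real \<rho> \<noteq> 0" using \<rho> by simp
  have "exp (J \<tau> t \<rho>) * radial_mean 2 F \<rho> = h \<rho> / complex_of_real (\<rho>\<^sup>2)"
    unfolding rm g_def using \<rho>0 by (simp add: exp_minus field_simps power2_eq_square power3_eq_cube)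
  then have "complex_of_real \<rho> * ((\<nu> \<rho> t - \<nu> \<rho> \<tau>) + exp (J \<tau> t \<rho>) * radial_mean 2 F \<rho>)
     = (complex_of_real (\<rho>\<^sup>2) * (\<nu> \<rho> t - \<nu> \<rho> \<tau>) + h \<rho>) / complex_of_real \<rho>"
    using \<rho>0 by (simp add: field_simps power2_eq_square)
  also have "complex_of_real (\<rho>\<^sup>2) * (\<nu> \<rho> t - \<nu> \<rho> \<tau>) + h \<rho> = complex_of_real \<rho> * (V \<rho> t - V \<rho> \<tau>)"
    unfolding right_diff_distrib N_eq[OF \<rho> t(1)] N_eq[OF \<rho> t(2)] h_def N_def xi_V[OF \<rho>]
    by (simp add: algebra_simps)
  finally show ?thesis using \<rho>0 by (simp add: F_def[abs_def])
qed

end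

section \<open>Differentiation in t and bootstrap\<close>

context parameter_interval
begin

lemma frozen_cls:
  assumes "base f" "\<tau> \<in> {a..b}"
  shows "cls j (\<lambda>\<rho> t. f \<rho> \<tau>)"
proof -
  obtain B where "B > 0" "\<And>\<rho> t. \<rho> \<in> {0<..1} \<Longrightarrow> t \<in> {a..b} \<Longrightarrow> norm (f \<rho> t) \<le> B"
    using base_bound[OF assms(1)] by metis
  then show ?thesis using assms by (intro cls_const[of _ B] baseD) auto
qed

text \<open>The factor \<open>q\<close> is only Hoelder continuous, but \<open>p\<close> is already
  of first order in \<open>t - \<tau>\<close>; freezing \<open>q\<close> at \<tau> therefore costs a
  term of order 1 + \<alpha>, no more than the remainder.\<close>

lemma taylor_mult:
  assumes q: "cls 0 q" and \<tau>: "\<tau> \<in> {a..b}"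
    and p': "\<And>\<rho>. \<rho> \<in> {0<..1} \<Longrightarrow> norm (p' \<rho>) \<le> B"
    and p: "\<And>\<rho> t. \<rho> \<in> {0<..1} \<Longrightarrow> t \<in> {a..b} \<Longrightarrow> norm (p \<rho> t - (t - \<tau>) *\<^sub>R p' \<rho>) \<le> K * \<bar>t - \<tau>\<bar> powr (1 + \<alpha>)"
  obtains K' where "\<And>\<rho> t. \<rho> \<in> {0<..1} \<Longrightarrow> t \<in> {a..b} \<Longrightarrow>
    norm (q \<rho> t * p \<rho> t - (t - \<tau>) *\<^sub>R (q \<rho> \<tau> * p' \<rho>)) \<le> K' * \<bar>t - \<tau>\<bar> powr (1 + \<alpha>)"
proof -
  obtain Q where Q: "Q > 0" "\<And>\<rho> t. \<rho> \<in> {0<..1} \<Longrightarrow> t \<in> {a..b} \<Longrightarrow> norm (q \<rho> t) \<le> Q"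
    using base_bound[OF cls_base[OF q]] by metis
  obtain H where H: "H > 0" "\<And>\<rho> s t. \<rho> \<in> {0<..1} \<Longrightarrow> s \<in> {a..b} \<Longrightarrow> t \<in> {a..b} \<Longrightarrow> norm (q \<rho> s - q \<rho> t) \<le> H * \<bar>s - t\<bar> powr \<alpha>"
    using hol_bound[OF cls_hol[OF q]] by metis
  show thesis
  proof (rule that[of "Q * K + H * B"])
    fix \<rho> t :: real assume *: "\<rho> \<in> {0<..1}" "t \<in> {a..b}"
    have pw: "\<bar>t - \<tau>\<bar> * \<bar>t - \<tau>\<bar> powr \<alpha> = \<bar>t - \<tau>\<bar> powr (1 + \<alpha>)"
      by (cases "t = \<tau>") (auto simp: powr_add)
    have "q \<rho> t * p \<rho> t - (t - \<tau>) *\<^sub>R (q \<rho> \<tau> * p' \<rho>) = q \<rho> t * (p \<rho> t - (t - \<tau>) *\<^sub>R p' \<rho>) + (t - \<tau>) *\<^sub>R ((q \<rho> t - q \<rho> \<tau>) * p' \<rho>)"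
      by (simp add: algebra_simps scaleR_conv_of_real)
    also have "norm \<dots> \<le> Q * (K * \<bar>t - \<tau>\<bar> powr (1 + \<alpha>)) + \<bar>t - \<tau>\<bar> * ((H * \<bar>t - \<tau>\<bar> powr \<alpha>) * B)"
    proof (rule norm_triangle_mono)
      show "norm (q \<rho> t * (p \<rho> t - (t - \<tau>) *\<^sub>R p' \<rho>)) \<le> Q * (K * \<bar>t - \<tau>\<bar> powr (1 + \<alpha>))"
        unfolding norm_mult by (rule mult_mono[OF Q(2)[OF *] p[OF *]]) (use Q in auto)
      show "norm ((t - \<tau>) *\<^sub>R ((q \<rho> t - q \<rho> \<tau>) * p' \<rho>)) \<le> \<bar>t - \<tau>\<bar> * ((H * \<bar>t - \<tau>\<bar> powr \<alpha>) * B)"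
        unfolding norm_scaleR norm_mult
        by (intro mult_left_mono mult_mono[OF H(2)[OF * \<tau>] p'[OF *(1)]]) (use H in auto)
    qed
    also have "\<dots> = Q * K * \<bar>t - \<tau>\<bar> powr (1 + \<alpha>) + H * B * (\<bar>t - \<tau>\<bar> * \<bar>t - \<tau>\<bar> powr \<alpha>)" by (simp add: mult_ac)
    finally show "norm (q \<rho> t * p \<rho> t - (t - \<tau>) *\<^sub>R (q \<rho> \<tau> * p' \<rho>)) \<le> (Q * K + H * B) * \<bar>t - \<tau>\<bar> powr (1 + \<alpha>)"
      unfolding pw by (simp add: algebra_simps)
  qed
qed

end

context scaled_flow
begin

lemma cls_d: "cls k d"
  by (rule zcls_imp_cls[OF zcls_d])

text \<open>All factors in the formula for the difference are bounded uniformly in \<rho>, and \<nu>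
  is Lipschitz. The factor \<rho> is kept in the bound because \<open>tder_V\<close> works with the
  difference divided by \<rho>.\<close>

lemma V_lipschitz:
  obtains K where "K > 0" "\<And>\<rho> \<tau> t. \<rho> \<in> {0<..1} \<Longrightarrow> \<tau> \<in> {a..b} \<Longrightarrow> t \<in> {a..b} \<Longrightarrow> norm (V \<rho> t - V \<rho> \<tau>) \<le> \<rho> * (K * \<bar>t - \<tau>\<bar>)"
proof -
  obtain M where M: "M > 0" "\<And>\<rho> s t. \<rho> \<in> {0<..1} \<Longrightarrow> s \<in> {a..b} \<Longrightarrow> t \<in> {a..b} \<Longrightarrow> norm (\<nu> \<rho> s - \<nu> \<rho> t) \<le> M * \<bar>s - t\<bar>"
    using tder_lipschitz[OF tder_\<nu> cls_base[OF cls_d]] by metis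
  define G1 where "G1 = 4 * inverse c * inverse c * exp K1"
  have G1: "G1 > 0" using cC by (simp add: G1_def)
  show thesis
  proof (rule that[of "M + exp K1 * (M * G1)"])
    show "M + exp K1 * (M * G1) > 0" using M G1 by (simp add: add_pos_pos)
    fix \<rho> \<tau> t :: real assume \<rho>: "\<rho> \<in> {0<..1}" and t: "\<tau> \<in> {a..b}" "t \<in> {a..b}"
    define F where "F r = (\<nu> r t - \<nu> r \<tau>) * (4 * inverse (V r \<tau>) * inverse (V r t) * exp (- J \<tau> t r))" for r
    have cF: "continuous_on {0<..1} F" unfolding F_def
      by (intro continuous_intros baseD[OF base_\<nu>] baseD[OF base_V] continuous_on_subset[OF J_continuous[OF t]] t)
        (use V_bounds(4) t in auto)
    have e: "norm (exp (- J \<tau> t r)) \<le> exp K1" "norm (exp (J \<tau> t r)) \<le> exp K1" if "r \<in> {0<..1}" for r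
      using J_bound[OF t that] abs_Re_le_cmod[of "J \<tau> t r"] by (auto simp: norm_exp_eq_Re)
    have bF: "norm (F r) \<le> (M * \<bar>t - \<tau>\<bar>) * G1" if r: "r \<in> {0<..1}" for r
    proof -
      have "norm (inverse (V r u)) \<le> inverse c" if "u \<in> {a..b}" for u
        unfolding norm_inverse by (rule le_imp_inverse_le[OF V_bounds(3)[OF r that] cC(1)])
      then have "norm (4 * inverse (V r \<tau>) * inverse (V r t) * exp (- J \<tau> t r)) \<le> G1"
        unfolding G1_def norm_mult using e(1)[OF r] cC t by (intro mult_mono) auto
      then show ?thesis unfolding F_def norm_mult[of "\<nu> r t - \<nu> r \<tau>"]
        by (intro mult_mono[OF M(2)[OF r t(2,1)]]) (use M in auto)
    qed
    have "norm (radial_mean 2 F \<rho>) \<le> (M * \<bar>t - \<tau>\<bar>) * G1"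
      by (rule radial_mean_bound[OF cF bF \<rho> bF]) (use \<rho> in auto)
    then have 1: "norm (exp (J \<tau> t \<rho>) * radial_mean 2 F \<rho>) \<le> exp K1 * ((M * \<bar>t - \<tau>\<bar>) * G1)"
      unfolding norm_mult by (rule mult_mono[OF e(2)[OF \<rho>]]) auto
    have "norm (V \<rho> t - V \<rho> \<tau>) = \<rho> * norm ((\<nu> \<rho> t - \<nu> \<rho> \<tau>) + exp (J \<tau> t \<rho>) * radial_mean 2 F \<rho>)"
      unfolding V_difference[OF t \<rho>] F_def[abs_def] norm_mult using \<rho> by simp
    also have "\<dots> \<le> \<rho> * (M * \<bar>t - \<tau>\<bar> + exp K1 * ((M * \<bar>t - \<tau>\<bar>) * G1))"
      using \<rho> by (intro mult_left_mono norm_triangle_mono[OF M(2)[OF \<rho> t(2,1)] 1]) auto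
    finally show "norm (V \<rho> t - V \<rho> \<tau>) \<le> \<rho> * ((M + exp K1 * (M * G1)) * \<bar>t - \<tau>\<bar>)" by (simp add: algebra_simps)
  qed
qed

lemma hol_V: "hol V"
proof -
  obtain K where K: "K > 0" "\<And>\<rho> \<tau> t. \<rho> \<in> {0<..1} \<Longrightarrow> \<tau> \<in> {a..b} \<Longrightarrow> t \<in> {a..b} \<Longrightarrow> norm (V \<rho> t - V \<rho> \<tau>) \<le> \<rho> * (K * \<bar>t - \<tau>\<bar>)"
    using V_lipschitz by metis
  show ?thesis
  proof (rule hol_of_lipschitz)
    fix \<rho> s t :: real assume *: "\<rho> \<in> {0<..1}" "s \<in> {a..b}" "t \<in> {a..b}"
    have "\<rho> * (K * \<bar>s - t\<bar>) \<le> 1 * (K * \<bar>s - t\<bar>)" using * K(1) by (intro mult_right_mono) auto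
    with K(2)[OF *(1,3,2)] show "norm (V \<rho> s - V \<rho> t) \<le> K * \<bar>s - t\<bar>" by linarith
  qed (use K in simp)
qed

lemma cls_V_0: "cls 0 V"
  by (rule cls_0I[OF base_V hol_V])

lemma cls_inverse_V: "cls j V \<Longrightarrow> cls j (\<lambda>\<rho> t. inverse (V \<rho> t))"
  by (rule cls_inverse[OF _ cC(1) V_bounds(3)])

text \<open>This is \<open>x12\<close> for two equal times, written through \<open>V_sq_eq\<close>
  so that its class can be read off without a division by \<rho>.\<close>

definition X :: "real \<Rightarrow> real \<Rightarrow> complex" where
  "X \<rho> t = 4 * (Av 2 (\<lambda>\<rho> t. V \<rho> t * \<mu> \<rho> t) \<rho> t * (inverse (V \<rho> t) * inverse (V \<rho> t)))"

definition E :: "real \<Rightarrow> real \<Rightarrow> complex" where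
  "E \<rho> t = exp (complex_of_real \<rho> * Av 0 X \<rho> t)"

definition Einv :: "real \<Rightarrow> real \<Rightarrow> complex" where
  "Einv \<rho> t = exp ((-1) * (complex_of_real \<rho> * Av 0 X \<rho> t))"

lemma cls_X: "cls j V \<Longrightarrow> j \<le> Suc k \<Longrightarrow> cls j X"
  unfolding X_def by (intro cls_cmult cls_mult cls_Av cls_inverse_V cls_le[OF cls_\<mu>])

lemma cls_E: "cls j V \<Longrightarrow> j \<le> Suc k \<Longrightarrow> cls j E"
  unfolding E_def by (intro cls_exp cls_mult cls_rho cls_Av cls_X)

lemma cls_Einv: "cls j V \<Longrightarrow> j \<le> Suc k \<Longrightarrow> cls j Einv"
  unfolding Einv_def by (intro cls_exp cls_cmult cls_mult cls_rho cls_Av cls_X)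

lemma X_eq:
  assumes "\<rho> \<in> {0<..1}" "t \<in> {a..b}"
  shows "X \<rho> t = x12 t t \<rho>"
proof -
  have "4 * complex_of_real \<rho> * Av 2 (\<lambda>\<rho> t. V \<rho> t * \<mu> \<rho> t) \<rho> t = 4 + V \<rho> t * V \<rho> t"
    using V_sq_eq[OF assms] by (simp add: power2_eq_square add.commute)
  then have "Av 2 (\<lambda>\<rho> t. V \<rho> t * \<mu> \<rho> t) \<rho> t = (4 + V \<rho> t * V \<rho> t) / (4 * complex_of_real \<rho>)"
    using assms by (simp add: field_simps)
  then show ?thesis using V_bounds(4)[OF assms] assms by (simp add: X_def x12_def field_simps)
qed

lemma J_eq_Av:
  assumes eq: "\<And>\<rho>. \<rho> \<in> {0<..1} \<Longrightarrow> x12 \<tau> t \<rho> = Y \<rho> t" and \<rho>: "\<rho> \<in> {0<..1}"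
  shows "J \<tau> t \<rho> = complex_of_real \<rho> * Av 0 Y \<rho> t"
proof -
  have "integral {0..\<rho>} (x12 \<tau> t) = integral {0..\<rho>} (\<lambda>r. Y r t)"
    by (rule integral_spike[OF negligible_sing[of 0]]) (use eq \<rho> in auto)
  then show ?thesis using \<rho> by (simp add: J_def Av_def radial_mean_def)
qed

lemma J_diag: "\<rho> \<in> {0<..1} \<Longrightarrow> t \<in> {a..b} \<Longrightarrow> J t t \<rho> = complex_of_real \<rho> * Av 0 X \<rho> t"
  by (rule J_eq_Av) (simp_all add: X_eq)

text \<open>The integrand in the formula for the difference at equal times, with the increment of
  \<nu> replaced by its derivative \<open>d\<close>.\<close>

definition F :: "real \<Rightarrow> real \<Rightarrow> complex" where
  "F \<rho> t = d \<rho> t * (4 * (inverse (V \<rho> t) * (inverse (V \<rho> t) * Einv \<rho> t)))"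

text \<open>The t-derivative of \<open>V\<close> divided by \<rho>, as obtained by letting the two
  times in \<open>V_difference\<close> merge.\<close>

definition W :: "real \<Rightarrow> real \<Rightarrow> complex" where
  "W \<rho> t = d \<rho> t + E \<rho> t * Av 2 F \<rho> t"

lemma cls_W: "cls j V \<Longrightarrow> j \<le> k \<Longrightarrow> cls j W"
  unfolding W_def F_def by (intro cls_add cls_mult cls_cmult cls_Av cls_inverse_V cls_E cls_Einv cls_le[OF cls_d]) simp_all

text \<open>The exact formula for the difference is expanded around \<tau>. The increment of \<nu>
  is of first order with a remainder of order 1 + \<alpha>; the other factors involve both times but
  are Hoelder continuous in \<open>t\<close>, so \<open>taylor_mult\<close> freezes them at \<tau>,
  once inside the mean and once outside.\<close>

lemma tder_V: "tder V (\<lambda>\<rho> t. complex_of_real \<rho> * W \<rho> t)"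
proof (rule tderI)
  fix \<rho> \<tau> :: real assume \<rho>: "\<rho> \<in> {0<..1}" and \<tau>: "\<tau> \<in> {a..b}"
  obtain K where K: "K > 0" "\<And>\<rho> \<tau> t. \<rho> \<in> {0<..1} \<Longrightarrow> \<tau> \<in> {a..b} \<Longrightarrow> t \<in> {a..b} \<Longrightarrow> norm (V \<rho> t - V \<rho> \<tau>) \<le> \<rho> * (K * \<bar>t - \<tau>\<bar>)"
    using V_lipschitz by metis
  \<comment> \<open>The coefficient \<open>x12 \<tau> t\<close> differs from its value at equal
    times by a multiple of this quotient, whose regularity therefore controls the exponential
    factors.\<close>
  define U where "U \<rho> t = (V \<rho> t - V \<rho> \<tau>) / complex_of_real \<rho>" for \<rho> t
  have cU: "cls 0 U"
  proof (rule cls_0I)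
    show "base U"
    proof (rule baseI[of _ "K * (b - a)"])
      show "continuous_on {0<..1} (\<lambda>\<rho>. U \<rho> t)" if "t \<in> {a..b}" for t
        unfolding U_def by (intro continuous_intros baseD[OF base_V] that \<tau>) auto
      fix \<rho> t :: real assume *: "\<rho> \<in> {0<..1}" "t \<in> {a..b}"
      have "norm (U \<rho> t) \<le> K * \<bar>t - \<tau>\<bar>"
        using K(2)[OF *(1) \<tau> *(2)] * by (simp add: U_def norm_divide divide_le_eq mult.commute)
      also have "\<dots> \<le> K * (b - a)" using K * \<tau> by (intro mult_left_mono) auto
      finally show "norm (U \<rho> t) \<le> K * (b - a)" .
    qed
    show "hol U"
    proof (rule hol_of_lipschitz)
      fix \<rho> s t :: real assume *: "\<rho> \<in> {0<..1}" "s \<in> {a..b}" "t \<in> {a..b}"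
      have "U \<rho> s - U \<rho> t = (V \<rho> s - V \<rho> t) / complex_of_real \<rho>"
        by (simp add: U_def diff_divide_distrib)
      then show "norm (U \<rho> s - U \<rho> t) \<le> K * \<bar>s - t\<bar>"
        using K(2)[OF *(1,3,2)] * by (simp add: norm_divide divide_le_eq mult.commute)
    qed (use K in simp)
  qed
  define X12 where "X12 \<rho> t = X \<rho> \<tau> + (-4) * (U \<rho> t * (inverse (V \<rho> \<tau>) * (inverse (V \<rho> \<tau>) * inverse (V \<rho> t))))" for \<rho> t
  have bX: "base X" by (rule cls_base[OF cls_X[OF cls_V_0]]) simp
  have biV: "base (\<lambda>\<rho> t. inverse (V \<rho> t))" by (rule cls_base[OF cls_inverse_V[OF cls_V_0]])
  have cX12: "cls 0 X12" unfolding X12_def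
    by (intro cls_add cls_cmult cls_mult cU cls_inverse_V cls_V_0 frozen_cls[OF bX \<tau>] frozen_cls[OF biV \<tau>])
  have X12: "x12 \<tau> t \<rho> = X12 \<rho> t" if "\<rho> \<in> {0<..1}" "t \<in> {a..b}" for \<rho> t
    unfolding X12_def U_def X_eq[OF that(1) \<tau>] x12_def
    using V_bounds(4)[OF that] V_bounds(4)[OF that(1) \<tau>] that by (simp add: field_simps)
  have J: "J \<tau> t \<rho> = complex_of_real \<rho> * Av 0 X12 \<rho> t" if "\<rho> \<in> {0<..1}" "t \<in> {a..b}" for \<rho> t
    by (rule J_eq_Av[where Y = X12, OF X12[OF _ that(2)] that(1)])
  define E12 where "E12 \<rho> t = exp (complex_of_real \<rho> * Av 0 X12 \<rho> t)" for \<rho> t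
  define G where "G \<rho> t = 4 * (inverse (V \<rho> \<tau>) * (inverse (V \<rho> t) * exp ((-1) * (complex_of_real \<rho> * Av 0 X12 \<rho> t))))" for \<rho> t
  have cE12: "cls 0 E12" unfolding E12_def by (intro cls_exp cls_mult cls_rho cls_Av cX12)
  have cG: "cls 0 G" unfolding G_def
    by (intro cls_cmult cls_mult cls_exp cls_rho cls_Av cX12 cls_inverse_V cls_V_0 frozen_cls[OF biV \<tau>])
  have "X12 \<rho> \<tau> = X \<rho> \<tau>" for \<rho> by (simp add: X12_def U_def)
  then have "Av 0 X12 \<rho> \<tau> = Av 0 X \<rho> \<tau>" for \<rho> by (simp add: Av_def)
  then have E\<tau>: "E12 \<rho> \<tau> = E \<rho> \<tau>" and G\<tau>: "d \<rho> \<tau> * G \<rho> \<tau> = F \<rho> \<tau>" for \<rho>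
    by (simp_all add: E12_def E_def G_def F_def Einv_def)
  obtain Bd where Bd: "Bd > 0" "\<And>\<rho> t. \<rho> \<in> {0<..1} \<Longrightarrow> t \<in> {a..b} \<Longrightarrow> norm (d \<rho> t) \<le> Bd"
    using base_bound[OF cls_base[OF cls_d]] by metis
  obtain K0 where K0: "K0 > 0" "\<And>\<rho> s t. \<rho> \<in> {0<..1} \<Longrightarrow> s \<in> {a..b} \<Longrightarrow> t \<in> {a..b} \<Longrightarrow>
     norm (\<nu> \<rho> s - \<nu> \<rho> t - (s - t) *\<^sub>R d \<rho> t) \<le> K0 * \<bar>s - t\<bar> powr (1 + \<alpha>)"
    using tder_taylor[OF tder_\<nu> cls_hol[OF cls_d]] by metis
  define p where "p \<rho> t = \<nu> \<rho> t - \<nu> \<rho> \<tau>" for \<rho> t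
  have p: "norm (p \<rho> t - (t - \<tau>) *\<^sub>R d \<rho> \<tau>) \<le> K0 * \<bar>t - \<tau>\<bar> powr (1 + \<alpha>)" if "\<rho> \<in> {0<..1}" "t \<in> {a..b}" for \<rho> t
    using K0(2)[OF that \<tau>] by (simp add: p_def)
  obtain K2 where K2: "\<And>\<rho> t. \<rho> \<in> {0<..1} \<Longrightarrow> t \<in> {a..b} \<Longrightarrow>
    norm (G \<rho> t * p \<rho> t - (t - \<tau>) *\<^sub>R (G \<rho> \<tau> * d \<rho> \<tau>)) \<le> K2 * \<bar>t - \<tau>\<bar> powr (1 + \<alpha>)"
    by (rule taylor_mult[OF cG \<tau> Bd(2)[OF _ \<tau>] p]) (assumption | rule that)+
  have bp: "base p"
  proof -
    have "base (\<lambda>\<rho> t. \<nu> \<rho> t + (-1) * \<nu> \<rho> \<tau>)"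
      by (intro base_add base_mult base_\<nu> cls_base[OF cls_complex_const[of 0]] cls_base[OF frozen_cls[OF base_\<nu> \<tau>, of 0]])
    then show ?thesis by (simp add: p_def[abs_def])
  qed
  have bpG: "base (\<lambda>\<rho> t. p \<rho> t * G \<rho> t)" by (rule base_mult[OF bp cls_base[OF cG]])
  have bdG: "base (\<lambda>\<rho> t. d \<rho> t * G \<rho> t)" by (rule base_mult[OF cls_base[OF cls_d] cls_base[OF cG]])
  define q where "q \<rho> t = Av 2 (\<lambda>\<rho> t. p \<rho> t * G \<rho> t) \<rho> t" for \<rho> t
  have q\<tau>: "q \<rho> \<tau> = 0" for \<rho> by (simp add: q_def Av_def p_def radial_mean_def)
  have AvF: "Av 2 (\<lambda>\<rho> t. d \<rho> t * G \<rho> t) \<rho> \<tau> = Av 2 F \<rho> \<tau>" for \<rho> by (simp add: Av_def G\<tau>)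
  have q: "norm (q \<rho> t - (t - \<tau>) *\<^sub>R Av 2 F \<rho> \<tau>) \<le> K2 * \<bar>t - \<tau>\<bar> powr (1 + \<alpha>)" if *: "\<rho> \<in> {0<..1}" "t \<in> {a..b}" for \<rho> t
  proof -
    have "norm (Av 2 (\<lambda>\<rho> t. p \<rho> t * G \<rho> t) \<rho> t - Av 2 (\<lambda>\<rho> t. p \<rho> t * G \<rho> t) \<rho> \<tau> - (t - \<tau>) *\<^sub>R Av 2 (\<lambda>\<rho> t. d \<rho> t * G \<rho> t) \<rho> \<tau>) \<le> K2 * \<bar>t - \<tau>\<bar> powr (1 + \<alpha>)"
    proof (rule Av_diff_bound[OF bpG bdG *(1) *(2) \<tau>])
      fix r :: real assume r: "r \<in> {0<..1}"
      show "norm (p r t * G r t - p r \<tau> * G r \<tau> - (t - \<tau>) *\<^sub>R (d r \<tau> * G r \<tau>)) \<le> K2 * \<bar>t - \<tau>\<bar> powr (1 + \<alpha>)"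
        using K2[OF r *(2)] by (simp add: p_def mult.commute)
    qed
    then show ?thesis using q\<tau>[of \<rho>] unfolding AvF q_def[symmetric] by simp
  qed
  obtain BF where BF: "BF > 0" "\<And>\<rho> t. \<rho> \<in> {0<..1} \<Longrightarrow> t \<in> {a..b} \<Longrightarrow> norm (Av 2 (\<lambda>\<rho> t. d \<rho> t * G \<rho> t) \<rho> t) \<le> BF"
    using base_bound[OF base_Av[OF bdG]] by metis
  have BF': "norm (Av 2 F \<rho> \<tau>) \<le> BF" if "\<rho> \<in> {0<..1}" for \<rho> using BF(2)[OF that \<tau>] by (simp add: AvF)
  obtain K3 where K3: "\<And>\<rho> t. \<rho> \<in> {0<..1} \<Longrightarrow> t \<in> {a..b} \<Longrightarrow>
    norm (E12 \<rho> t * q \<rho> t - (t - \<tau>) *\<^sub>R (E12 \<rho> \<tau> * Av 2 F \<rho> \<tau>)) \<le> K3 * \<bar>t - \<tau>\<bar> powr (1 + \<alpha>)"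
    by (rule taylor_mult[OF cE12 \<tau> BF' q]) (assumption | rule that)+
  show "(V \<rho> has_vector_derivative complex_of_real \<rho> * W \<rho> \<tau>) (at \<tau> within {a..b})"
  proof (rule has_vector_derivative_of_taylor[OF _ \<alpha>(1), of _ _ _ _ "K0 + K3"])
    fix t assume t: "t \<in> {a..b}"
    have rm: "radial_mean 2 (\<lambda>r. (\<nu> r t - \<nu> r \<tau>) * (4 * inverse (V r \<tau>) * inverse (V r t) * exp (- J \<tau> t r))) \<rho> = q \<rho> t"
      unfolding q_def Av_def radial_mean_def
    proof (rule arg_cong2[where f = "(/)"], rule integral_spike[OF negligible_sing[of 0]])
      fix r assume "r \<in> {0..\<rho>} - {0}"
      then have r: "r \<in> {0<..1}" using \<rho> by auto
      show "complex_of_real (r ^ 2) * (p r t * G r t) = complex_of_real (r ^ 2) * ((\<nu> r t - \<nu> r \<tau>) * (4 * inverse (V r \<tau>) * inverse (V r t) * exp (- J \<tau> t r)))"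
        unfolding J[OF r t] by (simp add: p_def G_def mult.assoc)
    qed simp
    have "V \<rho> t - V \<rho> \<tau> = complex_of_real \<rho> * (p \<rho> t + E12 \<rho> t * q \<rho> t)"
      unfolding V_difference[OF \<tau> t \<rho>] rm J[OF \<rho> t] by (simp add: p_def E12_def)
    then have "V \<rho> t - V \<rho> \<tau> - (t - \<tau>) *\<^sub>R (complex_of_real \<rho> * W \<rho> \<tau>)
      = complex_of_real \<rho> * ((p \<rho> t - (t - \<tau>) *\<^sub>R d \<rho> \<tau>) + (E12 \<rho> t * q \<rho> t - (t - \<tau>) *\<^sub>R (E12 \<rho> \<tau> * Av 2 F \<rho> \<tau>)))"
      unfolding W_def E\<tau> by (simp add: algebra_simps scaleR_conv_of_real)
    then have "norm (V \<rho> t - V \<rho> \<tau> - (t - \<tau>) *\<^sub>R (complex_of_real \<rho> * W \<rho> \<tau>))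
      = \<rho> * norm ((p \<rho> t - (t - \<tau>) *\<^sub>R d \<rho> \<tau>) + (E12 \<rho> t * q \<rho> t - (t - \<tau>) *\<^sub>R (E12 \<rho> \<tau> * Av 2 F \<rho> \<tau>)))"
      using \<rho> by (simp only: norm_mult norm_of_real) simp
    also have "\<dots> \<le> 1 * norm ((p \<rho> t - (t - \<tau>) *\<^sub>R d \<rho> \<tau>) + (E12 \<rho> t * q \<rho> t - (t - \<tau>) *\<^sub>R (E12 \<rho> \<tau> * Av 2 F \<rho> \<tau>)))"
      using \<rho> by (intro mult_right_mono) auto
    also have "\<dots> \<le> K0 * \<bar>t - \<tau>\<bar> powr (1 + \<alpha>) + K3 * \<bar>t - \<tau>\<bar> powr (1 + \<alpha>)"
      unfolding mult_1 by (rule norm_triangle_mono[OF p[OF \<rho> t] K3[OF \<rho> t]])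
    finally show "norm (V \<rho> t - V \<rho> \<tau> - (t - \<tau>) *\<^sub>R (complex_of_real \<rho> * W \<rho> \<tau>)) \<le> (K0 + K3) * \<bar>t - \<tau>\<bar> powr (1 + \<alpha>)"
      by (simp add: algebra_simps)
  qed
qed

text \<open>Bootstrap: \<open>V\<close> of class \<open>j\<close> puts \<open>W\<close> into class
  \<open>j\<close>, and hence \<open>V\<close> into class \<open>Suc j\<close>. It ends at
  \<open>Suc k\<close> because \<open>W\<close> contains \<open>d\<close>, which is available in
  class \<open>k\<close>.\<close>

lemma cls_V: "cls (Suc k) V"
proof -
  have "j \<le> Suc k \<Longrightarrow> cls j V" for j
  proof (induction j)
    case (Suc j)
    then have "cls j V" "j \<le> k" by simp_all
    then show ?case by (intro cls_SucI[OF base_V tder_V] cls_mult cls_rho cls_W)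
  qed (rule cls_V_0)
  then show ?thesis by simp
qed

text \<open>The t-derivative of \<open>X = 1 / \<rho> + 4 / (\<rho> * V\<^sup>2)\<close>; the factor
  \<rho> in the derivative of \<open>V\<close> cancels the division by \<rho>.\<close>

definition Xt :: "real \<Rightarrow> real \<Rightarrow> complex" where
  "Xt \<rho> t = (-8) * (inverse (V \<rho> t) * (inverse (V \<rho> t) * inverse (V \<rho> t))) * W \<rho> t"

lemma zcls_F: "zcls k F"
proof -
  have "cls (Suc k) (\<lambda>\<rho> t. 4 * (inverse (V \<rho> t) * (inverse (V \<rho> t) * Einv \<rho> t)))"
    by (intro cls_cmult cls_mult cls_inverse_V cls_Einv cls_V order_refl)
  from zcls_mult[OF this zcls_d] show ?thesis
    unfolding F_def by (simp only: mult.commute[of "d _ _"])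
qed

text \<open>The gain starts in \<open>d\<close> and is passed on by multiplication with factors that
  have one derivative more and by \<open>Av 2\<close>, the weight under which it is stable.\<close>

lemma zcls_W: "zcls k W"
  unfolding W_def by (intro zcls_add zcls_d zcls_mult zcls_Av2 zcls_F cls_E cls_V order_refl)

lemma zcls_Xt: "zcls k Xt"
  unfolding Xt_def by (intro zcls_mult zcls_W cls_cmult cls_mult cls_inverse_V cls_V)

lemma tder_X: "tder X Xt"
proof -
  let ?i = "\<lambda>\<rho> t. inverse (V \<rho> t)" and ?V' = "\<lambda>\<rho> t. complex_of_real \<rho> * W \<rho> t"
  let ?i' = "\<lambda>\<rho> t. (- 1) * (?V' \<rho> t * (?i \<rho> t * ?i \<rho> t))"
  have i: "tder ?i ?i'" by (rule tder_inverse[OF tder_V V_bounds(4)])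
  have "tder (\<lambda>\<rho> t. 1 / complex_of_real \<rho> + 4 / complex_of_real \<rho> * (?i \<rho> t * ?i \<rho> t))
     (\<lambda>\<rho> t. 0 + 4 / complex_of_real \<rho> * (?i \<rho> t * ?i' \<rho> t + ?i' \<rho> t * ?i \<rho> t))"
  proof (rule tder_add)
    show "tder (\<lambda>\<rho> t. 1 / complex_of_real \<rho>) (\<lambda>\<rho> t. 0)" by (rule tderI) auto
    show "tder (\<lambda>\<rho> t. 4 / complex_of_real \<rho> * (?i \<rho> t * ?i \<rho> t)) (\<lambda>\<rho> t. 4 / complex_of_real \<rho> * (?i \<rho> t * ?i' \<rho> t + ?i' \<rho> t * ?i \<rho> t))"
      by (rule tder_rho_mult[OF tder_mult[OF i i]])
  qed
  then have *: "tder X (\<lambda>\<rho> t. 0 + 4 / complex_of_real \<rho> * (?i \<rho> t * ?i' \<rho> t + ?i' \<rho> t * ?i \<rho> t))"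
  proof (rule tder_cong[rotated])
    fix \<rho> t :: real assume "\<rho> \<in> {0<..1}" "t \<in> {a..b}"
    then show "1 / complex_of_real \<rho> + 4 / complex_of_real \<rho> * (?i \<rho> t * ?i \<rho> t) = X \<rho> t"
      using V_bounds(4)[of \<rho> t] by (simp add: X_eq x12_def field_simps)
  qed
  show ?thesis
  proof (rule tderI)
    fix \<rho> t :: real assume \<rho>: "\<rho> \<in> {0<..1}" and t: "t \<in> {a..b}"
    have "0 + 4 / complex_of_real \<rho> * (?i \<rho> t * ?i' \<rho> t + ?i' \<rho> t * ?i \<rho> t) = Xt \<rho> t"
      using \<rho> by (simp add: Xt_def field_simps)
    with tderD[OF * \<rho> t] show "(X \<rho> has_vector_derivative Xt \<rho> t) (at t within {a..b})" by simp
  qed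
qed

end

section \<open>First and second derivative of the tip\<close>

context scaled_flow
begin

text \<open>Eliminates \<open>d\<close> from the derivative of the flow at fixed
  \<open>t * (1 - \<rho>\<^sup>2)\<close>. The \<mu> term cancels the driving term there, so the
  result can be differentiated in \<rho> without differentiating \<mu>.\<close>

lemma rho_sq_d:
  assumes \<rho>: "\<rho> \<in> {0<..1}" and t: "t \<in> {a..b}"
  shows "complex_of_real (t * \<rho>\<^sup>2) * d \<rho> t
    = complex_of_real (sqrt t * dlam t) - complex_of_real (1 - \<rho>\<^sup>2) * \<mu> \<rho> t - N t \<rho> / 2"
proof -
  have t0: "t > 0" by (rule tpos[OF t])
  have 1: "t * t powr (-1/2) = sqrt t"
    using t0 powr_add[of t 1 "-1/2"] by (simp add: powr_half_sqrt)
  have 2: "t * t powr (-3/2) = 1 / sqrt t"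
    using t0 powr_add[of t 1 "-3/2"] by (simp add: powr_minus powr_half_sqrt divide_simps)
  have "complex_of_real (t * \<rho>\<^sup>2) * d \<rho> t
    = complex_of_real (t * t powr (-1/2)) * (complex_of_real (\<rho>\<^sup>2) * Xi 1 dlam \<rho> t)
      - complex_of_real (t * t powr (-3/2)) * (complex_of_real (\<rho>\<^sup>2) * Xi 0 lam \<rho> t) / 2"
    unfolding d_def by (simp add: algebra_simps)
  also have "\<dots> = complex_of_real (sqrt t) * (complex_of_real (dlam t - (1 - \<rho>\<^sup>2) * dlam (t * (1 - \<rho>\<^sup>2))))
      - complex_of_real (1 / sqrt t) * (complex_of_real (lam t - lam (t * (1 - \<rho>\<^sup>2)))) / 2"
    unfolding 1 2 Xi_rho_mult[OF \<rho>] by simp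
  also have "\<dots> = complex_of_real (sqrt t * dlam t) - complex_of_real (1 - \<rho>\<^sup>2) * \<mu> \<rho> t - N t \<rho> / 2"
    unfolding \<mu>_def N_def using t0 by (simp add: powr_half_sqrt algebra_simps diff_divide_distrib)
  finally show ?thesis .
qed

lemma exp_J: "\<rho> \<in> {0<..1} \<Longrightarrow> t \<in> {a..b} \<Longrightarrow> E \<rho> t = exp (J t t \<rho>)" "\<rho> \<in> {0<..1} \<Longrightarrow> t \<in> {a..b} \<Longrightarrow> Einv \<rho> t = exp (- J t t \<rho>)"
  by (simp_all add: E_def Einv_def J_diag)

text \<open>The derivative in \<open>t\<close> of the flow along \<open>t (1 - \<rho>\<^sup>2) = const\<close>, multiplied by \<open>\<rho> exp (- J)\<close>, is
  independent of \<open>\<rho>\<close>; it equals \<open>\<i>\<close> as \<open>\<rho> \<rightarrow> 0\<close>, and at \<open>\<rho> = 1\<close> it contains the derivative of the curve.\<close>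
lemma V_derivative_at_1:
  assumes t: "t \<in> {a..b}"
  shows "V 1 t / 2 + complex_of_real t * W 1 t = \<i> * E 1 t"
proof -
  define S where "S = complex_of_real (sqrt t * dlam t)"
  \<comment> \<open>The value \<open>2 * \<i>\<close> is the limit of \<open>V\<close> at \<rho> =
    0; it makes \<open>Z\<close> continuous on the closed interval.\<close>
  define Vx where "Vx \<rho> = (if \<rho> = 0 then 2 * \<i> else V \<rho> t)" for \<rho>
  define Y where "Y \<rho> = integral {0..\<rho>} (\<lambda>r. complex_of_real (r ^ 2) * F r t)" for \<rho>
  \<comment> \<open>This is \<open>sqrt t\<close> times the derivative of the flow at fixed
    \<open>t * (1 - \<rho>\<^sup>2)\<close>, multiplied by \<open>\<rho> * exp (- J)\<close>, after
    \<open>d\<close> has been eliminated by \<open>rho_sq_d\<close>; note that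
    \<open>Y \<rho>\<close> is \<open>\<rho> ^ 3 * Av 2 F \<rho> t\<close>.\<close>
  define Z where "Z \<rho> = (complex_of_real \<rho> * ((xi t \<rho> - N t \<rho>) / 2 + S) - 2 * complex_of_real (1 - \<rho>\<^sup>2) * inverse (Vx \<rho>)) * exp (- J t t \<rho>)
      + complex_of_real t * Y \<rho>" for \<rho>
  have bF: "base F" by (rule zcls_base[OF zcls_F])
  obtain B where B: "B > 0" "\<And>\<rho> t. \<rho> \<in> {0<..1} \<Longrightarrow> t \<in> {a..b} \<Longrightarrow> norm (F \<rho> t) \<le> B"
    using base_bound[OF bF] by metis
  have iF: "(\<lambda>r. complex_of_real (r ^ 2) * F r t) integrable_on {0..1}"
    by (rule radial_integrable[OF baseD[OF bF t] B(2)[OF _ t]]) auto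
  have Vx0: "continuous (at 0 within {0..1}) Vx"
    unfolding continuous_within
  proof (rule LIM_zero_cancel)
    have "((\<lambda>\<rho>. C * sqrt b * \<rho> / 2) \<longlongrightarrow> C * sqrt b * 0 / 2) (at 0 within {0..1})"
      by (intro tendsto_intros) auto
    then show "((\<lambda>\<rho>. Vx \<rho> - Vx 0) \<longlongrightarrow> 0) (at 0 within {0..1})"
    proof (rule Lim_null_comparison[rotated, OF tendsto_eq_rhs])
      show "\<forall>\<^sub>F \<rho> in at 0 within {0..1}. norm (Vx \<rho> - Vx 0) \<le> C * sqrt b * \<rho> / 2"
        unfolding eventually_at_filter
        by (rule always_eventually) (use V_minus_2i[OF _ t] in \<open>auto simp: Vx_def\<close>)
    qed simp
  qed
  have cVx: "continuous_on {0..1} Vx"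
    unfolding continuous_on_eq_continuous_within
  proof
    fix \<rho> :: real assume \<rho>: "\<rho> \<in> {0..1}"
    show "continuous (at \<rho> within {0..1}) Vx"
    proof (cases "\<rho> = 0")
      case False
      then have \<rho>0: "0 < \<rho>" "\<rho> \<in> {0<..1}" using \<rho> by auto
      have "continuous (at \<rho> within {0<..1}) (\<lambda>\<rho>. V \<rho> t)"
        using baseD[OF base_V t] \<rho>0 by (simp add: continuous_on_eq_continuous_within)
      then have "continuous (at \<rho> within {0<..1}) Vx"
        by (rule continuous_transform_within[of _ _ _ 1]) (use \<rho>0 in \<open>auto simp: Vx_def\<close>)
      moreover have "at \<rho> within {0<..1} = at \<rho> within {0..1}"
        by (rule at_within_nhd[of _ "{0<..}"]) (use \<rho>0 in auto)
      ultimately show ?thesis by simp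
    qed (use Vx0 in simp)
  qed
  have Vxnz: "Vx \<rho> \<noteq> 0" if "\<rho> \<in> {0..1}" for \<rho>
    using that V_bounds(4)[of \<rho> t] t by (auto simp: Vx_def)
  have "((\<lambda>\<rho>::real. 0) has_integral Z 1 - Z 0) {0..1}"
  proof (rule fundamental_theorem_of_calculus_interior)
    show "continuous_on {0..1} Z" unfolding Z_def Y_def
      by (intro continuous_intros xi_continuous N_continuous J_continuous cVx t indefinite_integral_continuous_1 iF) (use Vxnz in auto)
    fix r :: real assume "r \<in> {0<..<1}"
    then have r: "0 < r" "r < 1" "r \<in> {0<..1}" by auto
    let ?e = "exp (- J t t r)" and ?x = "xi t r" and ?r = "complex_of_real r" and ?V = "V r t"
    let ?x' = "complex_of_real (2 * r) * (- 2 / ?x + \<mu> r t)" and ?N' = "complex_of_real (2 * r) * \<mu> r t"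
    have nz: "?V \<noteq> 0" "?r \<noteq> 0" "?x \<noteq> 0" using V_bounds(4)[OF r(3) t] r by (auto simp: xi_V[OF r(3)])
    have id: "((\<lambda>r. complex_of_real r) has_vector_derivative 1) (at r)"
      by (auto intro!: derivative_eq_intros)
    have sq: "((\<lambda>r. complex_of_real (1 - r\<^sup>2)) has_vector_derivative complex_of_real (- (2 * r))) (at r)"
      by (rule has_vector_derivative_of_real) (auto intro!: derivative_eq_intros)
    have inv: "((\<lambda>r. inverse (xi t r)) has_vector_derivative ?x' * - (inverse ?x * inverse ?x)) (at r)"
      using field_vector_diff_chain_at[OF xi_deriv[OF t r(1,2)] DERIV_inverse[OF nz(3)]] nz
      by (simp add: o_def power2_eq_square)
    have Y': "(Y has_vector_derivative complex_of_real (r ^ 2) * F r t) (at r)"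
      unfolding Y_def
      by (rule indefinite_integral_deriv[OF _ iF r(1,2)]) (intro continuous_intros baseD[OF bF t])
    let ?R = "(?x - N t r) / 2 + S - 2 * (complex_of_real (1 - r\<^sup>2) * inverse ?x)"
    let ?R' = "(?x' - ?N') / 2 + 0 - 2 * (complex_of_real (1 - r\<^sup>2) * (?x' * - (inverse ?x * inverse ?x)) + complex_of_real (- (2 * r)) * inverse ?x)"
    have R: "((\<lambda>r. (xi t r - N t r) / 2 + S - 2 * (complex_of_real (1 - r\<^sup>2) * inverse (xi t r))) has_vector_derivative ?R') (at r)"
      by (intro has_vector_derivative_diff has_vector_derivative_add has_vector_derivative_divide has_vector_derivative_mult_right
        has_vector_derivative_mult has_vector_derivative_const xi_deriv N_deriv inv sq t r(1,2))
    have Z': "((\<lambda>r. complex_of_real r * ((xi t r - N t r) / 2 + S - 2 * (complex_of_real (1 - r\<^sup>2) * inverse (xi t r))) * exp (- J t t r) + complex_of_real t * Y r)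
       has_vector_derivative ((?r * ?R) * (- x12 t t r * ?e) + (?r * ?R' + 1 * ?R) * ?e) + complex_of_real t * (complex_of_real (r ^ 2) * F r t)) (at r)"
      by (intro has_vector_derivative_add has_vector_derivative_mult has_vector_derivative_mult_right id R exp_minus_J_deriv Y' t r(1,2))
    have rx: "?r * x12 t t r = (4 + ?V * ?V) / (?V * ?V)"
      unfolding x12_def using nz by simp
    have Ft: "complex_of_real t * (complex_of_real (r ^ 2) * F r t)
        = (S - complex_of_real (1 - r\<^sup>2) * \<mu> r t - N t r / 2) * 4 / (?V * ?V) * ?e"
    proof -
      have "complex_of_real t * (complex_of_real (r ^ 2) * F r t) = (complex_of_real (t * r\<^sup>2) * d r t) * 4 / (?V * ?V) * ?e"
        unfolding F_def exp_J(2)[OF r(3) t] using nz by (simp add: field_simps)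
      then show ?thesis unfolding rho_sq_d[OF r(3) t] S_def .
    qed
    have rR': "?r * ?R' = (2 * ?x + 4 * complex_of_real (1 - r\<^sup>2) * (- 2 / ?x + \<mu> r t)) / (?V * ?V)"
      unfolding xi_V[OF r(3)] using nz by (simp add: field_simps)
    have combine: "(- p * ((4 + v) / v) + m / v + p + s * 4 / v) * e = (- 4 * p + m + s * 4) / v * e" if "v \<noteq> 0" for p v m s e :: complex
      using that by (simp add: field_simps)
    have rearrange: "((z * p) * (- x * e) + (z * p' + 1 * p) * e) + y = (- p * (z * x) + z * p' + p) * e + y" for z p p' x e y :: complex
      by (simp add: algebra_simps)
    have "((?r * ?R) * (- x12 t t r * ?e) + (?r * ?R' + 1 * ?R) * ?e) + complex_of_real t * (complex_of_real (r ^ 2) * F r t)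
      = (- ?R * (?r * x12 t t r) + ?r * ?R' + ?R) * ?e + complex_of_real t * (complex_of_real (r ^ 2) * F r t)"
      by (rule rearrange)
    also have "\<dots> = (- ?R * ((4 + ?V * ?V) / (?V * ?V)) + (2 * ?x + 4 * complex_of_real (1 - r\<^sup>2) * (- 2 / ?x + \<mu> r t)) / (?V * ?V) + ?R
        + (S - complex_of_real (1 - r\<^sup>2) * \<mu> r t - N t r / 2) * 4 / (?V * ?V)) * ?e"
      unfolding rx rR' Ft by (simp only: distrib_right)
    also have "\<dots> = (- 4 * ?R + (2 * ?x + 4 * complex_of_real (1 - r\<^sup>2) * (- 2 / ?x + \<mu> r t))
        + (S - complex_of_real (1 - r\<^sup>2) * \<mu> r t - N t r / 2) * 4) / (?V * ?V) * ?e"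
      by (rule combine) (use nz(1) in simp)
    also have "- 4 * ?R + (2 * ?x + 4 * complex_of_real (1 - r\<^sup>2) * (- 2 / ?x + \<mu> r t))
        + (S - complex_of_real (1 - r\<^sup>2) * \<mu> r t - N t r / 2) * 4 = 0"
      using nz(3) by (simp add: field_simps)
    finally have 0: "((?r * ?R) * (- x12 t t r * ?e) + (?r * ?R' + 1 * ?R) * ?e) + complex_of_real t * (complex_of_real (r ^ 2) * F r t) = 0"
      by simp
    show "(Z has_vector_derivative 0) (at r)"
    proof (rule has_vector_derivative_transform_within_open[OF Z'[unfolded 0], of "{0<..<1}"])
      fix u :: real assume "u \<in> {0<..<1}"
      then have u: "u \<in> {0<..1}" "u \<noteq> 0" by auto
      show "complex_of_real u * ((xi t u - N t u) / 2 + S - 2 * (complex_of_real (1 - u\<^sup>2) * inverse (xi t u))) * exp (- J t t u) + complex_of_real t * Y u = Z u"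
        unfolding Z_def Vx_def using u V_bounds(4)[OF u(1) t]
        by (simp add: xi_V[OF u(1)] field_simps)
    qed (use r in auto)
  qed simp
  then have "Z 1 = Z 0" using has_integral_unique[OF has_integral_0] by force
  \<comment> \<open>Only the singular term survives at 0, with value
    \<open>- 2 / (2 * \<i>)\<close>.\<close>
  moreover have "Z 0 = \<i>"
    using xi_0[OF t] by (simp add: Z_def Vx_def Y_def J_def N_def field_simps)
  moreover have "Y 1 = Av 2 F 1 t" by (simp add: Y_def Av_def radial_mean_def)
  moreover have J1: "E 1 t * exp (- J t t 1) = 1"
    using exp_J(1)[of 1 t] t by (simp flip: exp_add)
  ultimately have "E 1 t * (((xi t 1 - N t 1) / 2 + S) * exp (- J t t 1) + complex_of_real t * Av 2 F 1 t) = E 1 t * \<i>"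
    by (simp add: Z_def)
  then have "((xi t 1 - N t 1) / 2 + S) * (E 1 t * exp (- J t t 1)) + complex_of_real t * (E 1 t * Av 2 F 1 t) = \<i> * E 1 t"
    by (simp add: algebra_simps)
  then have 1: "(xi t 1 - N t 1) / 2 + S + complex_of_real t * (E 1 t * Av 2 F 1 t) = \<i> * E 1 t"
    unfolding J1 by simp
  have 2: "complex_of_real t * d 1 t = S - N t 1 / 2"
    using rho_sq_d[of 1 t] t by (simp add: S_def)
  have "V 1 t / 2 + complex_of_real t * W 1 t = xi t 1 / 2 + complex_of_real t * d 1 t + complex_of_real t * (E 1 t * Av 2 F 1 t)"
    by (simp add: W_def V_def algebra_simps)
  also have "\<dots> = \<i> * E 1 t" unfolding 2 1[symmetric] by (simp add: algebra_simps diff_divide_distrib)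
  finally show ?thesis .
qed

definition tip :: "real \<Rightarrow> complex" where
  "tip t = complex_of_real (lam 0) + w t t"

definition tip' :: "real \<Rightarrow> complex" where
  "tip' t = \<i> * (complex_of_real (t powr (-1/2)) * E 1 t)"

lemma of_real_powr_deriv:
  assumes "t \<in> {a..b}"
  shows "((\<lambda>t. complex_of_real (t powr p)) has_vector_derivative complex_of_real (p * t powr (p - 1))) (at t within {a..b})"
  by (rule has_vector_derivative_of_real) (use tpos[OF assms] in \<open>auto intro!: derivative_eq_intros\<close>)

text \<open>The product rule for \<open>sqrt t * V 1 t\<close> produces
  \<open>V 1 t / 2 + t * W 1 t\<close>, which \<open>V_derivative_at_1\<close> evaluates. This
  trades \<open>W\<close>, of class \<open>k\<close>, for \<open>E\<close>, of class
  \<open>Suc k\<close>, and so allows a second differentiation.\<close>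

lemma tip_deriv:
  assumes t: "t \<in> {a..b}"
  shows "(tip has_vector_derivative tip' t) (at t within {a..b})"
proof -
  have t0: "t > 0" by (rule tpos[OF t])
  have one: "(1::real) \<in> {0<..1}" by simp
  have "((\<lambda>t. complex_of_real (lam 0) + complex_of_real (t powr (1/2)) * V 1 t) has_vector_derivative
      (0 + (complex_of_real (t powr (1/2)) * (complex_of_real 1 * W 1 t) + complex_of_real (1/2 * t powr (1/2 - 1)) * V 1 t))) (at t within {a..b})"
    by (intro has_vector_derivative_add has_vector_derivative_const has_vector_derivative_mult of_real_powr_deriv[OF t] tderD[OF tder_V one t])
  moreover have "0 + (complex_of_real (t powr (1/2)) * (complex_of_real 1 * W 1 t) + complex_of_real (1/2 * t powr (1/2 - 1)) * V 1 t)
     = complex_of_real (t powr (-1/2)) * (V 1 t / 2 + complex_of_real t * W 1 t)"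
  proof -
    have "t powr (1/2) = t powr (-1/2) * t" using t0 powr_add[of t "-1/2" 1] by simp
    then show ?thesis by (simp add: algebra_simps)
  qed
  moreover have "complex_of_real (t powr (-1/2)) * (V 1 t / 2 + complex_of_real t * W 1 t) = tip' t"
    unfolding V_derivative_at_1[OF t] tip'_def by (simp add: mult_ac)
  ultimately have "((\<lambda>t. complex_of_real (lam 0) + complex_of_real (t powr (1/2)) * V 1 t) has_vector_derivative tip' t) (at t within {a..b})"
    by simp
  then show ?thesis
  proof (rule has_vector_derivative_transform[OF t, rotated])
    fix u assume u: "u \<in> {a..b}"
    show "tip u = complex_of_real (lam 0) + complex_of_real (u powr (1/2)) * V 1 u"
      using w_V[OF one u] tpos[OF u] by (simp add: tip_def powr_half_sqrt)
  qed
qed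

text \<open>Differentiating the exponential of the integral of \<open>X\<close> gives an integral of
  \<open>Xt\<close> again, the form in which the gain can be used. The summand free of \<rho> is put
  under the integral as well.\<close>

lemma tip_second_derivative:
  obtains a2 where "zcls k a2"
    "\<And>t. t \<in> {a..b} \<Longrightarrow> (tip' has_vector_derivative integral {0..1} (\<lambda>\<rho>. a2 \<rho> t)) (at t within {a..b})"
proof -
  let ?q = "\<lambda>t. \<i> * complex_of_real (t powr (-1/2))"
  let ?q' = "\<lambda>t. (\<i> * complex_of_real (-1/2)) * complex_of_real (t powr (-3/2))"
  define a2 where "a2 \<rho> t = (\<i> * (complex_of_real (t powr (-1/2)) * E 1 t)) * Xt \<rho> t
     + (\<i> * complex_of_real (-1/2)) * (complex_of_real (t powr (-3/2)) * E 1 t)" for \<rho> t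
  have cE1: "cls (Suc k) (\<lambda>\<rho> t. E 1 t)" by (rule cls_at_1[OF cls_E[OF cls_V order_refl]])
  have z: "zcls k a2" unfolding a2_def
    by (rule zcls_add[OF zcls_mult[OF cls_cmult[OF cls_mult[OF cls_powr cE1]] zcls_Xt] cls_imp_zcls[OF cls_cmult[OF cls_mult[OF cls_powr cE1]]]])
  have "(tip' has_vector_derivative integral {0..1} (\<lambda>\<rho>. a2 \<rho> t)) (at t within {a..b})" if t: "t \<in> {a..b}" for t
  proof -
    have cX: "cls k X" by (rule cls_Suc[OF cls_X[OF cls_V order_refl]])
    have cXt: "cls k Xt" by (rule zcls_imp_cls[OF zcls_Xt])
    have 1: "((\<lambda>t. integral {0..1} (\<lambda>\<rho>. X \<rho> t)) has_vector_derivative integral {0..1} (\<lambda>\<rho>. Xt \<rho> t)) (at t within {a..b})"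
      by (rule tder_integral[OF tder_X cls_base[OF cX] cXt t])
    have E1: "E 1 = (\<lambda>t. exp (integral {0..1} (\<lambda>\<rho>. X \<rho> t)))"
      by (rule ext) (simp add: E_def Av_def radial_mean_def)
    have "(E 1 has_vector_derivative integral {0..1} (\<lambda>\<rho>. Xt \<rho> t) * E 1 t) (at t within {a..b})"
      using field_vector_diff_chain_within[OF 1 has_field_derivative_at_within[OF DERIV_exp]]
      unfolding E1 o_def .
    from has_vector_derivative_mult_right[OF has_vector_derivative_mult[OF of_real_powr_deriv[OF t, of "-1/2"] this], of \<i>]
    have 2: "(tip' has_vector_derivative \<i> * (complex_of_real (t powr (-1/2)) * (integral {0..1} (\<lambda>\<rho>. Xt \<rho> t) * E 1 t)
       + complex_of_real (-1/2 * t powr (-3/2)) * E 1 t)) (at t within {a..b})"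
      unfolding tip'_def[abs_def] by simp
    have iX: "(\<lambda>\<rho>. Xt \<rho> t) integrable_on {0..1}"
    proof -
      obtain B where B: "B > 0" "\<And>\<rho> t. \<rho> \<in> {0<..1} \<Longrightarrow> t \<in> {a..b} \<Longrightarrow> norm (Xt \<rho> t) \<le> B"
        using base_bound[OF cls_base[OF cXt]] by metis
      show ?thesis
        by (rule integrable_on_bounded_half_open[OF baseD[OF cls_base[OF cXt] t] B(2)[OF _ t]]) auto
    qed
    have "integral {0..1} (\<lambda>\<rho>. a2 \<rho> t) = (\<i> * (complex_of_real (t powr (-1/2)) * E 1 t)) * integral {0..1} (\<lambda>\<rho>. Xt \<rho> t)
       + (\<i> * complex_of_real (-1/2)) * (complex_of_real (t powr (-3/2)) * E 1 t)"
      unfolding a2_def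
      by (subst integral_add) (auto intro!: integrable_on_mult_right iX)
    also have "\<dots> = \<i> * (complex_of_real (t powr (-1/2)) * (integral {0..1} (\<lambda>\<rho>. Xt \<rho> t) * E 1 t)
       + complex_of_real (-1/2 * t powr (-3/2)) * E 1 t)"
      by (simp add: algebra_simps)
    finally show ?thesis using 2 by (simp only:)
  qed
  with z show thesis by (rule that)
qed

end

section \<open>The hull is the curve of tips\<close>

text \<open>The solutions may meet \<open>lam\<close> at the final time \<tau>, where the equation
  is singular. Up to any earlier \<sigma> the coefficient of the difference is bounded and Gronwall
  applies; continuity closes the gap.\<close>

lemma forward_flow_unique:
  fixes h1 h2 :: "real \<Rightarrow> complex" and lam :: "real \<Rightarrow> real"
  assumes \<tau>: "0 < \<tau>" and lam: "continuous_on {0..\<tau>} lam"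
    and c: "continuous_on {0..\<tau>} h1" "continuous_on {0..\<tau>} h2"
    and d1: "\<And>u. u \<in> {0<..<\<tau>} \<Longrightarrow> (h1 has_vector_derivative 2 / (h1 u - complex_of_real (lam u))) (at u)"
    and d2: "\<And>u. u \<in> {0<..<\<tau>} \<Longrightarrow> (h2 has_vector_derivative 2 / (h2 u - complex_of_real (lam u))) (at u)"
    and nz: "\<And>u. u \<in> {0..<\<tau>} \<Longrightarrow> h1 u \<noteq> complex_of_real (lam u)" "\<And>u. u \<in> {0..<\<tau>} \<Longrightarrow> h2 u \<noteq> complex_of_real (lam u)"
    and init: "h1 0 = h2 0"
  shows "h1 \<tau> = h2 \<tau>"
proof -
  define D where "D u = h1 u - h2 u" for u
  have D0: "D \<sigma> = 0" if \<sigma>: "\<sigma> \<in> {0..<\<tau>}" for \<sigma>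
  proof -
    define q where "q u = - 2 / ((h1 u - complex_of_real (lam u)) * (h2 u - complex_of_real (lam u)))" for u
    have "continuous_on {0..\<sigma>} q" unfolding q_def
      by (intro continuous_intros continuous_on_subset[OF c(1)] continuous_on_subset[OF c(2)] continuous_on_subset[OF lam])
        (use \<sigma> nz in auto)
    then have "compact (q ` {0..\<sigma>})" by (rule compact_continuous_image) simp
    then have "bounded (q ` {0..\<sigma>})" by (rule compact_imp_bounded)
    then obtain K where "\<forall>x\<in>q ` {0..\<sigma>}. norm x \<le> K" unfolding bounded_iff by blast
    then have K: "norm (q u) \<le> K" if "u \<in> {0..\<sigma>}" for u using that by simp
    have "(norm (D \<sigma>))\<^sup>2 \<le> exp (2 * K * \<sigma> - 2 * K * 0) * (norm (D 0))\<^sup>2"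
    proof (rule linear_ode_growth[where q = q and k' = "\<lambda>u. 2 * K"])
      show "continuous_on {0..\<sigma>} D" unfolding D_def
        by (intro continuous_intros continuous_on_subset[OF c(1)] continuous_on_subset[OF c(2)]) (use \<sigma> in auto)
      fix u assume u: "0 < u" "u < \<sigma>"
      then have u': "u \<in> {0<..<\<tau>}" "u \<in> {0..<\<tau>}" "u \<in> {0..\<sigma>}" using \<sigma> by auto
      have "(D has_vector_derivative (2 / (h1 u - complex_of_real (lam u)) - 2 / (h2 u - complex_of_real (lam u)))) (at u)"
        unfolding D_def by (intro has_vector_derivative_diff d1 d2 u')
      moreover have "2 / (h1 u - complex_of_real (lam u)) - 2 / (h2 u - complex_of_real (lam u)) = q u * D u"
      proof -
        have "2 / x - 2 / y = - 2 / (x * y) * (x - y)" if "x \<noteq> 0" "y \<noteq> 0" for x y :: complex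
          using that by (simp add: field_simps)
        from this[of "h1 u - complex_of_real (lam u)" "h2 u - complex_of_real (lam u)"]
        show ?thesis using nz(1)[OF u'(2)] nz(2)[OF u'(2)] by (simp add: q_def D_def)
      qed
      ultimately show "(D has_vector_derivative q u * D u) (at u)" by simp
      show "2 * Re (q u) \<le> 2 * K" using K[OF u'(3)] complex_Re_le_cmod[of "q u"] by linarith
    qed (use \<sigma> in \<open>auto intro!: continuous_intros derivative_eq_intros\<close>)
    then show ?thesis using init by (simp add: D_def)
  qed
  have "D \<tau> = 0"
  proof (rule continuous_constant_on_closure[of "{0..<\<tau>}" D 0])
    show "continuous_on (closure {0..<\<tau>}) D" using \<tau> unfolding D_def by (simp add: continuous_intros c)
    show "\<tau> \<in> closure {0..<\<tau>}" using \<tau> by simp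
  qed (rule D0)
  then show ?thesis by (simp add: D_def)
qed

section \<open>Flow lines through the tips\<close>

locale loewner_flow =
  fixes T L c C :: real and lam dlam :: "real \<Rightarrow> real" and w :: "real \<Rightarrow> real \<Rightarrow> complex"
  assumes T: "0 < T" and L: "0 \<le> L" and cC: "0 < c" "0 < C"
    and lam: "\<And>t. t \<in> {0..T} \<Longrightarrow> (lam has_real_derivative dlam t) (at t within {0..T})"
    and dlam: "\<And>t. t \<in> {0..T} \<Longrightarrow> \<bar>dlam t\<bar> \<le> L"
    and w_cont: "\<And>t. t \<in> {0<..T} \<Longrightarrow> continuous_on {0..t} (w t)"
    and w_0: "\<And>t. t \<in> {0<..T} \<Longrightarrow> w t 0 = 0"
    and w_deriv: "\<And>t s. t \<in> {0<..T} \<Longrightarrow> s \<in> {0<..<t} \<Longrightarrow>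
      (w t has_vector_derivative (- 2 / w t s + complex_of_real (dlam (t - s)))) (at s)"
    and w_Im: "\<And>t s. t \<in> {0<..T} \<Longrightarrow> s \<in> {0..t} \<Longrightarrow> c * sqrt s \<le> Im (w t s)"
    and w_norm: "\<And>t s. t \<in> {0<..T} \<Longrightarrow> s \<in> {0..t} \<Longrightarrow> norm (w t s) \<le> C * sqrt s"
begin

definition tip :: "real \<Rightarrow> complex" where
  "tip t = complex_of_real (lam 0) + w t t"

text \<open>The backward flow read forward in time: the flow line that starts at
  \<open>tip t\<close> and meets \<open>lam\<close> exactly at time \<open>t\<close>.\<close>

definition F :: "real \<Rightarrow> real \<Rightarrow> complex" where
  "F t u = w t (t - u) + complex_of_real (lam u)"

lemma lam_cont: "continuous_on {0..T} lam"
  by (rule DERIV_continuous_on[OF lam])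

lemma lam_deriv: "0 < u \<Longrightarrow> u < T \<Longrightarrow> ((\<lambda>u. complex_of_real (lam u)) has_vector_derivative complex_of_real (dlam u)) (at u)"
  by (rule has_vector_derivative_of_real) (use lam[of u] in \<open>simp add: at_within_Icc_at\<close>)

lemma Im_w_pos:
  assumes "t \<in> {0<..T}" "s \<in> {0<..t}"
  shows "Im (w t s) > 0"
proof -
  have "0 < c * sqrt s" using cC assms by simp
  also have "\<dots> \<le> Im (w t s)" by (rule w_Im) (use assms in auto)
  finally show ?thesis .
qed

lemma F_cont: "t \<in> {0<..T} \<Longrightarrow> continuous_on {0..t} (F t)"
  unfolding F_def
  by (intro continuous_intros continuous_on_compose2[OF w_cont] continuous_on_subset[OF lam_cont]) auto

lemma F_deriv:
  assumes t: "t \<in> {0<..T}" and u: "u \<in> {0<..<t}"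
  shows "(F t has_vector_derivative 2 / (F t u - complex_of_real (lam u))) (at u)"
proof -
  have "((\<lambda>u. t - u) has_vector_derivative (- 1)) (at u)"
    by (auto intro!: derivative_eq_intros simp flip: has_real_derivative_iff_has_vector_derivative)
  from vector_diff_chain_at[OF this w_deriv[OF t, of "t - u"]] u
  have "((\<lambda>u. w t (t - u)) has_vector_derivative (- 1) *\<^sub>R (- 2 / w t (t - u) + complex_of_real (dlam u))) (at u)"
    by (simp add: o_def)
  from has_vector_derivative_add[OF this lam_deriv[of u]] t u show ?thesis
    by (simp add: F_def[abs_def])
qed

lemma F_ne: "t \<in> {0<..T} \<Longrightarrow> u \<in> {0..<t} \<Longrightarrow> F t u \<noteq> complex_of_real (lam u)"
  using Im_w_pos[of t "t - u"] by (auto simp: F_def)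

lemma F_ends: "t \<in> {0<..T} \<Longrightarrow> F t t = complex_of_real (lam t)" "F t 0 = tip t"
  by (simp_all add: F_def tip_def w_0)

text \<open>The flow line determines the time at which it is swallowed: two lines with a common
  start agree up to the earlier time \<open>s\<close>, but only one of them has met
  \<open>lam\<close> by then.\<close>

lemma tip_inj:
  assumes "0 < s" "s < t" "t \<le> T"
  shows "tip s \<noteq> tip t"
proof
  assume eq: "tip s = tip t"
  have st: "s \<in> {0<..T}" "t \<in> {0<..T}" using assms by auto
  have "F s s = F t s"
  proof (rule forward_flow_unique[of s lam "F s" "F t"])
    show "continuous_on {0..s} (F t)" by (rule continuous_on_subset[OF F_cont[OF st(2)]]) (use assms in auto)
    show "continuous_on {0..s} lam" by (rule continuous_on_subset[OF lam_cont]) (use assms in auto)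
  qed (use assms st F_cont F_deriv F_ne F_ends eq in auto)
  with F_ends(1)[OF st(1)] F_ne[OF st(2), of s] assms show False by simp
qed

lemma tip_Im: "t \<in> {0<..T} \<Longrightarrow> Im (tip t) > 0"
  using Im_w_pos[of t t] by (simp add: tip_def)

text \<open>Any flow from \<open>tip \<tau>\<close> coincides with \<open>F \<tau>\<close> up to
  time \<tau> and therefore hits \<open>lam\<close> there.\<close>

lemma tip_in_hull:
  assumes \<tau>: "0 < \<tau>" "\<tau> \<le> t" "t \<le> T"
  shows "tip \<tau> \<in> loewner_hull lam t"
proof -
  have \<tau>T: "\<tau> \<in> {0<..T}" using \<tau> by auto
  have False if h: "h 0 = tip \<tau>" "\<And>s. s \<in> {0..t} \<Longrightarrow> h s \<noteq> complex_of_real (lam s)"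
     "\<And>s. s \<in> {0..t} \<Longrightarrow> (h has_vector_derivative (2 / (h s - complex_of_real (lam s)))) (at s within {0..t})" for h
  proof -
    have ch: "continuous_on {0..t} h" by (rule has_vector_derivative_imp_continuous_on[OF h(3)])
    have "h \<tau> = F \<tau> \<tau>"
    proof (rule forward_flow_unique[of \<tau> lam h "F \<tau>"])
      show "continuous_on {0..\<tau>} h" by (rule continuous_on_subset[OF ch]) (use \<tau> in auto)
      show "continuous_on {0..\<tau>} lam" by (rule continuous_on_subset[OF lam_cont]) (use \<tau> in auto)
      show "(h has_vector_derivative (2 / (h u - complex_of_real (lam u)))) (at u)" if "u \<in> {0<..<\<tau>}" for u
        by (rule has_vector_derivative_interior[OF h(3)]) (use that \<tau> in auto)
    qed (use \<tau> \<tau>T F_cont F_deriv F_ne F_ends h in auto)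
    with h(2)[of \<tau>] F_ends(1)[OF \<tau>T] \<tau> show False by simp
  qed
  then show ?thesis using tip_Im[OF \<tau>T]
    unfolding loewner_hull_def upper_half_plane_def by blast
qed

text \<open>Clipping keeps the flow alive for swallowed points too. As long as the decreasing
  imaginary part is at least \<open>y\<close>, it is the genuine flow.\<close>

lemma regularized_forward_flow:
  assumes t: "0 < t" "t \<le> T" and y: "0 < y"
  obtains h where "h 0 = z"
    "\<And>s. s \<in> {0..t} \<Longrightarrow> (h has_vector_derivative 2 / lift_Im y (h s - complex_of_real (lam s))) (at s within {0..t})"
    "\<And>r s. 0 \<le> r \<Longrightarrow> r \<le> s \<Longrightarrow> s \<le> t \<Longrightarrow> Im (h s) \<le> Im (h r)"
proof -
  have nz: "lift_Im y x \<noteq> 0" for x using norm_lift_Im_ge[OF y, of x] y by auto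
  obtain h where h0: "h 0 = z" and
    hd: "\<And>s. s \<in> {0..t} \<Longrightarrow> (h has_vector_derivative 2 / lift_Im y (h s - complex_of_real (lam s))) (at s within {0..t})"
  proof (rule global_picard[of t "\<lambda>s x. 2 / lift_Im y (x - complex_of_real (lam s))" "2 / y\<^sup>2" z])
    show "continuous_on ({0..t} \<times> UNIV) (\<lambda>(s, x). 2 / lift_Im y (x - complex_of_real (lam s)))"
      unfolding case_prod_beta
      by (intro continuous_intros continuous_on_compose2[OF lam_cont]) (use nz t in auto)
    show "norm (2 / lift_Im y (p - complex_of_real (lam s)) - 2 / lift_Im y (q - complex_of_real (lam s))) \<le> 2 / y\<^sup>2 * norm (p - q)" for s p q
      using inverse_lift_Im_lipschitz[OF y, of 2 "p - complex_of_real (lam s)" "q - complex_of_real (lam s)"] by simp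
  qed (use t in auto)
  have mono: "Im (h s) \<le> Im (h r)" if rs: "0 \<le> r" "r \<le> s" "s \<le> t" for r s
  proof (rule DERIV_nonpos_imp_decreasing_open[OF \<open>r \<le> s\<close>])
    show "continuous_on {r..s} (\<lambda>s. Im (h s))"
      by (intro continuous_intros continuous_on_subset[OF has_vector_derivative_imp_continuous_on[OF hd]])
        (use rs in auto)
    fix x assume x: "r < x" "x < s"
    have "((\<lambda>x. Im (h x)) has_vector_derivative Im (2 / lift_Im y (h x - complex_of_real (lam x)))) (at x)"
      by (rule has_vector_derivative_Im, rule has_vector_derivative_interior[OF hd]) (use x rs in auto)
    moreover have "Im (2 / lift_Im y (h x - complex_of_real (lam x))) \<le> 0"
      using y by (simp add: Im_divide divide_le_0_iff)
    ultimately show "\<exists>d. ((\<lambda>x. Im (h x)) has_real_derivative d) (at x) \<and> d \<le> 0"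
      by (auto simp: has_real_derivative_iff_has_vector_derivative)
  qed
  show thesis
  proof (rule that[of h])
    show "h 0 = z" by (rule h0)
    show "\<And>s. s \<in> {0..t} \<Longrightarrow> (h has_vector_derivative 2 / lift_Im y (h s - complex_of_real (lam s))) (at s within {0..t})" by (rule hd)
    show "\<And>r s. 0 \<le> r \<Longrightarrow> r \<le> s \<Longrightarrow> s \<le> t \<Longrightarrow> Im (h s) \<le> Im (h r)" by (rule mono)
  qed
qed

text \<open>Gronwall for the difference of squares: dividing by \<open>w\<^sub>1 + w\<^sub>2\<close>, whose imaginary part is at least
  \<open>c * sqrt s\<close>, costs only an integrable weight, whatever the initial value of \<open>w\<^sub>1\<close>.\<close>
lemma compare_with_tip:
  assumes \<sigma>: "\<sigma> \<in> {0<..T}" and cv: "continuous_on {0..\<sigma>} v"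
    and vd: "\<And>s. s \<in> {0<..<\<sigma>} \<Longrightarrow> (v has_vector_derivative (- 2 / v s + complex_of_real (dlam (\<sigma> - s)))) (at s)"
    and Imv: "\<And>s. s \<in> {0<..<\<sigma>} \<Longrightarrow> Im (v s) > 0"
  shows "(norm ((v \<sigma>)\<^sup>2 - (w \<sigma> \<sigma>)\<^sup>2))\<^sup>2 \<le> exp (8 * L / c * sqrt T) * (norm (v 0))^4"
proof -
  define D where "D s = (v s)\<^sup>2 - (w \<sigma> s)\<^sup>2" for s
  have "(norm (D \<sigma>))\<^sup>2 \<le> exp (8 * L / c * sqrt \<sigma> - 8 * L / c * sqrt 0) * (norm (D 0))\<^sup>2"
  proof (rule linear_ode_growth[where q = "\<lambda>s. 2 * complex_of_real (dlam (\<sigma> - s)) / (v s + w \<sigma> s)" and k' = "\<lambda>s. 4 * L / (c * sqrt s)"])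
    show "0 \<le> \<sigma>" using \<sigma> by simp
    show "continuous_on {0..\<sigma>} D" unfolding D_def by (intro continuous_intros cv w_cont \<sigma>)
    show "continuous_on {0..\<sigma>} (\<lambda>s. 8 * L / c * sqrt s)" by (intro continuous_intros)
    fix s assume s0: "0 < s" "s < \<sigma>"
    then have s: "s \<in> {0<..<\<sigma>}" "s \<in> {0<..\<sigma>}" "s \<in> {0..\<sigma>}" by auto
    let ?n = "complex_of_real (dlam (\<sigma> - s))"
    have nz: "v s \<noteq> 0" "w \<sigma> s \<noteq> 0" "v s + w \<sigma> s \<noteq> 0"
      using Imv[OF s(1)] Im_w_pos[OF \<sigma> s(2)] by (auto simp: complex_eq_iff)
    have "(D has_vector_derivative ((v s * (- 2 / v s + ?n) + (- 2 / v s + ?n) * v s) - (w \<sigma> s * (- 2 / w \<sigma> s + ?n) + (- 2 / w \<sigma> s + ?n) * w \<sigma> s))) (at s)"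
      unfolding D_def power2_eq_square by (intro has_vector_derivative_diff has_vector_derivative_mult vd w_deriv \<sigma> s)
    moreover have "(v s * (- 2 / v s + ?n) + (- 2 / v s + ?n) * v s) - (w \<sigma> s * (- 2 / w \<sigma> s + ?n) + (- 2 / w \<sigma> s + ?n) * w \<sigma> s)
      = 2 * ?n / (v s + w \<sigma> s) * D s"
    proof -
      have "2 * ?n / (v s + w \<sigma> s) * D s = 2 * ?n * (v s - w \<sigma> s)"
        using nz(3) by (simp add: D_def field_simps power2_eq_square)
      then show ?thesis using nz(1,2) by (simp add: algebra_simps)
    qed
    ultimately show "(D has_vector_derivative 2 * ?n / (v s + w \<sigma> s) * D s) (at s)" by simp
    show "((\<lambda>s. 8 * L / c * sqrt s) has_real_derivative 4 * L / (c * sqrt s)) (at s)"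
      using s0 cC by (auto intro!: derivative_eq_intros simp: field_simps)
    have cs: "c * sqrt s > 0" using cC s0 by simp
    have "c * sqrt s \<le> Im (v s + w \<sigma> s)" using Imv[OF s(1)] w_Im[OF \<sigma> s(3)] by simp
    then have "c * sqrt s \<le> norm (v s + w \<sigma> s)" using abs_Im_le_cmod[of "v s + w \<sigma> s"] by linarith
    then have "norm (2 * ?n / (v s + w \<sigma> s)) \<le> (2 * L) / (c * sqrt s)"
      unfolding norm_divide using dlam[of "\<sigma> - s"] \<sigma> s0 cs L
      by (intro frac_le) (auto simp: norm_mult)
    then show "2 * Re (2 * ?n / (v s + w \<sigma> s)) \<le> 4 * L / (c * sqrt s)"
      using complex_Re_le_cmod[of "2 * ?n / (v s + w \<sigma> s)"] by linarith
  qed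
  also have "\<dots> \<le> exp (8 * L / c * sqrt T) * (norm (D 0))\<^sup>2"
    using \<sigma> L cC by (intro mult_right_mono) (auto intro!: mult_left_mono divide_right_mono)
  also have "D 0 = (v 0)\<^sup>2" using w_0[OF \<sigma>] by (simp add: D_def)
  finally show ?thesis by (simp add: D_def norm_power)
qed

text \<open>The imaginary part decays at relative rate at most 2 over the squared distance to
  \<open>lam\<close>, so a line that sinks to the very low height \<open>y\<close> must come within
  \<open>e\<close> of \<open>lam\<close>. Reversed from the moment of closest approach, it is a
  backward flow with initial value below \<open>e\<close>, and \<open>compare_with_tip\<close>
  applies.\<close>

lemma near_tip:
  assumes t: "0 < t" "t \<le> T" and z: "z \<in> loewner_hull lam t" and e: "0 < e" "e \<le> Im z"
  shows "\<exists>\<sigma>\<in>{0<..t}. (norm ((z - complex_of_real (lam 0))\<^sup>2 - (w \<sigma> \<sigma>)\<^sup>2))\<^sup>2 \<le> exp (8 * L / c * sqrt T) * e ^ 4"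
proof -
  have Imz: "Im z > 0" using e by simp
  \<comment> \<open>Half of the height that would remain up to time \<open>T\<close> if the distance
    to \<open>lam\<close> never fell below \<open>e\<close>.\<close>
  define y where "y = Im z * exp (- 2 * T / e\<^sup>2) / 2"
  have y: "0 < y" using Imz by (simp add: y_def)
  have "exp (- 2 * T / e\<^sup>2) \<le> 1" using T by simp
  then have "Im z * exp (- 2 * T / e\<^sup>2) \<le> Im z * 1" using Imz by (intro mult_left_mono) auto
  then have yz: "y < Im z" unfolding y_def using Imz by linarith
  obtain h where h0: "h 0 = z"
    and hd: "\<And>s. s \<in> {0..t} \<Longrightarrow> (h has_vector_derivative 2 / lift_Im y (h s - complex_of_real (lam s))) (at s within {0..t})"
    and mono: "\<And>r s. 0 \<le> r \<Longrightarrow> r \<le> s \<Longrightarrow> s \<le> t \<Longrightarrow> Im (h s) \<le> Im (h r)"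
    using regularized_forward_flow[OF t y, of z] by metis
  have ch: "continuous_on {0..t} h" by (rule has_vector_derivative_imp_continuous_on[OF hd])
  \<comment> \<open>Otherwise the clipping never acts and \<open>z\<close> has a genuine flow on all
    of \<open>{0..t}\<close>, contrary to its membership in the hull.\<close>
  have "Im (h t) < y"
  proof (rule ccontr)
    assume "\<not> Im (h t) < y"
    then have hy: "y \<le> Im (h s)" if "s \<in> {0..t}" for s using mono[of s t] that by auto
    have "\<forall>s\<in>{0..t}. h s \<noteq> complex_of_real (lam s) \<and> (h has_vector_derivative (2 / (h s - complex_of_real (lam s)))) (at s within {0..t})"
    proof
      fix s assume s: "s \<in> {0..t}"
      then show "h s \<noteq> complex_of_real (lam s) \<and> (h has_vector_derivative (2 / (h s - complex_of_real (lam s)))) (at s within {0..t})"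
        using hy[OF s] y hd[OF s] lift_Im_eq[of y "h s - complex_of_real (lam s)"] by auto
    qed
    with z h0 show False unfolding loewner_hull_def by blast
  qed
  moreover have "continuous_on {0..t} (\<lambda>s. Im (h s))" by (intro continuous_intros ch)
  ultimately obtain \<tau> where \<tau>: "0 \<le> \<tau>" "\<tau> \<le> t" "Im (h \<tau>) = y"
    using IVT2'[of "\<lambda>s. Im (h s)" t y 0] yz h0 t by auto
  have hy: "y \<le> Im (h s)" if "s \<in> {0..\<tau>}" for s using mono[of s \<tau>] that \<tau> by auto
  have hd': "(h has_vector_derivative 2 / (h s - complex_of_real (lam s))) (at s)" if "s \<in> {0<..<\<tau>}" for s
  proof -
    have "(h has_vector_derivative 2 / lift_Im y (h s - complex_of_real (lam s))) (at s)"
      by (rule has_vector_derivative_interior[OF hd]) (use that \<tau> in auto)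
    then show ?thesis using hy[of s] that by (simp add: lift_Im_eq)
  qed
  have cG: "continuous_on {0..\<tau>} (\<lambda>s. norm (h s - complex_of_real (lam s)))"
    by (intro continuous_intros continuous_on_subset[OF ch] continuous_on_subset[OF lam_cont]) (use \<tau> t in auto)
  then obtain \<sigma> where \<sigma>: "\<sigma> \<in> {0..\<tau>}" and min: "\<And>s. s \<in> {0..\<tau>} \<Longrightarrow> norm (h \<sigma> - complex_of_real (lam \<sigma>)) \<le> norm (h s - complex_of_real (lam s))"
    using continuous_attains_inf[of "{0..\<tau>}" "\<lambda>s. norm (h s - complex_of_real (lam s))"] \<tau> by auto
  have small: "norm (h \<sigma> - complex_of_real (lam \<sigma>)) < e"
  proof (rule ccontr)
    assume "\<not> norm (h \<sigma> - complex_of_real (lam \<sigma>)) < e"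
    then have big: "e \<le> norm (h s - complex_of_real (lam s))" if "s \<in> {0..\<tau>}" for s using min[OF that] by linarith
    define \<phi> where "\<phi> s = Im (h s) * exp (2 / e\<^sup>2 * s)" for s
    have "\<phi> 0 \<le> \<phi> \<tau>"
    proof (rule DERIV_nonneg_imp_increasing_open[OF \<tau>(1)])
      show "continuous_on {0..\<tau>} \<phi>" unfolding \<phi>_def
        by (intro continuous_intros continuous_on_subset[OF ch]) (use \<tau> in auto)
      fix s assume s: "0 < s" "s < \<tau>"
      then have s': "s \<in> {0<..<\<tau>}" "s \<in> {0..\<tau>}" by auto
      let ?G = "h s - complex_of_real (lam s)"
      have "((\<lambda>s. Im (h s)) has_real_derivative Im (2 / ?G)) (at s)"
        using has_vector_derivative_Im[OF hd'[OF s'(1)]] by (simp add: has_real_derivative_iff_has_vector_derivative)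
      moreover have "((\<lambda>s. exp (\<kappa> * s)) has_real_derivative exp (\<kappa> * s) * \<kappa>) (at s)" for \<kappa>
        by (auto intro!: derivative_eq_intros)
      ultimately have "(\<phi> has_real_derivative Im (2 / ?G) * exp (2 / e\<^sup>2 * s) + exp (2 / e\<^sup>2 * s) * (2 / e\<^sup>2) * Im (h s)) (at s)"
        unfolding \<phi>_def by (rule DERIV_mult)
      moreover have "Im (2 / ?G) * exp (2 / e\<^sup>2 * s) + exp (2 / e\<^sup>2 * s) * (2 / e\<^sup>2) * Im (h s) \<ge> 0"
      proof -
        have n: "e\<^sup>2 \<le> (norm ?G)\<^sup>2" using big[OF s'(2)] e by (intro power_mono) auto
        have ie: "1 / (norm ?G)\<^sup>2 \<le> 1 / e\<^sup>2" using n e by (intro frac_le) auto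
        have "Im (2 / ?G) = - (2 * Im (h s) * (1 / (norm ?G)\<^sup>2))" by (simp add: Im_divide cmod_power2)
        moreover have "2 * Im (h s) * (1 / (norm ?G)\<^sup>2) \<le> 2 * Im (h s) * (1 / e\<^sup>2)"
          using ie hy[OF s'(2)] y by (intro mult_left_mono) auto
        ultimately have "Im (2 / ?G) + 2 / e\<^sup>2 * Im (h s) \<ge> 0" by simp
        then have "(Im (2 / ?G) + 2 / e\<^sup>2 * Im (h s)) * exp (2 / e\<^sup>2 * s) \<ge> 0" by (intro mult_nonneg_nonneg) auto
        then show ?thesis by (simp add: algebra_simps)
      qed
      ultimately show "\<exists>d. (\<phi> has_real_derivative d) (at s) \<and> 0 \<le> d" by blast
    qed
    then have "Im z \<le> y * exp (2 / e\<^sup>2 * \<tau>)" using h0 \<tau> by (simp add: \<phi>_def)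
    also have "\<dots> \<le> y * exp (2 / e\<^sup>2 * T)" using y \<tau> t by (intro mult_left_mono) (auto intro!: divide_right_mono)
    also have "\<dots> = Im z / 2" by (simp add: y_def exp_minus field_simps)
    finally show False using Imz by simp
  qed
  \<comment> \<open>At time 0 the distance to \<open>lam\<close> is at least
    \<open>Im z \<ge> e\<close>, so the reversed flow runs for a positive time.\<close>
  have \<sigma>0: "\<sigma> \<noteq> 0"
  proof
    assume "\<sigma> = 0"
    then have "norm (z - complex_of_real (lam 0)) < Im z" using small h0 e by simp
    then show False using abs_Im_le_cmod[of "z - complex_of_real (lam 0)"] by simp
  qed
  then have \<sigma>t: "\<sigma> \<in> {0<..t}" "\<sigma> \<in> {0<..T}" using \<sigma> \<tau> t by auto
  define v where "v s = h (\<sigma> - s) - complex_of_real (lam (\<sigma> - s))" for s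
  have cmp: "(norm ((v \<sigma>)\<^sup>2 - (w \<sigma> \<sigma>)\<^sup>2))\<^sup>2 \<le> exp (8 * L / c * sqrt T) * (norm (v 0))^4"
  proof (rule compare_with_tip[OF \<sigma>t(2)])
    show "continuous_on {0..\<sigma>} v" unfolding v_def
      by (intro continuous_intros continuous_on_compose2[OF ch] continuous_on_compose2[OF lam_cont]) (use \<sigma> \<tau> t in auto)
    fix s assume s: "s \<in> {0<..<\<sigma>}"
    let ?u = "\<sigma> - s"
    have u: "?u \<in> {0<..<\<tau>}" "?u \<in> {0..\<tau>}" "0 < ?u" "?u < T" using s \<sigma> \<tau> t by auto
    show "Im (v s) > 0" using hy[OF u(2)] y by (simp add: v_def)
    have 1: "((\<lambda>s. \<sigma> - s) has_vector_derivative (- 1)) (at s)"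
      by (auto intro!: derivative_eq_intros simp flip: has_real_derivative_iff_has_vector_derivative)
    have "((\<lambda>u. h u - complex_of_real (lam u)) has_vector_derivative (2 / (h ?u - complex_of_real (lam ?u)) - complex_of_real (dlam ?u))) (at ?u)"
      by (intro has_vector_derivative_diff hd' lam_deriv u)
    from vector_diff_chain_at[OF 1 this]
    show "(v has_vector_derivative (- 2 / v s + complex_of_real (dlam (\<sigma> - s)))) (at s)"
      by (simp add: v_def[abs_def] o_def)
  qed
  have v\<sigma>: "v \<sigma> = z - complex_of_real (lam 0)" by (simp add: v_def h0)
  have "norm (v 0) \<le> e" using small by (simp add: v_def)
  then have pw: "(norm (v 0))^4 \<le> e ^ 4" by (rule power_mono) simp
  have "exp (8 * L / c * sqrt T) * (norm (v 0))^4 \<le> exp (8 * L / c * sqrt T) * e ^ 4"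
    by (rule mult_left_mono[OF pw]) simp
  with cmp[unfolded v\<sigma>] have "(norm ((z - complex_of_real (lam 0))\<^sup>2 - (w \<sigma> \<sigma>)\<^sup>2))\<^sup>2 \<le> exp (8 * L / c * sqrt T) * e ^ 4"
    by (rule order_trans)
  with \<sigma>t(1) show ?thesis by blast
qed

end

section \<open>Identification of the hull and of the generating curve\<close>

text \<open>Differentiability of the tips serves twice: as continuity, for a compactness argument,
  and to make the set of tips a null set of the plane.\<close>

locale loewner_flow_diff = loewner_flow +
  assumes tip_differentiable: "\<And>t. t \<in> {0<..T} \<Longrightarrow> \<exists>D. (tip has_vector_derivative D) (at t within {0<..T})"
begin

lemma tip_continuous: "continuous_on {0<..T} tip"
  using tip_differentiable has_vector_derivative_continuous continuous_on_eq_continuous_within by blast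

text \<open>By \<open>near_tip\<close> the square of \<open>z - lam 0\<close> is a limit of squares
  of \<open>w \<sigma> \<sigma>\<close>. With the value 0 added at \<sigma> = 0 these squares form a
  compact set, so the limit is attained; the sign of the imaginary part selects the square
  root.\<close>

lemma hull_subset_tip:
  assumes t: "0 < t" "t \<le> T" and z: "z \<in> loewner_hull lam t"
  shows "z \<in> tip ` {0<..t}"
proof -
  have Imz: "Im z > 0" using z by (simp add: loewner_hull_def upper_half_plane_def)
  define p where "p \<sigma> = (if \<sigma> = 0 then 0 else w \<sigma> \<sigma>)" for \<sigma>
  have cp: "continuous_on {0..t} p"
    unfolding continuous_on_eq_continuous_within
  proof
    fix \<sigma> assume \<sigma>: "\<sigma> \<in> {0..t}"
    show "continuous (at \<sigma> within {0..t}) p"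
    proof (cases "\<sigma> = 0")
      case True
      have "((\<lambda>s. C * sqrt s) \<longlongrightarrow> C * sqrt 0) (at 0 within {0..t})" by (intro tendsto_intros)
      then have lim: "((\<lambda>s. C * sqrt s) \<longlongrightarrow> 0) (at 0 within {0..t})" by simp
      have "(p \<longlongrightarrow> 0) (at 0 within {0..t})"
      proof (rule Lim_null_comparison[OF _ lim])
        show "\<forall>\<^sub>F s in at 0 within {0..t}. norm (p s) \<le> C * sqrt s"
          unfolding eventually_at_filter
          by (rule always_eventually) (use w_norm t in \<open>auto simp: p_def\<close>)
      qed
      then show ?thesis unfolding True continuous_within by (simp add: p_def)
    next
      case False
      then have \<sigma>0: "0 < \<sigma>" "\<sigma> \<in> {0<..t}" using \<sigma> by auto
      have "continuous_on {0<..t} (\<lambda>\<sigma>. tip \<sigma> - complex_of_real (lam 0))"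
        by (intro continuous_intros continuous_on_subset[OF tip_continuous]) (use t in auto)
      then have "continuous (at \<sigma> within {0<..t}) (\<lambda>\<sigma>. tip \<sigma> - complex_of_real (lam 0))"
        using \<sigma>0 by (simp add: continuous_on_eq_continuous_within)
      then have "continuous (at \<sigma> within {0<..t}) p"
        by (rule continuous_transform_within[of _ _ _ 1]) (use \<sigma>0 in \<open>auto simp: p_def tip_def\<close>)
      moreover have "at \<sigma> within {0<..t} = at \<sigma> within {0..t}"
        by (rule at_within_nhd[of _ "{0<..}"]) (use \<sigma>0 in auto)
      ultimately show ?thesis by simp
    qed
  qed
  let ?S = "(\<lambda>\<sigma>. (p \<sigma>)\<^sup>2) ` {0..t}" and ?x = "(z - complex_of_real (lam 0))\<^sup>2"
  have "compact ?S" by (intro compact_continuous_image continuous_intros cp) simp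
  then have "closed ?S" by (rule compact_imp_closed)
  then have "(\<forall>e>0. \<exists>y\<in>?S. dist y ?x < e) \<longleftrightarrow> ?x \<in> ?S" by (rule closed_approachable)
  moreover have "\<exists>y\<in>?S. dist y ?x < d" if d: "d > 0" for d
  proof -
    define M where "M = exp (8 * L / c * sqrt T)"
    have M: "M > 0" by (simp add: M_def)
    \<comment> \<open>With \<open>e \<le> 1\<close> the error \<open>M * e ^ 4\<close> is at most
      \<open>M * e\<close>, hence at most \<open>d\<^sup>2 / 2\<close>.\<close>
    define e where "e = min (Im z) (min 1 (d\<^sup>2 / (2 * M)))"
    have e: "0 < e" "e \<le> Im z" "e \<le> 1" "e \<le> d\<^sup>2 / (2 * M)" using Imz d M by (auto simp: e_def)
    obtain \<sigma> where \<sigma>: "\<sigma> \<in> {0<..t}" "(norm (?x - (w \<sigma> \<sigma>)\<^sup>2))\<^sup>2 \<le> M * e ^ 4"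
      using near_tip[OF t z e(1,2)] unfolding M_def by blast
    have "e ^ 4 \<le> e ^ 1" using e by (intro power_decreasing) auto
    then have "M * e ^ 4 \<le> M * (d\<^sup>2 / (2 * M))" using e(4) M by (intro mult_left_mono) auto
    also have "\<dots> < d\<^sup>2" using d M by simp
    finally have "norm (?x - (w \<sigma> \<sigma>)\<^sup>2) < d" using \<sigma>(2) d by (intro power_less_imp_less_base[of _ 2 d]) auto
    then have "dist ((p \<sigma>)\<^sup>2) ?x < d" using \<sigma>(1) by (simp add: p_def dist_norm norm_minus_commute)
    then show ?thesis using \<sigma>(1) by (intro bexI[of _ "(p \<sigma>)\<^sup>2"]) auto
  qed
  ultimately have "?x \<in> ?S" by blast
  then obtain \<sigma> where \<sigma>: "\<sigma> \<in> {0..t}" "?x = (p \<sigma>)\<^sup>2" by blast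
  have "z - complex_of_real (lam 0) \<noteq> 0" using Imz by (auto simp: complex_eq_iff)
  then have "\<sigma> \<noteq> 0" using \<sigma>(2) by (auto simp: p_def)
  then have \<sigma>0: "\<sigma> \<in> {0<..t}" "\<sigma> \<in> {0<..T}" using \<sigma> t by auto
  have "z - complex_of_real (lam 0) = w \<sigma> \<sigma> \<or> z - complex_of_real (lam 0) = - w \<sigma> \<sigma>"
    using \<sigma>(2) \<sigma>0 by (simp add: p_def power2_eq_iff)
  moreover have "z - complex_of_real (lam 0) \<noteq> - w \<sigma> \<sigma>"
    using Imz Im_w_pos[OF \<sigma>0(2), of \<sigma>] \<sigma>0 by (auto simp: complex_eq_iff)
  ultimately have "z = tip \<sigma>" by (simp add: tip_def algebra_simps)
  with \<sigma>0 show ?thesis by blast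
qed

lemma hull_eq: "0 < t \<Longrightarrow> t \<le> T \<Longrightarrow> loewner_hull lam t = tip ` {0<..t}"
  using hull_subset_tip tip_in_hull by force

text \<open>The complement of the tips is a component of the complement of the curve. Hence in the
  open half-plane the curve runs through tips only, of index at most its own time; and it misses no
  tip because the tips have empty interior. Injectivity of the tips then fixes the
  parametrisation.\<close>

lemma generated_curve_eq_tip:
  assumes gen: "loewner_generates lam T \<gamma>" and t: "t \<in> {0<..T}"
  shows "\<gamma> t = tip t"
proof -
  let ?H = upper_half_plane
  have c\<gamma>: "continuous_on {0..T} \<gamma>" using gen by (simp add: loewner_generates_def)
  have comp: "\<exists>x. ?H - tip ` {0<..t} = connected_component_set (?H - \<gamma> ` {0<..t}) x" if "t \<in> {0<..T}" for t
  proof -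
    have "\<forall>t\<in>{0..T}. (\<exists>x. ?H - loewner_hull lam t = connected_component_set (?H - \<gamma> ` {0<..t}) x) \<and> \<not> bounded (?H - loewner_hull lam t)"
      using gen unfolding loewner_generates_def by (elim conjE)
    from bspec[OF this, of t] that
    have "\<exists>x. ?H - loewner_hull lam t = connected_component_set (?H - \<gamma> ` {0<..t}) x" by simp
    moreover have "loewner_hull lam t = tip ` {0<..t}" by (rule hull_eq) (use that in auto)
    ultimately show ?thesis by (simp only:)
  qed
  have sub: "\<gamma> ` {0<..t} \<inter> ?H \<subseteq> tip ` {0<..t}" if "t \<in> {0<..T}" for t
    using comp[OF that] connected_component_subset by blast
  \<comment> \<open>A start in the open half-plane is impossible: for small \<open>s\<close> the
    point \<open>\<gamma> s\<close> would be a tip of index at most \<open>s\<close>, of height at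
    most \<open>C * sqrt s\<close>.\<close>
  have \<gamma>0: "Im (\<gamma> 0) \<le> 0"
  proof (rule ccontr)
    assume "\<not> Im (\<gamma> 0) \<le> 0"
    then have \<eta>: "Im (\<gamma> 0) > 0" by simp
    have "((\<lambda>s. Im (\<gamma> s)) \<longlongrightarrow> Im (\<gamma> 0)) (at 0 within {0..T})"
    proof (rule tendsto_Im)
      show "(\<gamma> \<longlongrightarrow> \<gamma> 0) (at 0 within {0..T})"
        by (rule bspec[OF c\<gamma>[unfolded continuous_on_def]]) (use T in simp)
    qed
    then have "((\<lambda>s. Im (\<gamma> s) - C * sqrt s) \<longlongrightarrow> Im (\<gamma> 0) - C * sqrt 0) (at 0 within {0..T})"
      by (rule tendsto_diff[OF _ tendsto_mult_left[OF tendsto_real_sqrt[OF tendsto_ident_at]]])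
    then have "\<forall>\<^sub>F s in at 0 within {0..T}. Im (\<gamma> s) - C * sqrt s > 0"
      using \<eta> by (intro order_tendstoD(1)[of _ "Im (\<gamma> 0) - C * sqrt 0"]) auto
    then obtain \<delta> where \<delta>: "\<delta> > 0" "\<And>s. s \<in> {0..T} \<Longrightarrow> s \<noteq> 0 \<Longrightarrow> dist s 0 < \<delta> \<Longrightarrow> Im (\<gamma> s) - C * sqrt s > 0"
      unfolding eventually_at by blast
    define s where "s = min T (\<delta> / 2)"
    have s: "s \<in> {0<..T}" "dist s 0 < \<delta>" using T \<delta>(1) by (auto simp: s_def)
    have Im: "Im (\<gamma> s) > C * sqrt s" using \<delta>(2)[of s] s by auto
    moreover have "C * sqrt s \<ge> 0" using cC s by simp
    ultimately have "\<gamma> s \<in> \<gamma> ` {0<..s} \<inter> ?H" using s by (auto simp: upper_half_plane_def)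
    then obtain r where r: "r \<in> {0<..s}" "\<gamma> s = tip r" using sub[OF s(1)] by blast
    have "Im (tip r) \<le> norm (w r r)" using abs_Im_le_cmod[of "w r r"] by (simp add: tip_def)
    also have "\<dots> \<le> C * sqrt r" using w_norm[of r r] r s by auto
    also have "\<dots> \<le> C * sqrt s" using r cC by simp
    finally show False using Im r by simp
  qed
  have "tip t \<in> \<gamma> ` {0<..t}"
  proof (rule ccontr)
    assume no: "tip t \<notin> \<gamma> ` {0<..t}"
    obtain x where x: "?H - tip ` {0<..t} = connected_component_set (?H - \<gamma> ` {0<..t}) x" using comp[OF t] by blast
    have "compact (\<gamma> ` {0..t})" by (intro compact_continuous_image continuous_on_subset[OF c\<gamma>]) (use t in auto)
    then have "open (?H - \<gamma> ` {0..t})"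
      by (intro open_Diff compact_imp_closed) (auto simp: upper_half_plane_def open_halfspace_Im_gt)
    moreover have "tip t \<in> ?H - \<gamma> ` {0..t}"
    proof -
      have "{0..t} = insert 0 {0<..t}" using t by auto
      moreover have "tip t \<noteq> \<gamma> 0" using tip_Im[OF t] \<gamma>0 by auto
      ultimately show ?thesis using no tip_Im[OF t] by (simp add: upper_half_plane_def)
    qed
    ultimately obtain r where r: "r > 0" "ball (tip t) r \<subseteq> ?H - \<gamma> ` {0..t}"
      unfolding open_contains_ball by blast
    then have bS: "ball (tip t) r \<subseteq> ?H - \<gamma> ` {0<..t}" by auto
    \<comment> \<open>A ball around a missed tip would contain a point off the null set of tips.
      That point lies in the component, and the connected ball then lies in it entirely, although
      its centre is a tip.\<close>
    have "negligible (tip ` {0<..t})"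
    proof (rule negligible_differentiable_image_lowdim)
      show "tip differentiable_on {0<..t}"
        unfolding differentiable_on_def
      proof
        fix s assume s: "s \<in> {0<..t}"
        then obtain D where "(tip has_vector_derivative D) (at s within {0<..T})" using tip_differentiable[of s] t by auto
        then have "(tip has_vector_derivative D) (at s within {0<..t})"
          by (rule has_vector_derivative_within_subset) (use t in auto)
        then show "tip differentiable at s within {0<..t}"
          by (auto simp: has_vector_derivative_def differentiable_def)
      qed
    qed simp
    then have "\<not> ball (tip t) r \<subseteq> tip ` {0<..t}"
      using negligible_subset open_not_negligible[OF open_ball, of "tip t" r] r(1) by auto
    then obtain p where p: "p \<in> ball (tip t) r" "p \<notin> tip ` {0<..t}" by blast
    then have pK: "p \<in> connected_component_set (?H - \<gamma> ` {0<..t}) x" using bS unfolding x[symmetric] by blast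
    have "ball (tip t) r \<subseteq> connected_component_set (?H - \<gamma> ` {0<..t}) p"
      by (rule connected_component_maximal[OF p(1) connected_ball bS])
    also have "\<dots> = connected_component_set (?H - \<gamma> ` {0<..t}) x" using connected_component_eq[OF pK] by simp
    finally have "ball (tip t) r \<subseteq> ?H - tip ` {0<..t}" unfolding x[symmetric] .
    then have "tip t \<in> ?H - tip ` {0<..t}" using centre_in_ball[of "tip t" r] r(1) by (metis subsetD)
    then show False using t by auto
  qed
  then obtain r where r: "r \<in> {0<..t}" "tip t = \<gamma> r" by blast
  have rT: "r \<in> {0<..T}" using r t by auto
  have "\<gamma> r \<in> \<gamma> ` {0<..r} \<inter> ?H" using r tip_Im[OF t] by (auto simp: upper_half_plane_def)
  then obtain s where s: "s \<in> {0<..r}" "\<gamma> r = tip s" using sub[OF rT] by blast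
  \<comment> \<open>Here \<open>s \<le> r \<le> t\<close> while \<open>tip s = tip t\<close>, so
    injectivity forces all three times to agree.\<close>
  have "s = t"
  proof (rule ccontr)
    assume "s \<noteq> t"
    then have "s < t" using s r by auto
    then show False using tip_inj[of s t] s r t by auto
  qed
  then have "r = t" using s r by auto
  with r show ?thesis by simp
qed

end

section \<open>Regularity of the generated curve\<close>

lemma hoelder_spaceI:
  fixes D :: "nat \<Rightarrow> real \<Rightarrow> 'a::real_normed_vector"
  assumes I: "compact I" and D0: "\<And>t. t \<in> I \<Longrightarrow> D 0 t = \<phi> t"
    and der: "\<And>k t. k < n \<Longrightarrow> t \<in> I \<Longrightarrow> (D k has_vector_derivative D (Suc k) t) (at t within I)"
    and cont: "\<And>k. k \<le> n \<Longrightarrow> continuous_on I (D k)"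
    and hol: "\<And>s t. s \<in> I \<Longrightarrow> t \<in> I \<Longrightarrow> norm (D n s - D n t) \<le> K * \<bar>s - t\<bar> powr \<alpha>"
  shows "hoelder_space n \<alpha> I \<phi>"
proof -
  have "bounded (\<Union>k\<in>{..n}. D k ` I)"
    by (intro bounded_UN ballI compact_imp_bounded compact_continuous_image cont I) auto
  then obtain B where B: "\<forall>x\<in>(\<Union>k\<in>{..n}. D k ` I). norm x \<le> B" unfolding bounded_iff by blast
  define M where "M = max 1 (max B K)"
  have "hoelder_space_M n \<alpha> I M \<phi>"
    unfolding hoelder_space_M_def
  proof (intro exI[of _ D] conjI ballI allI impI D0 der cont)
    show "norm (D k t) \<le> M" if "k \<le> n" "t \<in> I" for k t
    proof -
      have "norm (D k t) \<le> B" using B that by blast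
      then show ?thesis by (simp add: M_def)
    qed
    show "norm (D n t - D n s) \<le> M * \<bar>t - s\<bar> powr \<alpha>" if "s \<in> I" "t \<in> I" for s t
    proof -
      have "K * \<bar>t - s\<bar> powr \<alpha> \<le> M * \<bar>t - s\<bar> powr \<alpha>" by (intro mult_right_mono) (auto simp: M_def)
      with hol[OF that(2,1)] show ?thesis by linarith
    qed
  qed
  moreover have "M > 0" by (simp add: M_def)
  ultimately show ?thesis unfolding hoelder_space_def by blast
qed

lemma zygmund_classI:
  fixes D :: "nat \<Rightarrow> real \<Rightarrow> 'a::real_normed_vector"
  assumes I: "compact I" and D0: "\<And>t. t \<in> I \<Longrightarrow> D 0 t = \<phi> t"
    and der: "\<And>k t. k < n \<Longrightarrow> t \<in> I \<Longrightarrow> (D k has_vector_derivative D (Suc k) t) (at t within I)"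
    and cont: "\<And>k. k \<le> n \<Longrightarrow> continuous_on I (D k)"
    and zyg: "\<And>s \<delta>. \<delta> > 0 \<Longrightarrow> s - \<delta> \<in> I \<Longrightarrow> s + \<delta> \<in> I \<Longrightarrow>
      norm (D n (s + \<delta>) + D n (s - \<delta>) - 2 *\<^sub>R D n s) \<le> K * \<delta>"
  shows "zygmund_class n I \<phi>"
  unfolding zygmund_class_def
proof (intro exI[of _ D] conjI ballI allI impI D0 der cont exI[of _ K])
  show "bounded (D k ` I)" if "k \<le> n" for k
    by (intro compact_imp_bounded compact_continuous_image cont that I)
qed (use zyg in blast)+

lemma continuous_on_holder:
  fixes f :: "real \<Rightarrow> 'a::real_normed_vector"
  assumes \<alpha>: "\<alpha> > 0" and h: "\<And>s t. s \<in> S \<Longrightarrow> t \<in> S \<Longrightarrow> norm (f s - f t) \<le> K * \<bar>s - t\<bar> powr \<alpha>"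
  shows "continuous_on S f"
  unfolding continuous_on_def
proof
  fix t assume t: "t \<in> S"
  show "(f \<longlongrightarrow> f t) (at t within S)"
  proof (rule LIM_zero_cancel, rule Lim_null_comparison)
    show "\<forall>\<^sub>F s in at t within S. norm (f s - f t) \<le> K * \<bar>s - t\<bar> powr \<alpha>"
      unfolding eventually_at_filter by (rule always_eventually) (use h t in blast)
    have "((\<lambda>s. K * \<bar>s - t\<bar> powr \<alpha>) \<longlongrightarrow> K * \<bar>t - t\<bar> powr \<alpha>) (at t within S)"
      using \<alpha> by (intro tendsto_intros tendsto_powr') (auto intro!: tendsto_intros)
    then show "((\<lambda>s. K * \<bar>s - t\<bar> powr \<alpha>) \<longlongrightarrow> 0) (at t within S)" by simp
  qed
qed

section \<open>From the Hoelder class of the driving function to that of the curve\<close>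

text \<open>For integer \<beta> the exponent 0 carries no modulus of continuity. The bounded top
  derivative makes the one below Lipschitz, so the order is rewritten as \<open>n + \<alpha>\<close>
  with \<alpha> = 1.\<close>

lemma C_beta_chain:
  fixes lam :: "real \<Rightarrow> real"
  assumes T: "0 < T" and \<beta>: "\<beta> > 2" and C: "C_beta \<beta> {0..T} lam"
  obtains n \<alpha> D K where "2 \<le> n" "0 < \<alpha>" "\<alpha> \<le> 1" "\<beta> = real n + \<alpha>"
    "\<And>t. t \<in> {0..T} \<Longrightarrow> D 0 t = lam t"
    "\<And>k t. k < n \<Longrightarrow> t \<in> {0..T} \<Longrightarrow> (D k has_real_derivative D (Suc k) t) (at t within {0..T})"
    "\<And>k. k \<le> n \<Longrightarrow> continuous_on {0..T} (D k)"
    "\<And>s t. s \<in> {0..T} \<Longrightarrow> t \<in> {0..T} \<Longrightarrow> \<bar>D n s - D n t\<bar> \<le> K * \<bar>s - t\<bar> powr \<alpha>"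
proof -
  define m where "m = nat \<lfloor>\<beta>\<rfloor>"
  define \<theta> where "\<theta> = \<beta> - of_int \<lfloor>\<beta>\<rfloor>"
  have fl: "2 \<le> \<lfloor>\<beta>\<rfloor>" using \<beta> by linarith
  then have m: "2 \<le> m" "\<beta> = real m + \<theta>" using nat_mono[OF fl] by (auto simp: m_def \<theta>_def)
  have \<theta>: "0 \<le> \<theta>" "\<theta> < 1" unfolding \<theta>_def by linarith+
  obtain M where "hoelder_space_M m \<theta> {0..T} M lam"
    using C unfolding C_beta_def hoelder_space_def m_def \<theta>_def by blast
  then obtain D where D0: "\<forall>t\<in>{0..T}. D 0 t = lam t"
    and der: "\<forall>k<m. \<forall>t\<in>{0..T}. (D k has_vector_derivative D (Suc k) t) (at t within {0..T})"
    and cont: "\<forall>k\<le>m. continuous_on {0..T} (D k)"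
    and bnd: "\<forall>k\<le>m. \<forall>t\<in>{0..T}. norm (D k t) \<le> M"
    and hol: "\<forall>s\<in>{0..T}. \<forall>t\<in>{0..T}. s \<noteq> t \<longrightarrow> norm (D m t - D m s) \<le> M * \<bar>t - s\<bar> powr \<theta>"
    unfolding hoelder_space_M_def by blast
  have der': "(D k has_real_derivative D (Suc k) t) (at t within {0..T})" if "k < m" "t \<in> {0..T}" for k t
    using der that by (simp add: has_real_derivative_iff_has_vector_derivative)
  show thesis
  proof (cases "\<theta> = 0")
    case False
    have "\<bar>D m s - D m t\<bar> \<le> M * \<bar>s - t\<bar> powr \<theta>" if "s \<in> {0..T}" "t \<in> {0..T}" for s t
      using hol that by (cases "s = t") auto
    then show thesis
      by (intro that[of m \<theta> D M]) (use m \<theta> False D0 der' cont in auto)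
  next
    case True
    \<comment> \<open>Here \<beta> = m is an integer above 2, so lowering the order by one still
      leaves \<open>n \<ge> 2\<close>.\<close>
    define n where "n = m - 1"
    have n: "2 \<le> n" "m = Suc n" using m True \<beta> by (auto simp: n_def)
    have "\<bar>D n s - D n t\<bar> \<le> M * \<bar>s - t\<bar> powr 1" if st: "s \<in> {0..T}" "t \<in> {0..T}" for s t
    proof -
      have "norm (D n s - D n t) \<le> M * \<bar>s - t\<bar>"
        by (rule vector_derivative_bound[OF _ _ st, where f' = "D m"]) (use der bnd n in auto)
      then show ?thesis by simp
    qed
    then show thesis
      by (intro that[of n 1 D M]) (use n m True D0 der' cont in auto)
  qed
qed

context parameter_interval
begin

lemma rcls_of_chain:
  assumes der: "\<And>k t. k < n \<Longrightarrow> t \<in> {0..b} \<Longrightarrow> (D k has_real_derivative D (Suc k) t) (at t within {0..b})"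
    and cont: "continuous_on {0..b} (D n)"
    and hol: "\<And>s t. s \<in> {0..b} \<Longrightarrow> t \<in> {0..b} \<Longrightarrow> \<bar>D n s - D n t\<bar> \<le> K * \<bar>s - t\<bar> powr \<alpha>"
  shows "j \<le> n \<Longrightarrow> rcls j (D (n - j))"
proof (induction j)
  case 0
  show ?case unfolding rcls.simps diff_zero using cont hol by blast
next
  case (Suc j)
  then have "Suc (n - Suc j) = n - j" by simp
  with der[of "n - Suc j"] Suc show ?case by (intro rcls_SucI[of _ "D (n - j)"]) auto
qed

text \<open>Differentiating \<open>k\<close> times under the integral ends with an integrand of
  class \<open>zcls 0\<close>, to which the gain of half a derivative applies.\<close>

lemma zcls_integral_chain:
  "zcls k f \<Longrightarrow> \<exists>D g. D 0 = (\<lambda>t. integral {0..1} (\<lambda>\<rho>. f \<rho> t)) \<and>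
     (\<forall>j<k. \<forall>t\<in>{a..b}. (D j has_vector_derivative D (Suc j) t) (at t within {a..b})) \<and>
     zcls 0 g \<and> D k = (\<lambda>t. integral {0..1} (\<lambda>\<rho>. g \<rho> t))"
proof (induction k arbitrary: f)
  case 0
  then show ?case by (intro exI[of _ "\<lambda>j t. integral {0..1} (\<lambda>\<rho>. f \<rho> t)"] exI[of _ f]) auto
next
  case (Suc k)
  obtain f' where f': "tder f f'" "zcls k f'" by (rule zcls_SucE[OF Suc.prems])
  obtain D g where D: "D 0 = (\<lambda>t. integral {0..1} (\<lambda>\<rho>. f' \<rho> t))"
    "\<forall>j<k. \<forall>t\<in>{a..b}. (D j has_vector_derivative D (Suc j) t) (at t within {a..b})"
    "zcls 0 g" "D k = (\<lambda>t. integral {0..1} (\<lambda>\<rho>. g \<rho> t))"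
    using Suc.IH[OF f'(2)] by (elim exE conjE)
  define D' where "D' j = (case j of 0 \<Rightarrow> (\<lambda>t. integral {0..1} (\<lambda>\<rho>. f \<rho> t)) | Suc i \<Rightarrow> D i)" for j
  have "(D' j has_vector_derivative D' (Suc j) t) (at t within {a..b})" if "j < Suc k" "t \<in> {a..b}" for j t
  proof (cases j)
    case 0
    show ?thesis unfolding 0 D'_def
      by (simp add: D(1) tder_integral[OF f'(1) zcls_base[OF Suc.prems] zcls_imp_cls[OF f'(2)] that(2)])
  next
    case (Suc i)
    then show ?thesis using D(2) that by (simp add: D'_def)
  qed
  then show ?case using D(3,4) by (intro exI[of _ D'] exI[of _ g]) (auto simp: D'_def)
qed

lemma integral_continuous:
  assumes "cls 0 f"
  shows "continuous_on {a..b} (\<lambda>t. integral {0..1} (\<lambda>\<rho>. f \<rho> t))"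
proof -
  have eq: "Av 0 f 1 = (\<lambda>t. integral {0..1} (\<lambda>\<rho>. f \<rho> t))"
    by (rule ext) (simp add: Av_def radial_mean_def)
  obtain K where K: "K > 0" "\<And>\<rho> s t. \<rho> \<in> {0<..1} \<Longrightarrow> s \<in> {a..b} \<Longrightarrow> t \<in> {a..b} \<Longrightarrow> norm (Av 0 f \<rho> s - Av 0 f \<rho> t) \<le> K * \<bar>s - t\<bar> powr \<alpha>"
    using hol_bound[OF cls_hol[OF cls_Av[OF assms]]] by metis
  have "continuous_on {a..b} (Av 0 f 1)"
    by (rule continuous_on_holder[OF \<alpha>(1) K(2)]) auto
  then show ?thesis unfolding eq .
qed

end

text \<open>The integrals over \<rho> start at the second derivative of the tip, so the last one is
  derivative number \<open>k + 2\<close>. For \<alpha> > 1/2 the half derivative completes one more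
  full derivative and leaves the exponent \<alpha> - 1/2.\<close>

lemma (in scaled_flow) tip_regularity:
  assumes \<gamma>: "\<And>t. t \<in> {a..b} \<Longrightarrow> \<gamma> t = tip t"
  shows "\<alpha> < 1/2 \<Longrightarrow> hoelder_space (Suc (Suc k)) (\<alpha> + 1/2) {a..b} \<gamma>"
    "\<alpha> = 1/2 \<Longrightarrow> zygmund_class (Suc (Suc k)) {a..b} \<gamma>"
    "\<alpha> > 1/2 \<Longrightarrow> hoelder_space (Suc (Suc (Suc k))) (\<alpha> - 1/2) {a..b} \<gamma>"
proof -
  obtain a2 where a2: "zcls k a2"
    "\<And>t. t \<in> {a..b} \<Longrightarrow> (tip' has_vector_derivative integral {0..1} (\<lambda>\<rho>. a2 \<rho> t)) (at t within {a..b})"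
    using tip_second_derivative by metis
  obtain D0 g where D0: "D0 0 = (\<lambda>t. integral {0..1} (\<lambda>\<rho>. a2 \<rho> t))"
    "\<forall>j<k. \<forall>t\<in>{a..b}. (D0 j has_vector_derivative D0 (Suc j) t) (at t within {a..b})"
    and g: "zcls 0 g" and D0k: "D0 k = (\<lambda>t. integral {0..1} (\<lambda>\<rho>. g \<rho> t))"
    using zcls_integral_chain[OF a2(1)] by (elim exE conjE)
  define D where "D j = (case j of 0 \<Rightarrow> tip | Suc 0 \<Rightarrow> tip' | Suc (Suc i) \<Rightarrow> D0 i)" for j
  have D_simps: "D 0 = tip" "D (Suc 0) = tip'" "D (Suc (Suc i)) = D0 i" for i
    by (simp_all add: D_def)
  let ?n = "Suc (Suc k)"
  have der: "(D j has_vector_derivative D (Suc j) t) (at t within {a..b})" if "j < ?n" "t \<in> {a..b}" for j t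
  proof -
    consider "j = 0" | "j = Suc 0" | i where "j = Suc (Suc i)" by (metis not0_implies_Suc)
    then show ?thesis
    proof cases
      case 1
      then show ?thesis using tip_deriv[OF that(2)] by (simp add: D_simps)
    next
      case 2
      then show ?thesis using a2(2)[OF that(2)] by (simp add: D_simps D0(1))
    next
      case 3
      then show ?thesis using D0(2) that by (simp add: D_simps)
    qed
  qed
  have top: "D ?n = (\<lambda>t. integral {0..1} (\<lambda>\<rho>. g \<rho> t))" by (simp add: D_simps D0k)
  have cont: "continuous_on {a..b} (D j)" if "j \<le> ?n" for j
  proof (cases "j = ?n")
    case True
    show ?thesis unfolding True top by (rule integral_continuous[OF zcls_imp_cls[OF g]])
  next
    case False
    then have "j < ?n" using that by simp
    then show ?thesis using der has_vector_derivative_imp_continuous_on by blast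
  qed
  have D\<gamma>: "D 0 t = \<gamma> t" if "t \<in> {a..b}" for t using \<gamma>[OF that] by (simp add: D_simps)
  show "hoelder_space ?n (\<alpha> + 1/2) {a..b} \<gamma>" if \<alpha>2: "\<alpha> < 1/2"
  proof -
    obtain K where K: "\<forall>s\<in>{a..b}. \<forall>t\<in>{a..b}. norm (D ?n s - D ?n t) \<le> K * \<bar>s - t\<bar> powr (\<alpha> + 1/2)"
      using zcls_0_integral_regularity(1)[OF g \<alpha>2] unfolding top by blast
    show ?thesis by (rule hoelder_spaceI[where D = D and K = K]) (use D\<gamma> der cont K in auto)
  qed
  show "zygmund_class ?n {a..b} \<gamma>" if \<alpha>2: "\<alpha> = 1/2"
  proof -
    obtain K where K: "\<forall>t \<delta>. \<delta> > 0 \<and> t - \<delta> \<in> {a..b} \<and> t + \<delta> \<in> {a..b} \<longrightarrow>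
        norm (D ?n (t + \<delta>) + D ?n (t - \<delta>) - 2 *\<^sub>R D ?n t) \<le> K * \<delta>"
      using zcls_0_integral_regularity(2)[OF g \<alpha>2] unfolding top by blast
    show ?thesis by (rule zygmund_classI[where D = D and K = K]) (use D\<gamma> der cont K in auto)
  qed
  show "hoelder_space (Suc ?n) (\<alpha> - 1/2) {a..b} \<gamma>" if \<alpha>2: "\<alpha> > 1/2"
  proof -
    obtain K A where A: "\<forall>t\<in>{a..b}. (D ?n has_vector_derivative A t) (at t within {a..b})"
        "\<forall>s\<in>{a..b}. \<forall>t\<in>{a..b}. norm (A s - A t) \<le> K * \<bar>s - t\<bar> powr (\<alpha> - 1/2)"
      using zcls_0_integral_regularity(3)[OF g \<alpha>2] unfolding top by blast
    define D' where "D' j = (if j = Suc ?n then A else D j)" for j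
    have cA: "continuous_on {a..b} A"
      by (rule continuous_on_holder[where \<alpha> = "\<alpha> - 1/2" and K = K]) (use \<alpha>2 A(2) in auto)
    show ?thesis
    proof (rule hoelder_spaceI[where D = D' and K = K])
      show "(D' j has_vector_derivative D' (Suc j) t) (at t within {a..b})" if "j < Suc ?n" "t \<in> {a..b}" for j t
        using der[of j t] A(1) that by (cases "j = ?n") (auto simp: D'_def)
      show "continuous_on {a..b} (D' j)" if "j \<le> Suc ?n" for j
        using cont[of j] cA that by (cases "j = Suc ?n") (auto simp: D'_def)
    qed (use D\<gamma> A(2) in \<open>auto simp: D'_def\<close>)
  qed
qed

theorem theorem1p1:
  fixes T \<beta> :: real and lam :: "real \<Rightarrow> real" and \<gamma> :: "real \<Rightarrow> complex"
  assumes "T > 0" and "\<beta> > 2"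
    and "C_beta \<beta> {0..T} lam"
    and "loewner_generates lam T \<gamma>"
  shows "(\<beta> + 1/2 \<notin> \<nat> \<longrightarrow> (\<forall>s0\<in>{0<..<T}. C_beta (\<beta> + 1/2) {s0..T} \<gamma>)) \<and>
         (\<forall>n::nat. \<beta> + 1/2 = real n \<longrightarrow>
             (\<forall>s0\<in>{0<..<T}. zygmund_class (n - 1) {s0..T} \<gamma>))"
proof -
  obtain n \<alpha> D K where n: "2 \<le> n" and \<alpha>: "0 < \<alpha>" "\<alpha> \<le> 1" and \<beta>: "\<beta> = real n + \<alpha>"
    and D0: "\<And>t. t \<in> {0..T} \<Longrightarrow> D 0 t = lam t"
    and der: "\<And>k t. k < n \<Longrightarrow> t \<in> {0..T} \<Longrightarrow> (D k has_real_derivative D (Suc k) t) (at t within {0..T})"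
    and cont: "\<And>k. k \<le> n \<Longrightarrow> continuous_on {0..T} (D k)"
    and hol: "\<And>s t. s \<in> {0..T} \<Longrightarrow> t \<in> {0..T} \<Longrightarrow> \<bar>D n s - D n t\<bar> \<le> K * \<bar>s - t\<bar> powr \<alpha>"
    by (rule C_beta_chain[OF assms(1-3)]) (rule that)
  \<comment> \<open>\<open>k\<close> counts the derivatives of \<open>lam\<close> beyond the
    second.\<close>
  define k where "k = n - 2"
  have nk: "n = Suc (Suc k)" using n by (simp add: k_def)
  define dlam where "dlam = D 1"
  have dlam: "(lam has_real_derivative dlam t) (at t within {0..T})" if "t \<in> {0..T}" for t
  proof (rule has_field_derivative_transform_within[OF _ zero_less_one that])
    show "(D 0 has_real_derivative dlam t) (at t within {0..T})" using der[of 0 t] n that by (simp add: dlam_def)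
  qed (simp add: D0)
  have c_dlam: "continuous_on {0..T} dlam" using cont[of 1] n by (simp add: dlam_def)
  then have "bounded (dlam ` {0..T})" by (intro compact_imp_bounded compact_continuous_image) auto
  then obtain L0 where L0: "\<forall>x\<in>dlam ` {0..T}. norm x \<le> L0" unfolding bounded_iff by blast
  define L where "L = max L0 0"
  have L: "0 \<le> L" "\<bar>dlam t\<bar> \<le> L" if "t \<in> {0..T}" for t
    using L0 that by (auto simp: L_def le_max_iff_disj)
  have L': "0 \<le> L" by (simp add: L_def)
  obtain c C where cC: "0 < c" "0 < C" and flow: "\<And>t \<nu>. 0 < t \<Longrightarrow> t \<le> T \<Longrightarrow> continuous_on {0..t} \<nu> \<Longrightarrow> (\<And>s. s \<in> {0..t} \<Longrightarrow> \<bar>\<nu> s\<bar> \<le> L) \<Longrightarrow>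
      \<exists>w. continuous_on {0..t} w \<and> w 0 = 0 \<and>
        (\<forall>s\<in>{0<..<t}. (w has_vector_derivative (- 2 / w s + complex_of_real (\<nu> s))) (at s)) \<and>
        (\<forall>s\<in>{0..t}. Im (w s) \<ge> c * sqrt s \<and> norm (w s) \<le> C * sqrt s \<and>
           norm ((w s)\<^sup>2 + complex_of_real (4 * s)) \<le> C * (s * sqrt s))"
  proof (rule singular_backward_flow[OF assms(1) L'], goal_cases)
    case (1 c C)
    show thesis by (rule that[OF 1(2,3)], rule 1(4))
  qed
  define P where "P t w \<longleftrightarrow> continuous_on {0..t} w \<and> w 0 = 0 \<and>
        (\<forall>s\<in>{0<..<t}. (w has_vector_derivative (- 2 / w s + complex_of_real (dlam (t - s)))) (at s)) \<and>
        (\<forall>s\<in>{0..t}. Im (w s) \<ge> c * sqrt s \<and> norm (w s) \<le> C * sqrt s \<and>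
           norm ((w s)\<^sup>2 + complex_of_real (4 * s)) \<le> C * (s * sqrt s))" for t w
  have "\<exists>w. P t w" if t: "t \<in> {0<..T}" for t
    unfolding P_def
  proof (rule flow[of t "\<lambda>s. dlam (t - s)"])
    show "continuous_on {0..t} (\<lambda>s. dlam (t - s))"
      by (intro continuous_on_compose2[OF c_dlam] continuous_intros) (use t in auto)
  qed (use t L in auto)
  then obtain w where w: "\<And>t. t \<in> {0<..T} \<Longrightarrow> P t (w t)" by metis
  \<comment> \<open>The flows and the constants \<open>c\<close> and \<open>C\<close> were chosen
    for all times in \<open>{0<..T}\<close> beforehand, so the same data serve every
    \<open>s0\<close>.\<close>
  have scaled: "scaled_flow s0 T \<alpha> k lam dlam w c C" if s0: "s0 \<in> {0<..<T}" for s0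
  proof -
    interpret parameter_interval s0 T \<alpha> by unfold_locales (use s0 \<alpha> in auto)
    have "rcls (Suc k) (D (n - Suc k))"
      by (rule rcls_of_chain[OF der cont[OF order_refl] hol]) (use nk in auto)
    then have r: "rcls (Suc k) dlam" by (simp add: nk dlam_def)
    have t0: "t \<in> {s0..T} \<Longrightarrow> t \<in> {0<..T}" for t using s0 by auto
    show ?thesis
      by unfold_locales (use dlam r w[OF t0] cC in \<open>auto simp: P_def\<close>)
  qed
  define \<tau> where "\<tau> t = complex_of_real (lam 0) + w t t" for t
  have tip: "scaled_flow.tip lam w = \<tau>" if "s0 \<in> {0<..<T}" for s0
    using scaled_flow.tip_def[OF scaled[OF that]] by (auto simp: \<tau>_def)
  have diff: "\<exists>E. (\<tau> has_vector_derivative E) (at t within {0<..T})" if t: "t \<in> {0<..T}" for t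
  proof -
    \<comment> \<open>The tip does not depend on the left end of the interval; starting at
      \<open>t / 2\<close> puts \<open>t\<close> at positive distance from it.\<close>
    have s0: "t / 2 \<in> {0<..<T}" using t by auto
    have "(\<tau> has_vector_derivative scaled_flow.tip' dlam w t) (at t within {t / 2..T})"
      using scaled_flow.tip_deriv[OF scaled[OF s0], of t] t unfolding tip[OF s0] by auto
    moreover have "at t within {t / 2..T} = at t within {0<..T}"
      by (rule at_within_nhd[of _ "{t / 2<..}"]) (use t in auto)
    ultimately show ?thesis by auto
  qed
  interpret loewner_flow T L c C lam dlam w
    by unfold_locales (use assms(1) L L' cC dlam w in \<open>auto simp: P_def\<close>)
  have tip_eq: "tip = \<tau>" by (rule ext) (simp add: tip_def \<tau>_def)
  interpret loewner_flow_diff T L c C lam dlam w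
    by unfold_locales (unfold tip_eq, rule diff)
  have \<gamma>: "\<gamma> t = \<tau> t" if "t \<in> {0<..T}" for t
    using generated_curve_eq_tip[OF assms(4) that] by (simp add: tip_eq)
  have reg: "\<alpha> < 1/2 \<Longrightarrow> hoelder_space n (\<alpha> + 1/2) {s0..T} \<gamma>"
    "\<alpha> = 1/2 \<Longrightarrow> zygmund_class n {s0..T} \<gamma>"
    "\<alpha> > 1/2 \<Longrightarrow> hoelder_space (Suc n) (\<alpha> - 1/2) {s0..T} \<gamma>" if s0: "s0 \<in> {0<..<T}" for s0
  proof -
    have "\<gamma> t = scaled_flow.tip lam w t" if "t \<in> {s0..T}" for t
      unfolding tip[OF s0] by (rule \<gamma>) (use that s0 in auto)
    from scaled_flow.tip_regularity[OF scaled[OF s0] this]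
    show "\<alpha> < 1/2 \<Longrightarrow> hoelder_space n (\<alpha> + 1/2) {s0..T} \<gamma>"
      "\<alpha> = 1/2 \<Longrightarrow> zygmund_class n {s0..T} \<gamma>"
      "\<alpha> > 1/2 \<Longrightarrow> hoelder_space (Suc n) (\<alpha> - 1/2) {s0..T} \<gamma>"
      unfolding nk by blast+
  qed
  show ?thesis
  proof (intro conjI impI allI ballI)
    fix s0 assume nat: "\<beta> + 1/2 \<notin> \<nat>" and s0: "s0 \<in> {0<..<T}"
    have "\<alpha> \<noteq> 1/2"
    proof
      assume "\<alpha> = 1/2"
      then have "\<beta> + 1/2 = of_nat (Suc n)" by (simp add: \<beta>)
      with nat show False by (metis of_nat_in_Nats)
    qed
    then consider "\<alpha> < 1/2" | "\<alpha> > 1/2" by linarith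
    then show "C_beta (\<beta> + 1/2) {s0..T} \<gamma>"
    proof cases
      case 1
      have "\<lfloor>\<beta> + 1/2\<rfloor> = int n" by (rule floor_unique) (use 1 \<alpha> in \<open>auto simp: \<beta>\<close>)
      then show ?thesis using reg(1)[OF s0 1] by (simp add: C_beta_def \<beta> add.assoc)
    next
      case 2
      have fl: "\<lfloor>\<beta> + 1/2\<rfloor> = int (Suc n)" by (rule floor_unique) (use 2 \<alpha> in \<open>auto simp: \<beta>\<close>)
      have \<alpha>': "\<beta> + 1/2 - real (Suc n) = \<alpha> - 1/2" by (simp add: \<beta>)
      show ?thesis unfolding C_beta_def fl of_int_of_nat_eq \<alpha>' nat_int by (rule reg(3)[OF s0 2])
    qed
  next
    fix m :: nat and s0 assume m: "\<beta> + 1/2 = real m" and s0: "s0 \<in> {0<..<T}"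
    \<comment> \<open>Since \<alpha> + 1/2 lies strictly between 0 and 2, the integer
      \<open>m = n + \<alpha> + 1/2\<close> can only be \<open>n + 1\<close>, which forces \<alpha>
      = 1/2.\<close>
    have "real n < real m" "real m < real (n + 2)" using m \<alpha> by (auto simp: \<beta>)
    then have "m = Suc n" by linarith
    then have "\<alpha> = 1/2" "m - 1 = n" using m by (auto simp: \<beta>)
    then show "zygmund_class (m - 1) {s0..T} \<gamma>" using reg(2)[OF s0] by simp
  qed
qed

end
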